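(* Let $\varepsilon>0$ be a constant, let $k\geq 2$ be an integer and let $\mathcal{P}$ be a monotone increasing graph property. Let $G$ be a graph on $n$ vertices with minimum degree $\delta(G)=\omega(\log n)$, and let $p\in(0,1]$ be such that $p=\omega\left(\frac{\log n}{\delta(G)}\right)$. Put $t:=(1-\varepsilon)\frac{\delta(G)p}{2k}$. Then w.h.p. a random edge-colored graph $H\sim \mathcal G_{kn}(G,p)$ can be generated as $H=H_0\cup H_1\cup\dots\cup H_t$ such that the following holds: (i) $H_0,H_1,\ldots,H_t$ are edge-disjoint subgraphs of $H$; (ii) the number of the subgraphs $H_1,\dots,H_t$ is $t=(1-\varepsilon)\frac{\delta(G)p}{2k}$; (iii) for every $1\leq i\leq t$, $E(H_i)$ is rainbow; (iv) for every $1\leq i\leq t$, $\Pr\left[\mathcal G_{k\text{-out}}(G)\models \mathcal{P}\right]\leq \Pr\left[H_i\models \mathcal{P}\right]+n^{-\omega(1)}$.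
   Context: All asymptotic notation is as $n\to\infty$: $G=G_n$ and $p=p_n$ form sequences indexed by $n$, while $k$ and $\varepsilon$ are fixed. "W.h.p." means with probability tending to $1$ as $n\to\infty$. $f=\omega(g)$ means $f/g\to\infty$, and $n^{-\omega(1)}$ denotes an error term that is eventually smaller than $n^{-C}$ for every constant $C$ (uniformly in $i$). The quantity $t$ is understood to be rounded down to an integer. "W.h.p. $H\sim\mathcal G_{kn}(G,p)$ can be generated as $H=H_0\cup\dots\cup H_t$ such that (i)-(iv)" means: there is a probability space carrying a random edge-colored graph $H\sim \mathcal G_{kn}(G,p)$ together with random subgraphs $H_0,\dots,H_t$ of $G$ such that, with probability tending to $1$, $H=H_0\cup\dots\cup H_t$ and (i) and (iii) hold (each $H_i$ inheriting the edge colors of $H$), while each of the random graphs $H_1,\dots,H_t$ satisfies the inequality (iv) between probabilities. Definitions. For a graph $G$, $p\in[0,1]$ and a positive integer $c$, $\mathcal G_c(G,p)$ is the probability space of edge-colored graphs obtained by keeping each edge of $G$ independently with probability $p$ and then coloring each kept edge independently and uniformly at random with a color from $[c]=\{1,\dots,c\}$. A set of edges is rainbow if all its elements have distinct colors. For $k\le\delta(G)$, $\mathcal G_{k\text{-out}}(G)$ is the distribution of the random subgraph of $G$ on vertex set $V(G)$ obtained as follows: each vertex $v\in V(G)$, independently of the others, chooses $k$ (distinct) out-neighbors uniformly at random among its neighbors in $G$; then orientations and multiple edges are ignored. A graph property is monotone increasing if it is preserved under adding edges (on the same vertex set). $H\models\mathcal P$ means that $H$ satisfies $\mathcal P$ (colors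 are ignored), and $\Pr[\mathcal G\models\mathcal P]$ denotes the probability that a random element of the probability space $\mathcal G$ satisfies $\mathcal P$. *)

theory Defs
  imports "HOL-Probability.Probability" "HOL-Library.Landau_Symbols" "HOL-Library.Disjoint_Sets"
begin

type_synonym 'v ugraph = "'v set \<times> 'v set set"

abbreviation verts :: "'v ugraph \<Rightarrow> 'v set" where
  "verts G \<equiv> fst G"

abbreviation edges :: "'v ugraph \<Rightarrow> 'v set set" where
  "edges G \<equiv> snd G"

definition simple_graph :: "'v ugraph \<Rightarrow> bool" where
  "simple_graph G \<longleftrightarrow> finite (verts G) \<and> edges G \<subseteq> {e. e \<subseteq> verts G \<and> card e = 2}"

definition neighbors :: "'v ugraph \<Rightarrow> 'v \<Rightarrow> 'v set" where
  "neighbors G v = {u. {v, u} \<in> edges G}"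

text \<open>For the graph without vertices the value is unspecified.\<close>
definition min_degree :: "'v ugraph \<Rightarrow> nat" where
  "min_degree G = Min ((\<lambda>v. card (neighbors G v)) ` verts G)"

definition monotone_increasing :: "('v ugraph \<Rightarrow> bool) \<Rightarrow> bool" where
  "monotone_increasing P \<longleftrightarrow>
     (\<forall>G G'. simple_graph G \<and> simple_graph G' \<and> verts G = verts G' \<and> edges G \<subseteq> edges G'
        \<and> P G \<longrightarrow> P G')"

text \<open>An edge-colored spanning subgraph is a partial map from edges to colors; its domain is
  the set of edges that are present.\<close>
type_synonym 'v colored_graph = "'v set \<rightharpoonup> nat"

definition rainbow :: "'v colored_graph \<Rightarrow> 'v set set \<Rightarrow> bool" where
  "rainbow H S \<longleftrightarrow> S \<subseteq> dom H \<and> inj_on H S"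

definition random_colored_subgraph :: "nat \<Rightarrow> 'v ugraph \<Rightarrow> real \<Rightarrow> 'v colored_graph pmf" where
  "random_colored_subgraph c G p =
     bind_pmf (Pi_pmf (edges G) False (\<lambda>_. bernoulli_pmf p))
       (\<lambda>keep. Pi_pmf {e \<in> edges G. keep e} None (\<lambda>_. map_pmf Some (pmf_of_set {1..c})))"

text \<open>Meaningful only if \<open>k\<close> is at most the minimum degree: otherwise \<open>pmf_of_set\<close> is
  applied to the empty set for some vertex.\<close>
definition k_out :: "nat \<Rightarrow> 'v ugraph \<Rightarrow> 'v ugraph pmf" where
  "k_out k G =
     map_pmf (\<lambda>out. (verts G, {{v, u} |v u. v \<in> verts G \<and> u \<in> out v}))
       (Pi_pmf (verts G) {} (\<lambda>v. pmf_of_set {S. S \<subseteq> neighbors G v \<and> card S = k}))"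

text \<open>An error term of the form \<open>n\<close> to the power \<open>-\<omega>(1)\<close>.\<close>
definition superpolynomially_small :: "(nat \<Rightarrow> real) \<Rightarrow> bool" where
  "superpolynomially_small err \<longleftrightarrow>
     (\<forall>C::real. eventually (\<lambda>n. \<bar>err n\<bar> < real n powr (- C)) sequentially)"

end

theory Submission
  imports Defs "HOL-Combinatorics.Multiset_Permutations"
begin

text \<open>
  Split \<open>H\<close> at random into a bounded number of sparse random graphs. In a sparse one, every vertex
  \<open>u\<close> collects a pool of edges such that the pools are disjoint, and each pool is ordered at random.
  Its edges have independent uniform colours, so by Hall's theorem the positions in the pools can
  be distributed among the rounds in such a way that every vertex gets \<open>k\<close> positions in each round
  and each round uses every colour once. The distribution depends on the colours only, so the
  round then consists of a uniform \<open>k\<close>-subset of each pool.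

  The difficulty is that \<open>k\<close>-out choices are independent, while an edge that one end uses in some
  round is lost for the other end in all other rounds. Process the vertices in a fixed order. A
  vertex \<open>u\<close> announces in advance a set \<open>B\<close> of neighbours that are permitted to take their edge to
  \<open>u\<close>; later vertices may use only such edges, and \<open>u\<close> itself uses the others. If \<open>B\<close> is a binomial
  random set minus an independent uniform \<open>k\<close>-set, then, given the choice \<open>S\<close> of \<open>u\<close> in one round,
  \<open>B\<close> is a binomial subset of the complement of \<open>S\<close>. On \<open>S\<close> itself the round may toss fresh
  coins, since an edge already chosen by \<open>u\<close> may be chosen again by its other end at no cost.
  Hence, in the view of one round, later vertices see independent coins, and the round contains an
  exact random \<open>k\<close>-out graph unless some pool is too small.\<close>

section \<open>Disjoint perfect matchings\<close>

text \<open>(iv) tolerates only a superpolynomially small error, but the probability that the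
  colours admit no rainbow assignment is only bounded by a multiple of 1/n. So this failure must not
  enter (iv): colours are attached to positions and drawn before the graph, and the positions used
  by a round form a legitimate assignment for all colours, rainbow or not. Given any colours, a
  round reads fixed positions of randomly ordered pools, and the error in (iv) comes from small
  pools alone. The splitting serves the constant. An edge decided by two coins of probability
  \<open>a\<close> is present with probability \<open>2 * a - a * a\<close>, and a fair share of it
  for each end is half of that; but a neighbour lies in the pool of \<open>u\<close> with
  probability of about \<open>a * (1 - a)\<close> only. The two agree up to a factor close to 1 only
  if \<open>a\<close> is small. Pools of about \<open>\<delta> * p / 2\<close> edges in total,
  \<open>k\<close> of them per round, give the value of \<open>t\<close>. There are as many slots as
  colours, \<open>k\<close> for each of the \<open>n\<close> vertices, so a rainbow round is a
  perfect matching between slots and colours.\<close>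

lemma hall_marriage:
  fixes A :: "'i \<Rightarrow> 'a set"
  assumes "finite I" "\<And>i. i \<in> I \<Longrightarrow> finite (A i)"
    and "\<And>J. J \<subseteq> I \<Longrightarrow> card J \<le> card (\<Union>(A ` J))"
  shows "\<exists>f. (\<forall>i\<in>I. f i \<in> A i) \<and> inj_on f I"
  using assms
proof (induction "card I" arbitrary: I A rule: less_induct)
  case less
  have finU: "finite (\<Union>(A ` J))" if "J \<subseteq> I" for J
    using that less.prems(1,2) finite_subset by blast
  show ?case
  \<comment> \<open>Halmos-Vaughan dichotomy. If a nonempty proper \<open>J\<close> is tight, it is
    matched within its own neighbourhood, and Hall's condition survives for \<open>I - J\<close>
    once that neighbourhood is deleted. Otherwise every nonempty proper subset has a neighbour to
    spare, so one pair can be fixed at will.\<close>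
  proof (cases "\<exists>J. J \<subset> I \<and> J \<noteq> {} \<and> card J = card (\<Union>(A ` J))")
    case True
    then obtain J where J: "J \<subset> I" "J \<noteq> {}" "card J = card (\<Union>(A ` J))" by blast
    have finJ: "finite J" using J less.prems(1) finite_subset by blast
    have cJ: "card J < card I" using J(1) less.prems(1) by (rule psubset_card_mono[rotated])
    have "\<exists>f. (\<forall>i\<in>J. f i \<in> A i) \<and> inj_on f J"
    proof (rule less.hyps[of J A, OF cJ finJ])
      show "finite (A i)" if "i \<in> J" for i using that J(1) less.prems(2) by blast
      show "card K \<le> card (\<Union>(A ` K))" if "K \<subseteq> J" for K using that J(1) by (intro less.prems(3)) blast
    qed
    then obtain f where f: "\<forall>i\<in>J. f i \<in> A i" "inj_on f J" by blast
    define A' where "A' i = A i - \<Union>(A ` J)" for i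
    have cIJ: "card (I - J) < card I"
      using J less.prems(1) by (intro psubset_card_mono) auto
    have condK: "card K \<le> card (\<Union>(A' ` K))" if K: "K \<subseteq> I - J" for K
    proof -
      have finK: "finite K" using K less.prems(1) finite_subset by blast
      have "card K + card J = card (K \<union> J)"
        using K finK finJ by (intro card_Un_disjoint[symmetric]) auto
      also have "\<dots> \<le> card (\<Union>(A ` (K \<union> J)))" using K J by (intro less.prems(3)) auto
      also have "\<Union>(A ` (K \<union> J)) = \<Union>(A' ` K) \<union> \<Union>(A ` J)" by (auto simp: A'_def)
      also have "card \<dots> \<le> card (\<Union>(A' ` K)) + card (\<Union>(A ` J))" by (rule card_Un_le)
      finally show ?thesis using J(3) by simp
    qed
    have "\<exists>g. (\<forall>i\<in>I - J. g i \<in> A' i) \<and> inj_on g (I - J)"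
      proof (rule less.hyps[of "I - J" A', OF cIJ])
      show "finite (I - J)" using less.prems(1) by simp
      show "finite (A' i)" if "i \<in> I - J" for i
        unfolding A'_def by (rule finite_Diff, rule less.prems(2)) (use that in blast)
    qed (rule condK)
    then obtain g where "(\<forall>i\<in>I - J. g i \<in> A' i) \<and> inj_on g (I - J)" ..
    then have g: "\<forall>i\<in>I-J. g i \<in> A' i" "inj_on g (I - J)" by simp_all
    have "f ` J \<inter> g ` (I - J) = {}"
    proof (intro equals0I)
      fix z assume "z \<in> f ` J \<inter> g ` (I - J)"
      then obtain i j where "i \<in> J" "z = f i" "j \<in> I - J" "z = g j" by auto
      then have "z \<in> A i" "z \<in> A' j" using bspec[OF f(1)] bspec[OF g(1)] by metis+
      then show False using \<open>i \<in> J\<close> by (auto simp: A'_def)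
    qed
    from inj_on_disjoint_Un[OF f(2) g(2) this]
    have "inj_on (\<lambda>i. if i \<in> J then f i else g i) (J \<union> (I - J))" .
    moreover have "J \<union> (I - J) = I" using J(1) by blast
    ultimately have "inj_on (\<lambda>i. if i \<in> J then f i else g i) I" by simp
    moreover have "\<forall>i\<in>I. (if i \<in> J then f i else g i) \<in> A i"
      using f g by (auto simp: A'_def)
    ultimately show ?thesis by (intro exI[of _ "\<lambda>i. if i \<in> J then f i else g i"]) simp
  next
    case nt: False
    show ?thesis
    proof (cases "I = {}")
      case True
      then show ?thesis by auto
    next
      case False
      then obtain i where i: "i \<in> I" by blast
      have "A i \<noteq> {}" using less.prems(3)[of "{i}"] i by auto
      then obtain x where x: "x \<in> A i" by blast
      define A' where "A' j = A j - {x}" for j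
      have cIi: "card (I - {i}) < card I" using i less.prems(1) by (rule card_Diff1_less[rotated])
      have condK: "card K \<le> card (\<Union>(A' ` K))" if K: "K \<subseteq> I - {i}" for K
      proof (cases "K = {}")
        case False
        have "K \<subset> I" using K i by blast
        then have "card K \<noteq> card (\<Union>(A ` K))" using nt False by blast
        then have "card K < card (\<Union>(A ` K))" using less.prems(3)[of K] K by force
        moreover have eq: "\<Union>(A' ` K) = \<Union>(A ` K) - {x}" by (auto simp: A'_def)
        moreover have "card (\<Union>(A ` K)) - 1 \<le> card (\<Union>(A ` K) - {x})"
          by (simp add: card_Diff_singleton_if)
        ultimately show ?thesis unfolding eq by linarith
      qed simp
      have "\<exists>g. (\<forall>j\<in>I - {i}. g j \<in> A' j) \<and> inj_on g (I - {i})"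
      proof (rule less.hyps[of "I - {i}" A', OF cIi])
        show "finite (I - {i})" using less.prems(1) by simp
        show "finite (A' j)" if "j \<in> I - {i}" for j
          unfolding A'_def by (rule finite_Diff, rule less.prems(2)) (use that in blast)
      qed (rule condK)
      then obtain g where "(\<forall>j\<in>I - {i}. g j \<in> A' j) \<and> inj_on g (I - {i})" ..
      then have g: "\<forall>j\<in>I-{i}. g j \<in> A' j" "inj_on g (I - {i})" by simp_all
      have "inj_on (g(i := x)) I" using g i
        by (auto simp: inj_on_def A'_def)
      moreover have "\<forall>j\<in>I. (g(i := x)) j \<in> A j" using g x by (auto simp: A'_def)
      ultimately show ?thesis by (intro exI[of _ "g(i := x)"]) simp
    qed
  qed
qed

text \<open>Positions are the edges of a bipartite multigraph between slots and colours; parallel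
  edges occur, so they cannot be encoded as pairs. A regular bipartite multigraph satisfies Hall's
  condition by double counting, and removing a perfect matching lowers the degree by one
  everywhere.\<close>

lemma regular_matchings:
  fixes slot :: "'p \<Rightarrow> 's" and col :: "'p \<Rightarrow> 'c"
  assumes "finite F" "finite L" "finite C" "card L = card C"
    and "slot ` F \<subseteq> L" "col ` F \<subseteq> C"
    and "\<And>s. s \<in> L \<Longrightarrow> card {p\<in>F. slot p = s} = t"
    and "\<And>c. c \<in> C \<Longrightarrow> card {p\<in>F. col p = c} = t"
  shows "\<exists>g :: nat \<Rightarrow> 's \<Rightarrow> 'p.
           (\<forall>i<t. (\<forall>s\<in>L. g i s \<in> F \<and> slot (g i s) = s) \<and> inj_on (\<lambda>s. col (g i s)) L) \<and>
           (\<forall>i<t. \<forall>j<t. \<forall>s\<in>L. i \<noteq> j \<longrightarrow> g i s \<noteq> g j s)"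
  using assms
proof (induction t arbitrary: F)
  case 0
  then show ?case by auto
next
  case (Suc t)
  note fin = Suc.prems(1-3)
  define N where "N s = col ` {p\<in>F. slot p = s}" for s
  have "card X \<le> card (\<Union>(N ` X))" if X: "X \<subseteq> L" for X
  proof -
    have finX: "finite X" using X fin finite_subset by blast
    have finN: "finite (\<Union>(N ` X))" using finX fin by (auto simp: N_def)
    have NC: "\<Union>(N ` X) \<subseteq> C" using Suc.prems(6) by (auto simp: N_def)
    have "Suc t * card X = (\<Sum>s\<in>X. card {p\<in>F. slot p = s})"
      using X Suc.prems(7) by (simp add: subset_iff)
    also have "\<dots> = card (\<Union>s\<in>X. {p\<in>F. slot p = s})"
      using finX fin by (intro card_UN_disjoint[symmetric]) auto
    also have "\<dots> \<le> card (\<Union>c\<in>\<Union>(N ` X). {p\<in>F. col p = c})"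
      using finX fin by (intro card_mono) (auto simp: N_def)
    also have "\<dots> \<le> (\<Sum>c\<in>\<Union>(N ` X). card {p\<in>F. col p = c})"
      using finN by (rule card_UN_le)
    also have "\<dots> = Suc t * card (\<Union>(N ` X))"
      using NC Suc.prems(8) by (simp add: subset_iff)
    finally show ?thesis by (simp only: Suc_mult_le_cancel1)
  qed
  then obtain f where f: "\<forall>s\<in>L. f s \<in> N s" "inj_on f L"
    using hall_marriage[of L N] fin by (auto simp: N_def)
  then have "\<forall>s\<in>L. \<exists>p. p \<in> F \<and> slot p = s \<and> col p = f s" unfolding N_def by (simp add: image_iff) metis
  from bchoice[OF this] obtain h
    where h: "\<And>s. s \<in> L \<Longrightarrow> h s \<in> F \<and> slot (h s) = s \<and> col (h s) = f s" by auto
  have "f ` L \<subseteq> C"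
  proof
    fix c assume "c \<in> f ` L"
    then obtain s where "s \<in> L" "c = col (h s)" "h s \<in> F" using h by force
    then show "c \<in> C" using Suc.prems(6) by blast
  qed
  then have fC: "f ` L = C"
    using f(2) Suc.prems(4) fin(3) by (intro card_subset_eq) (simp_all add: card_image)
  define F' where "F' = F - h ` L"
  have F'1: "card {p\<in>F'. slot p = s} = t" if s: "s \<in> L" for s
  proof -
    have "{p\<in>F'. slot p = s} = {p\<in>F. slot p = s} - {h s}" using h s by (auto simp: F'_def)
    then show ?thesis using Suc.prems(7)[OF s] h[OF s] fin by simp
  qed
  have F'2: "card {p\<in>F'. col p = c} = t" if c: "c \<in> C" for c
  proof -
    from c fC obtain s where s: "s \<in> L" "f s = c" by auto
    have "{p\<in>F'. col p = c} = {p\<in>F. col p = c} - {h s}"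
      using h s f(2) by (auto simp: F'_def inj_on_def)
    then show ?thesis using Suc.prems(8)[OF c] h[OF s(1)] s fin by simp
  qed
  have F'3: "finite F'" "slot ` F' \<subseteq> L" "col ` F' \<subseteq> C" using Suc.prems by (auto simp: F'_def)
  have "\<exists>g :: nat \<Rightarrow> 's \<Rightarrow> 'p.
      (\<forall>i<t. (\<forall>s\<in>L. g i s \<in> F' \<and> slot (g i s) = s) \<and> inj_on (\<lambda>s. col (g i s)) L) \<and>
      (\<forall>i<t. \<forall>j<t. \<forall>s\<in>L. i \<noteq> j \<longrightarrow> g i s \<noteq> g j s)"
    by (rule Suc.IH[OF F'3(1) fin(2,3) Suc.prems(4) F'3(2,3)]) (simp_all add: F'1 F'2)
  then obtain g where g:
    "\<forall>i<t. (\<forall>s\<in>L. g i s \<in> F' \<and> slot (g i s) = s) \<and> inj_on (\<lambda>s. col (g i s)) L"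
    "\<forall>i<t. \<forall>j<t. \<forall>s\<in>L. i \<noteq> j \<longrightarrow> g i s \<noteq> g j s"
    by (elim exE conjE) (rule that)
  define g' where "g' i = (if i = t then h else g i)" for i
  have "inj_on (\<lambda>s. col (h s)) L" using f(2) h by (auto simp: inj_on_def)
  then have "\<forall>i<Suc t. (\<forall>s\<in>L. g' i s \<in> F \<and> slot (g' i s) = s) \<and> inj_on (\<lambda>s. col (g' i s)) L"
    using g(1) h by (auto simp: g'_def F'_def less_Suc_eq)
  moreover have "\<forall>i<Suc t. \<forall>j<Suc t. \<forall>s\<in>L. i \<noteq> j \<longrightarrow> g' i s \<noteq> g' j s"
  proof (intro allI impI ballI)
    fix i j s assume ij: "i < Suc t" "j < Suc t" "s \<in> L" "i \<noteq> j"
    have "g l s \<noteq> h s" if "l < t" for l using g(1) that ij(3) by (auto simp: F'_def)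
    note ne = this
    have "g i s \<noteq> g j s" if "i < t" "j < t" using that g(2) ij by blast
    then show "g' i s \<noteq> g' j s" using ij ne[of i] ne[of j] by (auto simp: g'_def less_Suc_eq)
  qed
  ultimately show ?case by blast
qed

text \<open>Each slot receives \<open>N - t\<close> dummy partners; a perfect matching of the positions with the
  dummies and \<open>t\<close> copies of every colour leaves exactly \<open>t\<close> positions per slot for the colours.\<close>
lemma regular_factor:
  fixes slot :: "'p \<Rightarrow> 's" and col :: "'p \<Rightarrow> 'c"
  assumes fin: "finite P" "finite L" "finite C" and LC: "card L = card C"
    and slotL: "slot ` P \<subseteq> L" and slotN: "\<And>s. s \<in> L \<Longrightarrow> card {p\<in>P. slot p = s} = N" and tN: "t \<le> N"
    and cond: "\<And>X Y. X \<subseteq> L \<Longrightarrow> Y \<subseteq> C \<Longrightarrow>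
        t * card X + t * card Y \<le> t * card L + card {p\<in>P. slot p \<in> X \<and> col p \<in> Y}"
  shows "\<exists>F\<subseteq>P. col ` F \<subseteq> C \<and> (\<forall>s\<in>L. card {p\<in>F. slot p = s} = t) \<and> (\<forall>c\<in>C. card {p\<in>F. col p = c} = t)"
proof -
  define IC where "IC = C \<times> {..<t}"
  define ID where "ID = L \<times> {..<N-t}"
  define I :: "(('c \<times> nat) + ('s \<times> nat)) set" where "I = Inl ` IC \<union> Inr ` ID"
  define A where "A i = (case i of Inl (c, _) \<Rightarrow> {p\<in>P. col p = c} | Inr (s, _) \<Rightarrow> {p\<in>P. slot p = s})"
    for i :: "('c \<times> nat) + ('s \<times> nat)"
  have finI: "finite I" using fin by (auto simp: I_def IC_def ID_def)
  have cardslots: "card {p\<in>P. slot p \<in> X} = N * card X" if "X \<subseteq> L" for X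
  proof -
    have "finite X" using that fin finite_subset by blast
    have "card {p\<in>P. slot p \<in> X} = card (\<Union>s\<in>X. {p\<in>P. slot p = s})" by (rule arg_cong[of _ _ card]) auto
    also have "\<dots> = (\<Sum>s\<in>X. card {p\<in>P. slot p = s})"
      using \<open>finite X\<close> fin by (intro card_UN_disjoint) auto
    also have "\<dots> = N * card X" using that slotN by (simp add: subset_iff)
    finally show ?thesis .
  qed
  have cardP: "card P = N * card L"
  proof -
    have "{p\<in>P. slot p \<in> L} = P" using slotL by auto
    then show ?thesis using cardslots[of L] by simp
  qed
  have "card J \<le> card (\<Union>(A ` J))" if J: "J \<subseteq> I" for J
  proof -
    define Y where "Y = fst ` (Inl -` J)"
    define X where "X = fst ` (Inr -` J)"
    have XY: "X \<subseteq> L" "Y \<subseteq> C" using J by (auto simp: X_def Y_def I_def IC_def ID_def)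
    have finXY: "finite X" "finite Y" using XY fin finite_subset by blast+
    have "J \<subseteq> Inl ` (Y \<times> {..<t}) \<union> Inr ` (X \<times> {..<N-t})"
    proof
      fix j assume j: "j \<in> J"
      then have "j \<in> I" using J by auto
      then show "j \<in> Inl ` (Y \<times> {..<t}) \<union> Inr ` (X \<times> {..<N-t})"
        using j by (auto simp: I_def IC_def ID_def X_def Y_def image_iff) (metis fst_conv vimageI)+
    qed
    then have "card J \<le> card (Inl ` (Y \<times> {..<t}) \<union> Inr ` (X \<times> {..<N-t}))"
      using finXY by (intro card_mono) auto
    also have "\<dots> \<le> card (Y \<times> {..<t}) + card (X \<times> {..<N-t})"
      by (rule order_trans[OF card_Un_le]) (simp add: card_image)
    finally have 1: "card J \<le> t * card Y + (N - t) * card X"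
      by (simp add: card_cartesian_product mult.commute)
    \<comment> \<open>Hall's condition for the dummies of the slots \<open>X\<close> and the copies
      of the colours \<open>Y\<close>: their partners are all positions in \<open>X\<close>, and
      those outside \<open>X\<close> with a colour in \<open>Y\<close>. This is \<open>cond\<close>
      for the complementary set of slots.\<close>
    have 2: "t * card (L - X) + t * card Y \<le> t * card L + card {p\<in>P. slot p \<in> L - X \<and> col p \<in> Y}"
      using XY by (intro cond) auto
    have "card (L - X) + card X = card L"
      using XY fin finXY by (simp add: card_Diff_subset card_mono)
    then have "t * card (L - X) + t * card X = t * card L" by (metis add_mult_distrib2)
    then have 4: "t * card Y \<le> t * card X + card {p\<in>P. slot p \<in> L - X \<and> col p \<in> Y}"
      using 2 by linarith
    have "card {p\<in>P. slot p \<in> X} + card {p\<in>P. slot p \<in> L - X \<and> col p \<in> Y}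
        = card ({p\<in>P. slot p \<in> X} \<union> {p\<in>P. slot p \<in> L - X \<and> col p \<in> Y})"
      using fin by (intro card_Un_disjoint[symmetric]) auto
    also have "\<dots> \<le> card (\<Union>(A ` J))"
    proof (rule card_mono)
      have "\<Union>(A ` J) \<subseteq> P" by (auto simp: A_def split: sum.splits)
      then show "finite (\<Union>(A ` J))" using fin(1) by (rule finite_subset)
      show "{p \<in> P. slot p \<in> X} \<union> {p \<in> P. slot p \<in> L - X \<and> col p \<in> Y} \<subseteq> \<Union> (A ` J)"
        by (force simp: X_def Y_def A_def)
    qed
    finally have "N * card X + card {p\<in>P. slot p \<in> L - X \<and> col p \<in> Y} \<le> card (\<Union>(A ` J))"
      using cardslots XY by simp
    moreover have "N * card X = t * card X + (N - t) * card X" using tN by (simp add: diff_mult_distrib)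
    ultimately show ?thesis using 1 4 by linarith
  qed
  moreover have "finite (A i)" if "i \<in> I" for i using fin by (auto simp: A_def split: sum.splits)
  ultimately obtain \<phi> where \<phi>: "\<forall>i\<in>I. \<phi> i \<in> A i" "inj_on \<phi> I"
    using hall_marriage[of I A] finI by blast
  have \<phi>C: "\<phi> (Inl (c, i)) \<in> P \<and> col (\<phi> (Inl (c, i))) = c" if "c \<in> C" "i < t" for c i
    using \<phi>(1) that by (force simp: I_def IC_def A_def)
  have \<phi>D: "\<phi> (Inr (s, i)) \<in> P \<and> slot (\<phi> (Inr (s, i))) = s" if "s \<in> L" "i < N - t" for s i
    using \<phi>(1) that by (force simp: I_def ID_def A_def)
  have "card I = card (Inl ` IC :: (('c \<times> nat) + ('s \<times> nat)) set) + card (Inr ` ID :: (('c \<times> nat) + ('s \<times> nat)) set)"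
    unfolding I_def using fin by (intro card_Un_disjoint) (auto simp: IC_def ID_def)
  also have "\<dots> = t * card C + (N - t) * card L"
    by (simp add: card_image card_cartesian_product IC_def ID_def mult.commute)
  also have "\<dots> = card P" using LC tN cardP by (simp add: diff_mult_distrib)
  finally have "card I = card P" .
  moreover have "\<phi> ` I \<subseteq> P" using \<phi>C \<phi>D by (auto simp: I_def IC_def ID_def)
  ultimately have surj: "\<phi> ` I = P"
    using \<phi>(2) fin by (intro card_subset_eq) (auto simp: card_image)
  define F where "F = \<phi> ` Inl ` IC"
  have FP: "F \<subseteq> P" "col ` F \<subseteq> C" using \<phi>C by (auto simp: F_def IC_def)
  \<comment> \<open>The matching is onto since both sides have \<open>card P\<close> elements; so
    whatever the dummies leave belongs to \<open>F\<close>, and \<open>N - t\<close> dummies per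
    slot force degree exactly \<open>t\<close>.\<close>
  have Fcomp: "F = P - \<phi> ` Inr ` ID"
  proof -
    have "Inl ` IC = I - Inr ` ID" by (auto simp: I_def)
    then have "F = \<phi> ` I - \<phi> ` Inr ` ID"
      unfolding F_def using inj_on_image_set_diff[OF \<phi>(2), of I "Inr ` ID"] by (simp add: I_def)
    then show ?thesis by (simp add: surj)
  qed
  have "card {p\<in>F. slot p = s} = t" if s: "s \<in> L" for s
  proof -
    have "{p\<in>F. slot p = s} = {p\<in>P. slot p = s} - (\<lambda>i. \<phi> (Inr (s, i))) ` {..<N-t}"
      using \<phi>D s unfolding Fcomp ID_def by force
    moreover have "card ((\<lambda>i. \<phi> (Inr (s, i))) ` {..<N-t}) = N - t"
      using \<phi>(2) s by (subst card_image) (auto simp: inj_on_def I_def ID_def)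
    moreover have "(\<lambda>i. \<phi> (Inr (s, i))) ` {..<N-t} \<subseteq> {p\<in>P. slot p = s}" using \<phi>D s by auto
    ultimately show ?thesis using slotN[OF s] tN by (simp add: card_Diff_subset)
  qed
  moreover have "card {p\<in>F. col p = c} = t" if c: "c \<in> C" for c
  proof -
    have "{p\<in>F. col p = c} = (\<lambda>i. \<phi> (Inl (c, i))) ` {..<t}"
      using \<phi>C c unfolding F_def IC_def by force
    moreover have "card ((\<lambda>i. \<phi> (Inl (c, i))) ` {..<t}) = t"
      using \<phi>(2) c by (subst card_image) (auto simp: inj_on_def I_def IC_def)
    ultimately show ?thesis by simp
  qed
  ultimately show ?thesis using FP by blast
qed

text \<open>The inequality is the cut condition for a spanning \<open>t\<close>-regular subgraph. It
  is also necessary for one: of the \<open>t * card X\<close> chosen edges at \<open>X\<close>, at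
  most \<open>t * (card L - card Y)\<close> avoid the colours in \<open>Y\<close>.\<close>

corollary disjoint_perfect_matchings:
  fixes slot :: "'p \<Rightarrow> 's" and col :: "'p \<Rightarrow> 'c"
  assumes "finite P" "finite L" "finite C" "card L = card C"
    and "slot ` P \<subseteq> L" "\<And>s. s \<in> L \<Longrightarrow> card {p\<in>P. slot p = s} = N" "t \<le> N"
    and "\<And>X Y. X \<subseteq> L \<Longrightarrow> Y \<subseteq> C \<Longrightarrow>
        t * card X + t * card Y \<le> t * card L + card {p\<in>P. slot p \<in> X \<and> col p \<in> Y}"
  shows "\<exists>g :: nat \<Rightarrow> 's \<Rightarrow> 'p.
           (\<forall>i<t. (\<forall>s\<in>L. g i s \<in> P \<and> slot (g i s) = s) \<and> inj_on (\<lambda>s. col (g i s)) L) \<and>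
           (\<forall>i<t. \<forall>j<t. \<forall>s\<in>L. i \<noteq> j \<longrightarrow> g i s \<noteq> g j s)"
proof -
  have "\<exists>F\<subseteq>P. col ` F \<subseteq> C \<and> (\<forall>s\<in>L. card {p\<in>F. slot p = s} = t) \<and> (\<forall>c\<in>C. card {p\<in>F. col p = c} = t)"
    by (rule regular_factor[OF assms(1-5) _ assms(7)]) (simp_all add: assms(6,8))
  then obtain F where F: "F \<subseteq> P" "col ` F \<subseteq> C" "\<forall>s\<in>L. card {p\<in>F. slot p = s} = t"
      "\<forall>c\<in>C. card {p\<in>F. col p = c} = t" by (elim exE conjE) (rule that)
  have F': "finite F" "slot ` F \<subseteq> L" using F(1) assms(1,5) by (auto intro: finite_subset)
  have "\<exists>g :: nat \<Rightarrow> 's \<Rightarrow> 'p.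
           (\<forall>i<t. (\<forall>s\<in>L. g i s \<in> F \<and> slot (g i s) = s) \<and> inj_on (\<lambda>s. col (g i s)) L) \<and>
           (\<forall>i<t. \<forall>j<t. \<forall>s\<in>L. i \<noteq> j \<longrightarrow> g i s \<noteq> g j s)"
    by (rule regular_matchings[OF F'(1) assms(2-4) F'(2) F(2)]) (simp_all add: F(3,4))
  then obtain g where "\<forall>i<t. (\<forall>s\<in>L. g i s \<in> F \<and> slot (g i s) = s) \<and> inj_on (\<lambda>s. col (g i s)) L"
    "\<forall>i<t. \<forall>j<t. \<forall>s\<in>L. i \<noteq> j \<longrightarrow> g i s \<noteq> g j s" by (elim exE conjE) (rule that)
  then show ?thesis using F(1) by (intro exI[of _ g]) auto
qed

section \<open>Chernoff bound\<close>

text \<open>The large deviation rate, per unit of the mean, for a Poisson variable to fall to the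
  fraction \<open>1 - \<gamma>\<close> of its mean.\<close>

definition tail_rate :: "real \<Rightarrow> real" where
  "tail_rate \<gamma> = \<gamma> + (1 - \<gamma>) * ln (1 - \<gamma>)"

lemma tail_rate_pos:
  assumes "0 < \<gamma>" "\<gamma> < 1"
  shows "tail_rate \<gamma> > 0"
proof -
  have "ln (1 / (1 - \<gamma>)) < 1 / (1 - \<gamma>) - 1"
    using assms ln_le_minus_one[of "1 / (1 - \<gamma>)"] ln_eq_minus_one[of "1 / (1 - \<gamma>)"]
    by (fastforce simp: field_simps)
  then have "- ln (1 - \<gamma>) < \<gamma> / (1 - \<gamma>)" using assms by (simp add: ln_div field_simps)
  then have "(1 - \<gamma>) * (- ln (1 - \<gamma>)) < \<gamma>" using assms by (simp add: field_simps)
  then show ?thesis by (simp add: tail_rate_def)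
qed

text \<open>Chernoff's method with the moment generating function at \<open>ln (1 - \<gamma>)\<close>.\<close>
lemma Pi_pmf_lower_tail:
  fixes p :: "'i \<Rightarrow> 'a pmf"
  assumes fin: "finite A" and IA: "I \<subseteq> A" and q: "0 \<le> q" "\<And>i. i \<in> I \<Longrightarrow> q \<le> measure_pmf.prob (p i) (E i)"
    and \<gamma>: "0 < \<gamma>" "\<gamma> < 1"
  shows "measure_pmf.prob (Pi_pmf A d p) {f. real (card {i\<in>I. f i \<in> E i}) \<le> (1 - \<gamma>) * q * card I}
     \<le> exp (- (tail_rate \<gamma> * q * card I))"
proof -
  let ?M = "Pi_pmf A d p"
  define z where "z i v = (if i \<in> I \<and> v \<in> E i then 1 - \<gamma> else 1)" for i v
  define Z where "Z f = (\<Prod>i\<in>A. z i (f i))" for f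
  define x where "x = (1 - \<gamma>) * q * card I"
  have finI: "finite I" using fin IA finite_subset by blast
  have z01: "0 \<le> z i v" "z i v \<le> 1" for i v using \<gamma> by (auto simp: z_def)
  have Z01: "0 \<le> Z f" "Z f \<le> 1" for f unfolding Z_def using z01 by (auto intro!: prod_nonneg prod_le_1)
  have Zcount: "Z f = (1 - \<gamma>) ^ card {i\<in>I. f i \<in> E i}" for f
  proof -
    have "Z f = (\<Prod>i\<in>{i\<in>A. i \<in> I \<and> f i \<in> E i}. 1 - \<gamma>)"
      unfolding Z_def z_def using fin by (simp only: prod.inter_filter)
    also have "{i\<in>A. i \<in> I \<and> f i \<in> E i} = {i\<in>I. f i \<in> E i}" using IA by auto
    finally show ?thesis by simp
  qed
  have "measure_pmf.expectation ?M Z = (\<Prod>i\<in>A. measure_pmf.expectation (p i) (z i))"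
    unfolding Z_def
  proof (rule expectation_prod_Pi_pmf[OF fin])
    show "integrable (p i) (z i)" for i
      by (rule measure_pmf.integrable_const_bound[where B = 1]) (use z01 in auto)
  qed (use z01 in auto)
  also have "\<dots> \<le> (\<Prod>i\<in>A. if i \<in> I then exp (- \<gamma> * q) else 1)"
  proof (intro prod_mono conjI)
    fix i assume i: "i \<in> A"
    show "0 \<le> measure_pmf.expectation (p i) (z i)" using z01 by (intro integral_nonneg_AE) auto
    show "measure_pmf.expectation (p i) (z i) \<le> (if i \<in> I then exp (- \<gamma> * q) else 1)"
    proof (cases "i \<in> I")
      case True
      have "z i = (\<lambda>v. 1 - \<gamma> * indicat_real (E i) v)" using True by (auto simp: z_def fun_eq_iff)
      then have "measure_pmf.expectation (p i) (z i) = 1 - \<gamma> * measure_pmf.prob (p i) (E i)"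
        by (simp add: measure_pmf.emeasure_eq_measure measure_pmf.prob_space integrable_real_indicator)
      also have "\<dots> \<le> 1 + (- \<gamma> * q)" using q(2)[OF True] \<gamma> by simp
      also have "\<dots> \<le> exp (- \<gamma> * q)" by (rule exp_ge_add_one_self)
      finally show ?thesis using True by simp
    next
      case False
      then have "z i = (\<lambda>_. 1)" by (auto simp: z_def)
      then show ?thesis using False by simp
    qed
  qed
  also have "\<dots> = exp (- \<gamma> * q) ^ card I"
    using fin IA by (simp add: prod.inter_restrict[symmetric] Int_absorb1)
  also have "\<dots> = exp (- \<gamma> * q * card I)" by (simp add: exp_of_nat_mult[symmetric] mult.commute)
  finally have EZ: "measure_pmf.expectation ?M Z \<le> exp (- \<gamma> * q * card I)" .
  have "(1 - \<gamma>) powr x * measure_pmf.prob ?M {f. real (card {i\<in>I. f i \<in> E i}) \<le> x}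
      = measure_pmf.expectation ?M (\<lambda>f. (1 - \<gamma>) powr x * indicat_real {f. real (card {i\<in>I. f i \<in> E i}) \<le> x} f)"
    by simp
  also have "\<dots> \<le> measure_pmf.expectation ?M Z"
  proof (rule integral_mono)
    show "integrable ?M Z" by (rule measure_pmf.integrable_const_bound[where B = 1]) (use Z01 in auto)
    show "integrable ?M (\<lambda>f. (1 - \<gamma>) powr x * indicat_real {f. real (card {i\<in>I. f i \<in> E i}) \<le> x} f)"
      by (intro integrable_mult_right integrable_real_indicator) (auto simp: less_top[symmetric])
    show "(1 - \<gamma>) powr x * indicat_real {f. real (card {i\<in>I. f i \<in> E i}) \<le> x} f \<le> Z f" for f
    proof (cases "real (card {i\<in>I. f i \<in> E i}) \<le> x")
      case True
      have "(1 - \<gamma>) powr x \<le> (1 - \<gamma>) powr real (card {i\<in>I. f i \<in> E i})"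
        using True \<gamma> by (intro powr_mono') auto
      also have "\<dots> = Z f" using \<gamma> by (simp add: Zcount powr_realpow)
      finally show ?thesis using True by simp
    qed (use Z01 in auto)
  qed
  also note EZ
  finally have "measure_pmf.prob ?M {f. real (card {i\<in>I. f i \<in> E i}) \<le> x} \<le> exp (- \<gamma> * q * card I) / (1 - \<gamma>) powr x"
    using \<gamma> by (simp add: field_simps)
  also have "\<dots> = exp (- (tail_rate \<gamma> * q * card I))"
    using \<gamma> by (simp add: powr_def x_def tail_rate_def exp_diff[symmetric] algebra_simps)
  finally show ?thesis by (simp add: x_def)
qed

section \<open>Weights for the union bound over pairs of subsets\<close>

lemma sum_pow_card_Pow:
  fixes w :: real
  assumes "finite A"
  shows "(\<Sum>X\<in>Pow A. w ^ card X) = (1 + w) ^ card A"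
  using assms
proof (induction A)
  case (insert a A)
  have "(\<Sum>X\<in>Pow (insert a A). w ^ card X) = (\<Sum>X\<in>Pow A. w ^ card X) + (\<Sum>X\<in>insert a ` Pow A. w ^ card X)"
    unfolding Pow_insert using insert by (intro sum.union_disjoint) auto
  also have "(\<Sum>X\<in>insert a ` Pow A. w ^ card X) = (\<Sum>X\<in>Pow A. w ^ card (insert a X))"
    using insert by (subst sum.reindex) (auto simp: inj_on_def insert_ident)
  also have "\<dots> = (\<Sum>X\<in>Pow A. w * w ^ card X)"
  proof (rule sum.cong)
    fix X assume "X \<in> Pow A"
    then have "finite X" "a \<notin> X" using insert finite_subset by auto
    then show "w ^ card (insert a X) = w * w ^ card X" by simp
  qed simp
  finally show ?case using insert by (simp add: sum_distrib_left[symmetric] algebra_simps)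
qed simp

text \<open>For \<open>w = 1 / (\<nu> + 1)\<close> the sum of \<open>w ^ card X\<close> over all
  subsets of a \<open>\<nu>\<close>-set is below 3, so such weights absorb the choice of both sets.
  The constraint on the pair gives \<open>4 * card Y \<ge> 2 + card (U - X) + card Y\<close>, which
  leaves \<open>w ^ 2\<close> over.\<close>

lemma sum_pairs_bound:
  fixes U :: "'a set" and W :: "'b set"
  assumes "finite U" "finite W" "card U = \<nu>" "card W = \<nu>"
  defines "w \<equiv> 1 / (real \<nu> + 1)"
  shows "(\<Sum>(X,Y)\<in>{(X,Y). X \<subseteq> U \<and> Y \<subseteq> W \<and> card (U - X) \<le> card Y \<and> Y \<noteq> {}}. w ^ (4 * card Y)) \<le> 9 * w ^ 2"
proof -
  let ?K = "{(X,Y). X \<subseteq> U \<and> Y \<subseteq> W \<and> card (U - X) \<le> card Y \<and> Y \<noteq> {}}"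
  have w: "0 \<le> w" "w \<le> 1" by (auto simp: w_def)
  have sub: "?K \<subseteq> Pow U \<times> Pow W" by auto
  have pw: "(1 + w) ^ \<nu> \<le> 3"
  proof -
    have "(1 + w) ^ \<nu> \<le> exp w ^ \<nu>" using w by (intro power_mono exp_ge_add_one_self) auto
    also have "\<dots> = exp (\<nu> * w)" by (simp add: exp_of_nat_mult)
    also have "\<dots> \<le> exp 1" by (simp add: w_def)
    also have "\<dots> \<le> 3" by (rule exp_le)
    finally show ?thesis .
  qed
  have "(\<Sum>(X,Y)\<in>?K. w ^ (4 * card Y)) \<le> (\<Sum>(X,Y)\<in>?K. w ^ 2 * (w ^ card (U - X) * w ^ card Y))"
  proof (rule sum_mono, clarify)
    fix X Y assume *: "X \<subseteq> U" "Y \<subseteq> W" "card (U - X) \<le> card Y" "Y \<noteq> {}"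
    then have "card Y \<ge> 1" using assms(2) by (simp add: Suc_le_eq card_gt_0_iff finite_subset)
    then have "2 + (card (U - X) + card Y) \<le> 4 * card Y" using * by linarith
    then have "w ^ (4 * card Y) \<le> w ^ (2 + (card (U - X) + card Y))"
      using w by (intro power_decreasing)
    then show "w ^ (4 * card Y) \<le> w ^ 2 * (w ^ card (U - X) * w ^ card Y)" by (simp only: power_add)
  qed
  also have "\<dots> \<le> (\<Sum>(X,Y)\<in>Pow U \<times> Pow W. w ^ 2 * (w ^ card (U - X) * w ^ card Y))"
    using w assms(1,2) by (intro sum_mono2) auto
  also have "\<dots> = w ^ 2 * ((\<Sum>X\<in>Pow U. w ^ card (U - X)) * (\<Sum>Y\<in>Pow W. w ^ card Y))"
    proof -
    have "(\<Sum>(X,Y)\<in>Pow U \<times> Pow W. w ^ 2 * (w ^ card (U - X) * w ^ card Y))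
      = (\<Sum>X\<in>Pow U. w ^ 2 * (w ^ card (U - X) * (\<Sum>Y\<in>Pow W. w ^ card Y)))"
      by (simp only: sum.cartesian_product[symmetric] sum_distrib_left)
    then show ?thesis by (simp only: sum_distrib_left[symmetric] sum_distrib_right[symmetric])
  qed
  also have "(\<Sum>X\<in>Pow U. w ^ card (U - X)) = (\<Sum>X\<in>Pow U. w ^ card X)"
    by (rule sum.reindex_bij_witness[of _ "\<lambda>X. U - X" "\<lambda>X. U - X"]) (auto simp: double_diff)
  also have "w ^ 2 * ((\<Sum>X\<in>Pow U. w ^ card X) * (\<Sum>Y\<in>Pow W. w ^ card Y)) = w ^ 2 * ((1 + w) ^ \<nu> * (1 + w) ^ \<nu>)"
    using assms by (simp add: sum_pow_card_Pow)
  also have "\<dots> \<le> w ^ 2 * (3 * 3)" using w pw by (intro mult_left_mono mult_mono) auto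
  finally show ?thesis by simp
qed

section \<open>Rainbow assignments of random colours\<close>

text \<open>The cut condition is at stake only if \<open>card X + card Y > \<nu>\<close>. The number
  of positions in \<open>X\<close> with a colour in \<open>Y\<close> has mean
  \<open>N * card X * card Y / \<nu>\<close>, and
  \<open>card X * card Y / \<nu> \<ge> card X + card Y - \<nu>\<close>. So it suffices that all
  these counts exceed \<open>1 - \<gamma>\<close> times their means.\<close>

lemma random_matchings:
  fixes L :: "'s set" and C :: "'c set" and t N :: nat and \<gamma> :: real
  assumes fin: "finite L" "finite C" and card: "card L = \<nu>" "card C = \<nu>" "\<nu> > 0"
    and \<gamma>: "0 < \<gamma>" "\<gamma> < 1" and t: "real t \<le> (1 - \<gamma>) * N" and N: "8 * ln (real \<nu> + 1) \<le> tail_rate \<gamma> * N"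
  shows "measure_pmf.prob (Pi_pmf (L \<times> {..<N}) d (\<lambda>_. pmf_of_set C))
     {c. \<not> (\<exists>g :: nat \<Rightarrow> 's \<Rightarrow> nat. (\<forall>i<t. (\<forall>s\<in>L. g i s < N) \<and> inj_on (\<lambda>s. c (s, g i s)) L) \<and>
            (\<forall>i<t. \<forall>j<t. \<forall>s\<in>L. i \<noteq> j \<longrightarrow> g i s \<noteq> g j s))} \<le> 18 / real \<nu>"
    (is "measure_pmf.prob ?M ?bad \<le> _")
proof -
  define ev where "ev X Y = {c :: 's \<times> nat \<Rightarrow> 'c. real (card {p\<in>X \<times> {..<N}. c p \<in> Y})
      \<le> (1 - \<gamma>) * (card Y / \<nu>) * card (X \<times> {..<N})}" for X Y
  \<comment> \<open>One of the two sets has at least half of the \<open>\<nu>\<close> elements, and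
    its complement is no larger than the other set, of size \<open>m\<close> say. So
    \<open>m\<close> controls the number of pairs, and also the mean, which is at least
    \<open>N * m / 2\<close>.\<close>
  define K1 where "K1 = {(X,Y). X \<subseteq> L \<and> Y \<subseteq> C \<and> card (L - X) \<le> card Y \<and> Y \<noteq> {} \<and> \<nu> \<le> 2 * card X}"
  define K2 where "K2 = {(X,Y). X \<subseteq> L \<and> Y \<subseteq> C \<and> card (C - Y) \<le> card X \<and> X \<noteq> {} \<and> \<nu> \<le> 2 * card Y}"
  define w where "w = 1 / (real \<nu> + 1)"
  have w: "0 < w" "w \<le> 1" by (auto simp: w_def)
  have ne: "C \<noteq> {}" using card by auto
  have h0: "tail_rate \<gamma> > 0" using \<gamma> by (rule tail_rate_pos)
  have ev_le: "measure_pmf.prob ?M (ev X Y) \<le> w ^ (4 * m)"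
    if XY: "X \<subseteq> L" "Y \<subseteq> C" "real m * \<nu> \<le> 2 * (card X * card Y)" for X Y m
  proof -
    have "measure_pmf.prob ?M (ev X Y) \<le> exp (- (tail_rate \<gamma> * (card Y / \<nu>) * card (X \<times> {..<N})))"
      unfolding ev_def
    proof (rule Pi_pmf_lower_tail)
      show "card Y / \<nu> \<le> measure_pmf.prob (pmf_of_set C) Y"
        using fin ne card XY(2) by (simp add: measure_pmf_of_set Int_absorb1)
    qed (use fin XY \<gamma> in auto)
    also have "tail_rate \<gamma> * (card Y / \<nu>) * card (X \<times> {..<N}) = (tail_rate \<gamma> * N) * (card X * card Y / \<nu>)"
      by (simp add: card_cartesian_product)
    \<comment> \<open>Half of the constant 8 is lost with \<open>m / 2\<close>; the remaining 4 is
      the exponent in \<open>sum_pairs_bound\<close>.\<close>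
    also have "exp (- \<dots>) \<le> exp (- (8 * ln (real \<nu> + 1) * (m / 2)))"
    proof -
      have hm: "real m / 2 \<le> card X * card Y / \<nu>" using XY(3) card(3) by (simp add: field_simps)
      have "8 * ln (real \<nu> + 1) * (m / 2) \<le> (tail_rate \<gamma> * N) * (card X * card Y / \<nu>)"
        by (rule mult_mono[OF N hm]) (use h0 in auto)
      then show ?thesis by simp
    qed
    also have "\<dots> = exp (- ln (real \<nu> + 1)) ^ (4 * m)"
      by (simp add: exp_of_nat_mult[symmetric] algebra_simps)
    also have "exp (- ln (real \<nu> + 1)) = w" by (simp add: w_def exp_minus divide_inverse)
    finally show ?thesis .
  qed
  have finPow: "finite {(X,Y). X \<subseteq> L \<and> Y \<subseteq> C \<and> card (L - X) \<le> card Y \<and> Y \<noteq> {}}"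
    "finite {(Y,X). Y \<subseteq> C \<and> X \<subseteq> L \<and> card (C - Y) \<le> card X \<and> X \<noteq> {}}"
    using fin by (auto intro: finite_subset[of _ "Pow L \<times> Pow C"] finite_subset[of _ "Pow C \<times> Pow L"])
  have "?bad \<subseteq> (\<Union>(X,Y)\<in>K1 \<union> K2. ev X Y)"
  proof (rule ccontr)
    assume "\<not> ?bad \<subseteq> (\<Union>(X,Y)\<in>K1 \<union> K2. ev X Y)"
    then obtain c where c: "c \<in> ?bad" and nc: "\<And>X Y. (X,Y) \<in> K1 \<union> K2 \<Longrightarrow> c \<notin> ev X Y" by blast
    have "\<exists>g :: nat \<Rightarrow> 's \<Rightarrow> 's \<times> nat.
           (\<forall>i<t. (\<forall>s\<in>L. g i s \<in> L \<times> {..<N} \<and> fst (g i s) = s) \<and> inj_on (\<lambda>s. c (g i s)) L) \<and>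
           (\<forall>i<t. \<forall>j<t. \<forall>s\<in>L. i \<noteq> j \<longrightarrow> g i s \<noteq> g j s)"
    proof (rule disjoint_perfect_matchings[of "L \<times> {..<N}" L C fst N t c])
      show "card {p \<in> L \<times> {..<N}. fst p = s} = N" if "s \<in> L" for s
      proof -
        have "{p \<in> L \<times> {..<N}. fst p = s} = {s} \<times> {..<N}" using that by auto
        then show ?thesis by (simp add: card_cartesian_product)
      qed
      have "real t \<le> real N" using t \<gamma> by (smt (verit) mult_left_le_one_le of_nat_0_le_iff)
      then show "t \<le> N" by simp
      fix X Y assume XY: "X \<subseteq> L" "Y \<subseteq> C"
      have le: "card X \<le> \<nu>" "card Y \<le> \<nu>" using card_mono[OF fin(1) XY(1)] card_mono[OF fin(2) XY(2)] card by simp_all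
      have eq: "{p \<in> L \<times> {..<N}. fst p \<in> X \<and> c p \<in> Y} = {p\<in>X \<times> {..<N}. c p \<in> Y}" using XY by auto
      show "t * card X + t * card Y \<le> t * card L + card {p \<in> L \<times> {..<N}. fst p \<in> X \<and> c p \<in> Y}"
      proof (cases "card X + card Y \<le> \<nu>")
        case True
        then have "t * (card X + card Y) \<le> t * \<nu>" by (rule mult_le_mono2)
        then show ?thesis using card(1) by (simp add: add_mult_distrib2 del: mult_le_cancel1)
      next
        case False
        have cX: "card (L - X) = \<nu> - card X" "card (C - Y) = \<nu> - card Y"
          using XY fin card by (auto simp: card_Diff_subset finite_subset)
        have "X \<noteq> {}" "Y \<noteq> {}" using False le by auto
        then have "(X,Y) \<in> K1 \<union> K2"
          unfolding K1_def K2_def using False XY cX by auto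
        then have "c \<notin> ev X Y" by (rule nc)
        then have "(1 - \<gamma>) * (card Y / \<nu>) * card (X \<times> {..<N}) < card {p\<in>X \<times> {..<N}. c p \<in> Y}"
          by (simp add: ev_def)
        moreover have "real t * (real (card X) + card Y - \<nu>) \<le> (1 - \<gamma>) * (card Y / \<nu>) * card (X \<times> {..<N})"
        proof -
          have "0 \<le> (real \<nu> - card X) * (real \<nu> - card Y)" using le by (intro mult_nonneg_nonneg) auto
          then have "real (card X) + card Y - \<nu> \<le> card X * card Y / \<nu>"
            using card(3) by (simp add: field_simps)
          then have "real t * (real (card X) + card Y - \<nu>) \<le> real t * (card X * card Y / \<nu>)"
            by (intro mult_left_mono) auto
          also have "\<dots> \<le> ((1 - \<gamma>) * N) * (card X * card Y / \<nu>)" by (intro mult_right_mono t) auto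
          also have "\<dots> = (1 - \<gamma>) * (card Y / \<nu>) * card (X \<times> {..<N})"
            by (simp add: card_cartesian_product)
          finally show ?thesis .
        qed
        ultimately have "real t * (real (card X) + card Y - \<nu>) \<le> card {p\<in>X \<times> {..<N}. c p \<in> Y}" by linarith
        then have "real (t * card X + t * card Y) \<le> real (t * card L + card {p\<in>X \<times> {..<N}. c p \<in> Y})"
          using card(1) by (simp add: algebra_simps)
        then show ?thesis unfolding eq by (simp only: of_nat_le_iff)
      qed
    qed (use fin card in auto)
    then obtain g :: "nat \<Rightarrow> 's \<Rightarrow> 's \<times> nat" where
      gg: "(\<forall>i<t. (\<forall>s\<in>L. g i s \<in> L \<times> {..<N} \<and> fst (g i s) = s) \<and> inj_on (\<lambda>s. c (g i s)) L) \<and>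
           (\<forall>i<t. \<forall>j<t. \<forall>s\<in>L. i \<noteq> j \<longrightarrow> g i s \<noteq> g j s)" ..
    have g: "i < t \<Longrightarrow> s \<in> L \<Longrightarrow> g i s \<in> L \<times> {..<N} \<and> fst (g i s) = s"
         "i < t \<Longrightarrow> inj_on (\<lambda>s. c (g i s)) L"
         "i < t \<Longrightarrow> j < t \<Longrightarrow> s \<in> L \<Longrightarrow> i \<noteq> j \<Longrightarrow> g i s \<noteq> g j s" for i j s
      using gg by simp_all
    have gs: "g i s = (s, snd (g i s))" "snd (g i s) < N" if "i < t" "s \<in> L" for i s
      using g(1)[OF that] by (auto simp: prod_eq_iff)
    have "inj_on (\<lambda>s. c (s, snd (g i s))) L" if "i < t" for i
      using g(2)[OF that] gs(1)[OF that] by (simp cong: inj_on_cong)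
    moreover have "snd (g i s) \<noteq> snd (g j s)" if "i < t" "j < t" "s \<in> L" "i \<noteq> j" for i j s
      using g(3)[OF that] gs(1)[OF that(1,3)] gs(1)[OF that(2,3)] by metis
    ultimately have "\<exists>g :: nat \<Rightarrow> 's \<Rightarrow> nat. (\<forall>i<t. (\<forall>s\<in>L. g i s < N) \<and> inj_on (\<lambda>s. c (s, g i s)) L) \<and>
            (\<forall>i<t. \<forall>j<t. \<forall>s\<in>L. i \<noteq> j \<longrightarrow> g i s \<noteq> g j s)"
      using gs(2) by (intro exI[of _ "\<lambda>i s. snd (g i s)"]) blast
    then show False using c by blast
  qed
  moreover have finK: "finite K1" "finite K2"
  proof -
    have "K1 \<subseteq> Pow L \<times> Pow C" "K2 \<subseteq> Pow L \<times> Pow C" by (auto simp: K1_def K2_def)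
    then show "finite K1" "finite K2" using fin by (auto intro: finite_subset)
  qed
  ultimately have "measure_pmf.prob ?M ?bad \<le> measure_pmf.prob ?M (\<Union>(X,Y)\<in>K1 \<union> K2. ev X Y)"
    by (intro measure_pmf.finite_measure_mono) auto
  also have "\<dots> \<le> (\<Sum>(X,Y)\<in>K1 \<union> K2. measure_pmf.prob ?M (ev X Y))"
    using finK by (intro order_trans[OF measure_pmf.finite_measure_subadditive_finite]) (auto simp: case_prod_unfold)
  also have "\<dots> \<le> (\<Sum>(X,Y)\<in>K1. measure_pmf.prob ?M (ev X Y)) + (\<Sum>(X,Y)\<in>K2. measure_pmf.prob ?M (ev X Y))"
    using finK by (subst sum.union_inter[symmetric]) (auto intro!: sum_nonneg)
  also have "(\<Sum>(X,Y)\<in>K1. measure_pmf.prob ?M (ev X Y)) \<le> 9 * w ^ 2"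
  proof -
    have "(\<Sum>(X,Y)\<in>K1. measure_pmf.prob ?M (ev X Y)) \<le> (\<Sum>(X,Y)\<in>K1. w ^ (4 * card Y))"
    proof (rule sum_mono, clarify)
      fix X Y assume XY: "(X,Y) \<in> K1"
      then have sub: "X \<subseteq> L" "Y \<subseteq> C" "real \<nu> \<le> 2 * card X" by (auto simp: K1_def)
      show "measure_pmf.prob ?M (ev X Y) \<le> w ^ (4 * card Y)"
        by (rule ev_le[OF sub(1,2)]) (use mult_right_mono[OF sub(3), of "real (card Y)"] in \<open>simp add: mult_ac\<close>)
    qed
    also have "\<dots> \<le> (\<Sum>(X,Y)\<in>{(X,Y). X \<subseteq> L \<and> Y \<subseteq> C \<and> card (L - X) \<le> card Y \<and> Y \<noteq> {}}. w ^ (4 * card Y))"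
      using w finPow by (intro sum_mono2) (auto simp: K1_def)
    also have "\<dots> \<le> 9 * w ^ 2" unfolding w_def using fin card by (intro sum_pairs_bound) auto
    finally show ?thesis .
  qed
  also have "(\<Sum>(X,Y)\<in>K2. measure_pmf.prob ?M (ev X Y)) \<le> 9 * w ^ 2"
  proof -
    have "(\<Sum>(X,Y)\<in>K2. measure_pmf.prob ?M (ev X Y)) \<le> (\<Sum>(X,Y)\<in>K2. w ^ (4 * card X))"
    proof (rule sum_mono, clarify)
      fix X Y assume XY: "(X,Y) \<in> K2"
      then have sub: "X \<subseteq> L" "Y \<subseteq> C" "real \<nu> \<le> 2 * card Y" by (auto simp: K2_def)
      show "measure_pmf.prob ?M (ev X Y) \<le> w ^ (4 * card X)"
        by (rule ev_le[OF sub(1,2)]) (use mult_right_mono[OF sub(3), of "real (card X)"] in \<open>simp add: mult_ac\<close>)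
    qed
    also have "\<dots> = (\<Sum>(Y,X)\<in>prod.swap ` K2. w ^ (4 * card X))"
      by (subst sum.reindex) (auto simp: case_prod_unfold)
    also have "\<dots> \<le> (\<Sum>(Y,X)\<in>{(Y,X). Y \<subseteq> C \<and> X \<subseteq> L \<and> card (C - Y) \<le> card X \<and> X \<noteq> {}}. w ^ (4 * card X))"
      using w finPow by (intro sum_mono2) (auto simp: K2_def)
    also have "\<dots> \<le> 9 * w ^ 2" unfolding w_def using fin card by (intro sum_pairs_bound) auto
    finally show ?thesis .
  qed
  also have "9 * w ^ 2 + 9 * w ^ 2 \<le> 18 / real \<nu>"
  proof -
    have "w ^ 2 \<le> w * 1" unfolding power2_eq_square using w by (intro mult_left_mono) auto
    also have "\<dots> \<le> 1 / real \<nu>" using card(3) by (simp add: w_def field_simps)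
    finally show ?thesis by simp
  qed
  finally show ?thesis by simp
qed

section \<open>Random subsets\<close>

lemma Pi_pmf_dflt_outside:
  "f \<in> set_pmf (Pi_pmf A d p) \<Longrightarrow> finite A \<Longrightarrow> x \<notin> A \<Longrightarrow> f x = d"
  using set_Pi_pmf_subset[of A d p] by auto

lemma Pi_pmf_zip:
  assumes "finite A" "h d d' = e"
  shows "Pi_pmf A e (\<lambda>x. map_pmf (\<lambda>(u,v). h u v) (pair_pmf (p x) (q x)))
    = map_pmf (\<lambda>(f,g) x. h (f x) (g x)) (pair_pmf (Pi_pmf A d p) (Pi_pmf A d' q))"
proof -
  have "Pi_pmf A e (\<lambda>x. map_pmf (\<lambda>(u,v). h u v) (pair_pmf (p x) (q x)))
    = Pi_pmf A e (\<lambda>x. bind_pmf (p x) (\<lambda>u. bind_pmf (q x) (\<lambda>v. return_pmf (h u v))))"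
    by (simp add: pair_pmf_def map_bind_pmf)
  also have "\<dots> = bind_pmf (Pi_pmf A d p) (\<lambda>f. bind_pmf (Pi_pmf A d' q)
      (\<lambda>g. return_pmf (\<lambda>x. if x \<in> A then h (f x) (g x) else e)))"
    by (subst Pi_pmf_bind[OF assms(1), where d' = d], subst Pi_pmf_bind[OF assms(1), where d' = d'])
      (simp only: Pi_pmf_return_pmf[OF assms(1)])
  also have "\<dots> = bind_pmf (Pi_pmf A d p) (\<lambda>f. bind_pmf (Pi_pmf A d' q) (\<lambda>g. return_pmf (\<lambda>x. h (f x) (g x))))"
  proof (intro bind_pmf_cong refl arg_cong[of _ _ return_pmf] ext)
    fix f g x assume "f \<in> set_pmf (Pi_pmf A d p)" "g \<in> set_pmf (Pi_pmf A d' q)"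
    then show "(if x \<in> A then h (f x) (g x) else e) = h (f x) (g x)"
      using assms Pi_pmf_dflt_outside[of f A d p x] Pi_pmf_dflt_outside[of g A d' q x] by auto
  qed
  finally show ?thesis by (simp add: pair_pmf_def map_bind_pmf)
qed

lemma Pi_pmf_reindex:
  assumes "finite A" "inj_on h A"
  shows "map_pmf (\<lambda>f x. if x \<in> A then f (h x) else d) (Pi_pmf (h ` A) d' p) = Pi_pmf A d (\<lambda>x. p (h x))"
  using assms
proof (induction A)
  case (insert x A)
  have hx: "h x \<notin> h ` A" and hx': "\<And>y. y \<in> A \<Longrightarrow> h y \<noteq> h x"
    using insert.hyps insert.prems by (auto simp: inj_on_def)
  have "map_pmf (\<lambda>f y. if y \<in> insert x A then f (h y) else d) (Pi_pmf (h ` insert x A) d' p)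
    = map_pmf (\<lambda>(v, f). (\<lambda>y. if y \<in> A then f (h y) else d)(x := v)) (pair_pmf (p (h x)) (Pi_pmf (h ` A) d' p))"
    using insert.hyps insert.prems hx hx'
    by (auto simp: Pi_pmf_insert pmf.map_comp intro!: map_pmf_cong ext)
  also have "\<dots> = map_pmf (\<lambda>(v, f). f(x := v)) (pair_pmf (p (h x)) (map_pmf (\<lambda>f y. if y \<in> A then f (h y) else d) (Pi_pmf (h ` A) d' p)))"
    by (simp add: pair_map_pmf2 pmf.map_comp o_def case_prod_unfold)
  also have "\<dots> = Pi_pmf (insert x A) d (\<lambda>x. p (h x))"
    using insert by (simp add: Pi_pmf_insert)
  finally show ?case .
qed simp

definition rsub :: "real \<Rightarrow> 'a set \<Rightarrow> 'a set pmf" where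
  "rsub a A = map_pmf Collect (Pi_pmf A False (\<lambda>_. bernoulli_pmf a))"

lemma set_rsub: "finite A \<Longrightarrow> S \<in> set_pmf (rsub a A) \<Longrightarrow> S \<subseteq> A"
  using set_Pi_pmf_subset[of A False "\<lambda>_. bernoulli_pmf a"] by (auto simp: rsub_def)

lemma rsub_empty [simp]: "rsub a {} = return_pmf {}"
  by (simp add: rsub_def)

lemma pmf_rsub:
  assumes "finite A" "0 \<le> a" "a \<le> 1"
  shows "pmf (rsub a A) S = (if S \<subseteq> A then a ^ card S * (1 - a) ^ card (A - S) else 0)"
proof -
  have "pmf (rsub a A) S = pmf (Pi_pmf A False (\<lambda>_. bernoulli_pmf a)) (\<lambda>x. x \<in> S)"
    unfolding rsub_def using pmf_map_inj'[of Collect "Pi_pmf A False (\<lambda>_. bernoulli_pmf a)" "\<lambda>x. x \<in> S"]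
    by (simp add: inj_def Collect_inj)
  also have "\<dots> = (if S \<subseteq> A then \<Prod>x\<in>A. if x \<in> S then a else 1 - a else 0)"
    using assms by (subst pmf_Pi) (auto intro!: prod.cong)
  also have "\<dots> = (if S \<subseteq> A then a ^ card S * (1 - a) ^ card (A - S) else 0)"
  proof (cases "S \<subseteq> A")
    case True
    have "(\<Prod>x\<in>A. if x \<in> S then a else 1 - a) = (\<Prod>x\<in>A \<inter> S. a) * (\<Prod>x\<in>A - S. 1 - a)"
      using prod.If_cases[OF assms(1), of "\<lambda>x. x \<in> S" "\<lambda>_. a" "\<lambda>_. 1 - a"] by (simp add: Diff_eq)
    then show ?thesis using True by (simp add: Int_absorb1)
  qed simp
  finally show ?thesis .
qed

lemma rsub_Un:
  assumes "finite A" "finite B" "A \<inter> B = {}"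
  shows "rsub a (A \<union> B) = map_pmf (\<lambda>(X,Y). X \<union> Y) (pair_pmf (rsub a A) (rsub a B))"
proof -
  let ?P = "\<lambda>A. Pi_pmf A False (\<lambda>_. bernoulli_pmf a)"
  have "rsub a (A \<union> B) = map_pmf (\<lambda>(f,g). {x. if x \<in> A then f x else g x}) (pair_pmf (?P A) (?P B))"
    unfolding rsub_def using assms by (simp add: Pi_pmf_union pmf.map_comp o_def case_prod_unfold)
  also have "\<dots> = map_pmf (\<lambda>(f,g). Collect f \<union> Collect g) (pair_pmf (?P A) (?P B))"
  proof (rule map_pmf_cong[OF refl], clarify)
    fix f g assume "(f, g) \<in> set_pmf (pair_pmf (?P A) (?P B))"
    then have "f x \<Longrightarrow> x \<in> A" "g x \<Longrightarrow> x \<in> B" for x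
      using Pi_pmf_dflt_outside[of f A False _ x] Pi_pmf_dflt_outside[of g B False _ x] assms by auto
    then show "{x. if x \<in> A then f x else g x} = Collect f \<union> Collect g" using assms(3) by auto
  qed
  also have "\<dots> = map_pmf (\<lambda>(X,Y). X \<union> Y) (pair_pmf (rsub a A) (rsub a B))"
    unfolding rsub_def by (simp add: map_pair[symmetric] pmf.map_comp o_def case_prod_unfold)
  finally show ?thesis .
qed

lemma rsub_Int:
  assumes "finite A"
  shows "map_pmf (\<lambda>X. X \<inter> B) (rsub a A) = rsub a (A \<inter> B)"
proof -
  have "rsub a (A \<inter> B) = map_pmf (\<lambda>f. {x. x \<in> A \<inter> B \<and> f x}) (Pi_pmf A False (\<lambda>_. bernoulli_pmf a))"
    unfolding rsub_def using assms
    by (subst Pi_pmf_subset[of A]) (auto simp: pmf.map_comp o_def intro!: map_pmf_cong)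
  also have "\<dots> = map_pmf (\<lambda>f. Collect f \<inter> B) (Pi_pmf A False (\<lambda>_. bernoulli_pmf a))"
    using set_Pi_pmf_subset[OF assms, of False] by (intro map_pmf_cong) auto
  finally show ?thesis by (simp add: rsub_def pmf.map_comp o_def)
qed

lemma rsub_image:
  assumes "finite A" "inj_on h A"
  shows "rsub a (h ` A) = map_pmf (image h) (rsub a A)"
proof -
  let ?P = "Pi_pmf (h ` A) False (\<lambda>_. bernoulli_pmf a)"
  have "map_pmf (image h) (rsub a A) = map_pmf (\<lambda>f. h ` {x\<in>A. f (h x)}) ?P"
    unfolding rsub_def Pi_pmf_reindex[OF assms, of False False "\<lambda>_. bernoulli_pmf a", symmetric]
    by (auto simp: pmf.map_comp o_def intro!: map_pmf_cong)
  also have "\<dots> = map_pmf Collect ?P"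
  proof (rule map_pmf_cong[OF refl])
    fix f assume "f \<in> set_pmf ?P"
    then have "x \<in> h ` A" if "f x" for x
      using Pi_pmf_dflt_outside[of f "h ` A" False _ x] that assms(1) by auto
    then show "h ` {x\<in>A. f (h x)} = Collect f" by blast
  qed
  finally show ?thesis by (simp add: rsub_def)
qed

lemma rsub_union_indep:
  assumes "finite A" "0 \<le> a" "a \<le> 1" "0 \<le> b" "b \<le> 1"
  shows "map_pmf (\<lambda>(X,Y). X \<union> Y) (pair_pmf (rsub a A) (rsub b A)) = rsub (a + b - a * b) A"
proof -
  have 0: "a + b - a * b = 1 - (1 - a) * (1 - b)" by (simp add: algebra_simps)
  have ab: "0 \<le> a + b - a * b" "a + b - a * b \<le> 1"
    unfolding 0 using assms by (auto intro: mult_le_one)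
  have ber: "map_pmf (\<lambda>(u,v). u \<or> v) (pair_pmf (bernoulli_pmf a) (bernoulli_pmf b)) = bernoulli_pmf (a + b - a * b)"
  proof (rule pmf_eqI)
    fix x
    have "pmf (map_pmf (\<lambda>(u,v). u \<or> v) (pair_pmf (bernoulli_pmf a) (bernoulli_pmf b))) False = (1 - a) * (1 - b)"
    proof -
      have "(\<lambda>(u,v). u \<or> v) -` {False} = {(False, False)}" by auto
      then show ?thesis using assms by (simp add: pmf_map measure_pmf_single pmf_pair)
    qed
    moreover have "pmf (map_pmf (\<lambda>(u,v). u \<or> v) (pair_pmf (bernoulli_pmf a) (bernoulli_pmf b))) True
      = 1 - pmf (map_pmf (\<lambda>(u,v). u \<or> v) (pair_pmf (bernoulli_pmf a) (bernoulli_pmf b))) False"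
      by (subst pmf_False_conv_True) simp
    ultimately show "pmf (map_pmf (\<lambda>(u,v). u \<or> v) (pair_pmf (bernoulli_pmf a) (bernoulli_pmf b))) x
        = pmf (bernoulli_pmf (a + b - a * b)) x"
      using ab 0 by (cases x) auto
  qed
  have "rsub (a + b - a * b) A = map_pmf Collect (map_pmf (\<lambda>(f,g) x. f x \<or> g x)
     (pair_pmf (Pi_pmf A False (\<lambda>_. bernoulli_pmf a)) (Pi_pmf A False (\<lambda>_. bernoulli_pmf b))))"
    unfolding rsub_def ber[symmetric] by (subst Pi_pmf_zip[OF assms(1)]) auto
  also have "\<dots> = map_pmf (\<lambda>(X,Y). X \<union> Y) (pair_pmf (rsub a A) (rsub b A))"
    unfolding rsub_def by (simp add: map_pair[symmetric] pmf.map_comp o_def case_prod_unfold Collect_disj_eq)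
  finally show ?thesis by simp
qed

definition ksub :: "nat \<Rightarrow> 'a set \<Rightarrow> 'a set pmf" where
  "ksub k A = pmf_of_set {S. S \<subseteq> A \<and> card S = k}"

lemma ksub_ne: "finite A \<Longrightarrow> k \<le> card A \<Longrightarrow> finite {S. S \<subseteq> A \<and> card S = k} \<and> {S. S \<subseteq> A \<and> card S = k} \<noteq> {}"
  using obtain_subset_with_card_n[of k A] by (auto intro: finite_subset[of _ "Pow A"])

lemma set_ksub: "finite A \<Longrightarrow> k \<le> card A \<Longrightarrow> set_pmf (ksub k A) = {S. S \<subseteq> A \<and> card S = k}"
  unfolding ksub_def using ksub_ne by (intro set_pmf_of_set) auto

lemma ksub_image:
  assumes "finite A" "inj_on h A" "k \<le> card A"
  shows "map_pmf (image h) (ksub k A) = ksub k (h ` A)"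
proof -
  have "image h ` {S. S \<subseteq> A \<and> card S = k} = {S. S \<subseteq> h ` A \<and> card S = k}"
  proof (intro equalityI subsetI)
    fix T assume "T \<in> {S. S \<subseteq> h ` A \<and> card S = k}"
    then obtain S where "S \<subseteq> A" "T = h ` S" "card T = k" by (auto simp: subset_image_iff)
    then show "T \<in> image h ` {S. S \<subseteq> A \<and> card S = k}"
      using assms by (auto simp: card_image inj_on_subset)
  qed (use assms in \<open>auto simp: card_image inj_on_subset\<close>)
  moreover have "inj_on (image h) {S. S \<subseteq> A \<and> card S = k}"
    using assms(2) by (intro inj_on_subset[OF inj_on_image_Pow]) auto
  ultimately show ?thesis
    unfolding ksub_def using ksub_ne[OF assms(1,3)] by (subst map_pmf_of_set_inj) auto
qed

lemma permutes_image_exists: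
  assumes "finite A" "S \<subseteq> A" "T \<subseteq> A" "card S = card T"
  shows "\<exists>\<sigma>. \<sigma> permutes A \<and> \<sigma> ` S = T"
proof -
  have fin: "finite S" "finite T" using assms finite_subset by blast+
  obtain f where f: "bij_betw f S T" using fin assms(4) by (metis finite_same_card_bij)
  have "card (A - S) = card (A - T)" using assms fin by (simp add: card_Diff_subset)
  then obtain g where g: "bij_betw g (A - S) (A - T)" using assms(1) by (metis finite_Diff finite_same_card_bij)
  define \<sigma> where "\<sigma> x = (if x \<in> S then f x else if x \<in> A then g x else x)" for x
  have "bij_betw \<sigma> S T" using f bij_betw_cong[of S f \<sigma> T] by (simp add: \<sigma>_def)
  moreover have "bij_betw \<sigma> (A - S) (A - T)" using g bij_betw_cong[of "A - S" g \<sigma> "A - T"] by (simp add: \<sigma>_def)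
  ultimately have "bij_betw \<sigma> (S \<union> (A - S)) (T \<union> (A - T))" by (rule bij_betw_combine) auto
  then have "bij_betw \<sigma> A A" using assms(2,3) by (simp add: Un_absorb1)
  then have "\<sigma> permutes A" by (rule bij_imp_permutes) (use assms(2) in \<open>auto simp: \<sigma>_def\<close>)
  moreover have "\<sigma> ` S = T" using \<open>bij_betw \<sigma> S T\<close> by (simp add: bij_betw_def)
  ultimately show ?thesis by blast
qed

text \<open>The permutations of \<open>A\<close> act transitively on its \<open>k\<close>-subsets,
  so an invariant law has constant mass. This symmetry criterion replaces counting in all later
  proofs that a choice is uniform.\<close>

lemma eq_ksubI:
  assumes A: "finite A" and supp: "\<And>S. S \<in> set_pmf q \<Longrightarrow> S \<subseteq> A \<and> card S = k"
    and inv: "\<And>\<sigma>. \<sigma> permutes A \<Longrightarrow> map_pmf (image \<sigma>) q = q"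
  shows "q = ksub k A"
proof -
  let ?N = "{S. S \<subseteq> A \<and> card S = k}"
  obtain S0 where S0: "S0 \<in> set_pmf q" using set_pmf_not_empty[of q] by blast
  have N: "finite ?N" "?N \<noteq> {}" using A supp[OF S0] by (auto intro: finite_subset[of _ "Pow A"])
  have const: "pmf q T = pmf q S0" if T: "T \<in> ?N" for T
  proof -
    obtain \<sigma> where \<sigma>: "\<sigma> permutes A" "\<sigma> ` S0 = T"
      using permutes_image_exists[OF A, of S0 T] supp[OF S0] T by auto
    have "inj (image \<sigma>)" using permutes_inj[OF \<sigma>(1)] by (simp add: inj_image_eq_iff inj_def)
    then have "pmf (map_pmf (image \<sigma>) q) (\<sigma> ` S0) = pmf q S0" by (rule pmf_map_inj')
    then show ?thesis using inv[OF \<sigma>(1)] \<sigma>(2) by simp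
  qed
  have "set_pmf q \<subseteq> ?N" using supp by blast
  then have "(\<Sum>T\<in>?N. pmf q T) = 1" using N(1) by (rule sum_pmf_eq_1[rotated])
  then have "card ?N * pmf q S0 = 1" using const by simp
  then have c: "pmf q S0 = 1 / card ?N" using N by (simp add: field_simps card_gt_0_iff)
  show ?thesis
  proof (rule pmf_eqI)
    fix T show "pmf q T = pmf (ksub k A) T"
    proof (cases "T \<in> ?N")
      case True
      then show ?thesis using const[OF True] c N by (simp add: ksub_def)
    next
      case False
      then have "pmf q T = 0" using supp by (auto simp: set_pmf_iff)
      then show ?thesis using False N by (simp add: ksub_def)
    qed
  qed
qed

text \<open>A uniform \<open>k\<close>-subset of \<open>A\<close>; the fallback \<open>D\<close> keeps the choice total when \<open>A\<close> is too small.\<close>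
definition pick :: "nat \<Rightarrow> 'a set \<Rightarrow> 'a set \<Rightarrow> 'a set pmf" where
  "pick k A D = (if k \<le> card A then ksub k A else ksub k D)"

text \<open>Both branches of \<open>pick\<close> commute with the permutations of \<open>D\<close>,
  and so does the binomial set. Because the fallback is \<open>D\<close> itself, the result is
  exactly uniform, without an error for small \<open>C\<close>.\<close>

lemma pick_rsub:
  assumes D: "finite D" "k \<le> card D"
  shows "bind_pmf (rsub a D) (\<lambda>C. pick k C D) = ksub k D"
proof (rule eq_ksubI[OF D(1)])
  show "S \<subseteq> D \<and> card S = k" if S: "S \<in> set_pmf (bind_pmf (rsub a D) (\<lambda>C. pick k C D))" for S
  proof -
    obtain C where "C \<subseteq> D" "S \<in> set_pmf (pick k C D)" using S set_rsub[OF D(1)] by auto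
    then show ?thesis using D finite_subset[of C D] by (auto simp: pick_def set_ksub split: if_splits)
  qed
  show "map_pmf (image \<sigma>) (bind_pmf (rsub a D) (\<lambda>C. pick k C D)) = bind_pmf (rsub a D) (\<lambda>C. pick k C D)"
    if \<sigma>: "\<sigma> permutes D" for \<sigma>
  proof -
    have inj: "inj \<sigma>" and im: "\<sigma> ` D = D" using \<sigma> by (auto simp: permutes_inj permutes_image)
    have "map_pmf (image \<sigma>) (bind_pmf (rsub a D) (\<lambda>C. pick k C D))
        = bind_pmf (rsub a D) (\<lambda>C. pick k (\<sigma> ` C) D)"
      unfolding map_bind_pmf
    proof (rule bind_pmf_cong[OF refl])
      fix C assume "C \<in> set_pmf (rsub a D)"
      then have C: "C \<subseteq> D" "finite C" using set_rsub[OF D(1)] D(1) finite_subset by blast+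
      have "card (\<sigma> ` C) = card C" using inj by (simp add: card_image inj_on_subset)
      then show "map_pmf (image \<sigma>) (pick k C D) = pick k (\<sigma> ` C) D"
        using D C inj im ksub_image[of D \<sigma> k] by (auto simp: pick_def ksub_image inj_on_subset)
    qed
    also have "\<dots> = bind_pmf (map_pmf (image \<sigma>) (rsub a D)) (\<lambda>C. pick k C D)"
      by (simp add: bind_map_pmf)
    also have "map_pmf (image \<sigma>) (rsub a D) = rsub a D"
      using rsub_image[OF D(1), of \<sigma> a] inj im by (simp add: inj_on_subset)
    finally show ?thesis .
  qed
qed

text \<open>Bayes' rule for a joint mass that is constant along each fibre: given \<open>b\<close>,
  the first coordinate is uniform on \<open>K b\<close>. The constant \<open>g b\<close> may vary
  with \<open>b\<close>.\<close>

lemma bind_uniform_fibre: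
  fixes J :: "('z \<times> 'b) pmf"
  assumes K: "\<And>b. b \<in> set_pmf (map_pmf snd J) \<Longrightarrow> finite (K b) \<and> K b \<noteq> {}"
    and J: "\<And>z b. b \<in> set_pmf (map_pmf snd J) \<Longrightarrow> pmf J (z,b) = (if z \<in> K b then g b else 0)"
  shows "bind_pmf (map_pmf snd J) (\<lambda>b. map_pmf (\<lambda>z. (z,b)) (pmf_of_set (K b))) = J"
proof (rule pmf_eqI)
  fix x :: "'z \<times> 'b"
  obtain z b where x: "x = (z,b)" by force
  have "pmf (bind_pmf (map_pmf snd J) (\<lambda>b. map_pmf (\<lambda>z. (z,b)) (pmf_of_set (K b)))) x
      = measure_pmf.expectation (map_pmf snd J) (\<lambda>b'. indicator {b} b' * pmf (pmf_of_set (K b)) z)"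
    unfolding pmf_bind x
  proof (rule Bochner_Integration.integral_cong[OF refl])
    fix b'
    show "pmf (map_pmf (\<lambda>z. (z, b')) (pmf_of_set (K b'))) (z, b) = indicator {b} b' * pmf (pmf_of_set (K b)) z"
    proof (cases "b' = b")
      case True
      then show ?thesis using pmf_map_inj'[of "\<lambda>z. (z,b)" "pmf_of_set (K b)" z] by (simp add: inj_def)
    next
      case False
      then have "(z,b) \<notin> set_pmf (map_pmf (\<lambda>z. (z, b')) (pmf_of_set (K b')))" by auto
      then show ?thesis using False by (simp add: pmf_eq_0_set_pmf)
    qed
  qed
  also have "\<dots> = pmf (map_pmf snd J) b * pmf (pmf_of_set (K b)) z"
    by (simp add: measure_pmf_single)
  also have "\<dots> = pmf J x"
  proof (cases "b \<in> set_pmf (map_pmf snd J)")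
    case True
    note Kb = K[OF True]
    have "pmf (map_pmf snd J) b = measure J (snd -` {b})" by (rule pmf_map)
    also have "\<dots> = measure J ((\<lambda>z. (z,b)) ` K b)"
    proof (rule measure_prob_cong_0)
      show "pmf J y = 0" if "y \<in> snd -` {b} - (\<lambda>z. (z,b)) ` K b" for y
        using that J[OF True] by (cases y) auto
    qed auto
    also have "\<dots> = (\<Sum>z\<in>K b. pmf J (z,b))"
      using Kb by (subst measure_measure_pmf_finite) (auto simp: sum.reindex inj_on_def)
    also have "\<dots> = card (K b) * g b" using J[OF True] by simp
    finally show ?thesis using Kb J[OF True] x by (simp add: indicator_def)
  next
    case False
    then have "x \<notin> set_pmf J" using x by force
    then have "pmf (map_pmf snd J) b = 0" "pmf J x = 0" using False by (simp_all add: pmf_eq_0_set_pmf)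
    then show ?thesis by simp
  qed
  finally show "pmf (bind_pmf (map_pmf snd J) (\<lambda>b. map_pmf (\<lambda>z. (z,b)) (pmf_of_set (K b)))) x = pmf J x" .
qed

section \<open>Announced permissions and their law given the choice of one round\<close>

definition perm_law :: "nat \<Rightarrow> real \<Rightarrow> 'a set \<Rightarrow> 'a set pmf" where
  "perm_law k a N = map_pmf (\<lambda>(Y,Z). Y - Z) (pair_pmf (rsub a N) (ksub k N))"

lemma set_perm_law:
  assumes "finite N" "k \<le> card N" "B \<in> set_pmf (perm_law k a N)"
  shows "B \<subseteq> N \<and> k \<le> card (N - B)"
proof -
  obtain Y Z where "B = Y - Z" "Y \<subseteq> N" "Z \<subseteq> N" "card Z = k"
    using assms set_rsub[OF assms(1)] by (auto simp: perm_law_def set_ksub)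
  then show ?thesis using card_mono[of "N - B" Z] assms(1) by auto
qed

text \<open>For disjoint \<open>S\<close> and \<open>B\<close>, the joint mass on the right depends
  on \<open>card B\<close> only; so given \<open>B\<close>, the set \<open>S\<close> is uniform
  among the \<open>k\<close>-subsets of \<open>N - B\<close>. The marginal law of \<open>B\<close>
  there is \<open>perm_law\<close>, as a binomial subset of \<open>N - S\<close> is a binomial
  subset of \<open>N\<close> with \<open>S\<close> removed.\<close>

lemma perm_law_posterior:
  assumes N: "finite N" "k \<le> card N" and a: "0 \<le> a" "a \<le> 1"
  shows "bind_pmf (perm_law k a N) (\<lambda>B. map_pmf (\<lambda>S. (S,B)) (ksub k (N - B)))
    = bind_pmf (ksub k N) (\<lambda>S. map_pmf (\<lambda>B. (S,B)) (rsub a (N - S)))"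
proof -
  define J where "J = bind_pmf (ksub k N) (\<lambda>S. map_pmf (\<lambda>B. (S,B)) (rsub a (N - S)))"
  have J2: "map_pmf snd J = perm_law k a N"
  proof -
    have "perm_law k a N = bind_pmf (ksub k N) (\<lambda>Z. map_pmf (\<lambda>Y. Y - Z) (rsub a N))"
      unfolding perm_law_def by (subst pair_commute_pmf) (simp add: pair_pmf_def map_bind_pmf map_pmf_def bind_assoc_pmf bind_return_pmf)
    also have "\<dots> = bind_pmf (ksub k N) (\<lambda>Z. rsub a (N - Z))"
      using rsub_Int[OF N(1), of "- _"] by (simp add: Diff_eq)
    also have "\<dots> = map_pmf snd J" unfolding J_def by (simp add: map_bind_pmf pmf.map_comp o_def)
    finally show ?thesis ..
  qed
  have pmfJ: "pmf J (z,b) = pmf (ksub k N) z * pmf (rsub a (N - z)) b" for z b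
  proof -
    have "pmf J (z,b) = measure_pmf.expectation (ksub k N) (\<lambda>S. indicator {z} S * pmf (rsub a (N - z)) b)"
      unfolding J_def pmf_bind
    proof (rule Bochner_Integration.integral_cong[OF refl])
      fix S
      show "pmf (map_pmf (\<lambda>B. (S, B)) (rsub a (N - S))) (z, b) = indicator {z} S * pmf (rsub a (N - z)) b"
      proof (cases "S = z")
        case True
        then show ?thesis using pmf_map_inj'[of "\<lambda>B. (z,B)" "rsub a (N - z)" b] by (simp add: inj_def)
      next
        case False
        then have "(z,b) \<notin> set_pmf (map_pmf (\<lambda>B. (S, B)) (rsub a (N - S)))" by auto
        then show ?thesis using False by (simp add: pmf_eq_0_set_pmf)
      qed
    qed
    then show ?thesis by (simp add: measure_pmf_single)
  qed
  define g where "g b = a ^ card b * (1 - a) ^ (card N - k - card b) / card {S. S \<subseteq> N \<and> card S = k}" for b :: "'a set"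
  have "bind_pmf (map_pmf snd J) (\<lambda>B. map_pmf (\<lambda>S. (S,B)) (pmf_of_set {S. S \<subseteq> N - B \<and> card S = k})) = J"
  proof (rule bind_uniform_fibre)
    fix b assume "b \<in> set_pmf (map_pmf snd J)"
    then have b: "b \<subseteq> N" "k \<le> card (N - b)" unfolding J2 using set_perm_law[OF N] by auto
    show "finite {S. S \<subseteq> N - b \<and> card S = k} \<and> {S. S \<subseteq> N - b \<and> card S = k} \<noteq> {}"
      using ksub_ne[of "N - b" k] N b by simp
    fix z
    show "pmf J (z, b) = (if z \<in> {S. S \<subseteq> N - b \<and> card S = k} then g b else 0)"
    proof (cases "z \<subseteq> N \<and> card z = k")
      case True
      then have finz: "finite z" using N(1) finite_subset by blast
      have 1: "pmf (ksub k N) z = 1 / card {S. S \<subseteq> N \<and> card S = k}"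
        unfolding ksub_def using ksub_ne[OF N] True by (subst pmf_of_set) auto
      have "card (N - z - b) = card N - k - card b" if "b \<subseteq> N - z"
        using that True finz b(1) N(1) by (metis card_Diff_subset finite_Diff finite_subset)
      then have 2: "pmf (rsub a (N - z)) b = (if b \<subseteq> N - z then a ^ card b * (1 - a) ^ (card N - k - card b) else 0)"
        using N(1) a by (simp add: pmf_rsub)
      have "b \<subseteq> N - z \<longleftrightarrow> z \<subseteq> N - b" using True b(1) by blast
      then show ?thesis unfolding pmfJ 1 2 using True by (simp add: g_def)
    next
      case False
      then have "pmf (ksub k N) z = 0" unfolding ksub_def using ksub_ne[OF N] by (subst pmf_of_set) auto
      then show ?thesis using False by (auto simp: pmfJ)
    qed
  qed
  then show ?thesis unfolding J2 by (simp add: J_def ksub_def)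
qed

text \<open>In the view of one round, \<open>S\<close> is the choice of a vertex with neighbourhood \<open>N\<close> and \<open>B \<union> y\<close> is what it
  reveals to later vertices: the permissions \<open>B\<close> and fresh coins \<open>y\<close> on \<open>S\<close>.\<close>
lemma exposure_step:
  assumes N: "finite N" "k \<le> card N" and a: "0 \<le> a" "a \<le> 1"
  shows "do {B \<leftarrow> perm_law k a N; C \<leftarrow> rsub a N; S \<leftarrow> pick k (C - B) (N - B); y \<leftarrow> rsub a S; return_pmf (S, B \<union> y)}
    = pair_pmf (ksub k N) (rsub a N)"
proof -
  let ?tail = "\<lambda>S B. map_pmf (\<lambda>y. (S, B \<union> y)) (rsub a S)"
  have "do {B \<leftarrow> perm_law k a N; C \<leftarrow> rsub a N; S \<leftarrow> pick k (C - B) (N - B); y \<leftarrow> rsub a S; return_pmf (S, B \<union> y)}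
    = do {B \<leftarrow> perm_law k a N; S \<leftarrow> bind_pmf (rsub a N) (\<lambda>C. pick k (C - B) (N - B)); ?tail S B}"
    by (simp add: bind_assoc_pmf map_pmf_def)
  also have "\<dots> = do {B \<leftarrow> perm_law k a N; S \<leftarrow> ksub k (N - B); ?tail S B}"
  proof (rule bind_pmf_cong[OF refl])
    fix B assume B: "B \<in> set_pmf (perm_law k a N)"
    have "bind_pmf (rsub a N) (\<lambda>C. pick k (C - B) (N - B))
      = bind_pmf (map_pmf (\<lambda>C. C \<inter> - B) (rsub a N)) (\<lambda>C. pick k C (N - B))"
      by (simp add: bind_map_pmf Diff_eq)
    also have "\<dots> = bind_pmf (rsub a (N - B)) (\<lambda>C. pick k C (N - B))"
      using N(1) by (simp add: rsub_Int Diff_eq)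
    also have "\<dots> = ksub k (N - B)" using pick_rsub[of "N - B" k a] set_perm_law[OF N B] N by simp
    finally show "do {S \<leftarrow> bind_pmf (rsub a N) (\<lambda>C. pick k (C - B) (N - B)); ?tail S B}
      = do {S \<leftarrow> ksub k (N - B); ?tail S B}" by simp
  qed
  also have "\<dots> = bind_pmf (bind_pmf (perm_law k a N) (\<lambda>B. map_pmf (\<lambda>S. (S,B)) (ksub k (N - B)))) (\<lambda>(S,B). ?tail S B)"
    by (simp add: bind_assoc_pmf bind_map_pmf)
  also have "\<dots> = bind_pmf (bind_pmf (ksub k N) (\<lambda>S. map_pmf (\<lambda>B. (S,B)) (rsub a (N - S)))) (\<lambda>(S,B). ?tail S B)"
    by (subst perm_law_posterior[OF N a]) simp
  also have "\<dots> = bind_pmf (ksub k N) (\<lambda>S. bind_pmf (rsub a (N - S)) (\<lambda>B. ?tail S B))"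
    by (simp add: bind_assoc_pmf bind_map_pmf)
  \<comment> \<open>After the exchange of order, \<open>B\<close> is binomial on
    \<open>N - S\<close> and the fresh coins are binomial on \<open>S\<close>. Their union is
    binomial on \<open>N\<close> whatever \<open>S\<close> is, hence independent of
    \<open>S\<close>.\<close>
  also have "\<dots> = bind_pmf (ksub k N) (\<lambda>S. map_pmf (\<lambda>X. (S, X)) (rsub a N))"
  proof (rule bind_pmf_cong[OF refl])
    fix S assume "S \<in> set_pmf (ksub k N)"
    then have S: "S \<subseteq> N" "finite S" using finite_subset[of S N] N by (simp_all add: set_ksub)
    have "rsub a N = rsub a ((N - S) \<union> S)" using S(1) by (simp add: Un_absorb2)
    also have "\<dots> = map_pmf (\<lambda>(X,Y). X \<union> Y) (pair_pmf (rsub a (N - S)) (rsub a S))"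
      using N S by (intro rsub_Un) auto
    finally show "bind_pmf (rsub a (N - S)) (\<lambda>B. ?tail S B) = map_pmf (\<lambda>X. (S, X)) (rsub a N)"
      by (simp add: pair_pmf_def map_bind_pmf map_pmf_def bind_assoc_pmf bind_return_pmf)
  qed
  finally show ?thesis by (simp add: pair_pmf_def map_pmf_def)
qed

section \<open>Exposing the graph in the view of one round\<close>

text \<open>Regroups three independent families, each split into its value at one vertex and the
  rest, into all data of that vertex and all data of the rest.\<close>

lemma pair_pmf_rearrange:
  "pair_pmf (pair_pmf (pair_pmf A A') (pair_pmf B B')) (pair_pmf C C')
   = map_pmf (\<lambda>(((a,b),c),((a',b'),c')). (((a,a'),(b,b')),(c,c')))
       (pair_pmf (pair_pmf (pair_pmf A B) C) (pair_pmf (pair_pmf A' B') C'))"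
    (is "?L = map_pmf ?\<phi> ?R")
proof (rule pmf_eqI, clarify)
  fix a a' b b' c c'
  have inj: "inj ?\<phi>" by (auto simp: inj_def)
  have "pmf (map_pmf ?\<phi> ?R) (?\<phi> (((a,b),c),((a',b'),c'))) = pmf ?R (((a,b),c),((a',b'),c'))"
    by (rule pmf_map_inj'[OF inj])
  then show "pmf ?L (((a,a'),(b,b')),(c,c')) = pmf (map_pmf ?\<phi> ?R) (((a,a'),(b,b')),(c,c'))"
    by (simp add: pmf_pair)
qed

text \<open>\<open>A\<close> is meant as the real pool and \<open>P\<close> as the pool enlarged by
  virtual permissions. The real choice keeps what the virtual choice \<open>S\<close> has in
  \<open>A\<close> and is refilled inside \<open>A - S\<close>, so \<open>S\<close> leaves it only
  in \<open>P - A\<close>. The other branch keeps both marginals correct for arbitrary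
  arguments.\<close>

definition coupled_pick :: "nat \<Rightarrow> 'a set \<Rightarrow> 'a set \<Rightarrow> 'a set \<Rightarrow> ('a set \<times> 'a set) pmf" where
  "coupled_pick k A P D = (if finite P \<and> A \<subseteq> P \<and> k \<le> card A
     then bind_pmf (ksub k P) (\<lambda>S. map_pmf (\<lambda>R. (S \<inter> A \<union> R, S)) (ksub (k - card (S \<inter> A)) (A - S)))
     else pair_pmf (pick k A D) (pick k P D))"

lemma map_snd_coupled_pick: "map_pmf snd (coupled_pick k A P D) = pick k P D"
proof (cases "finite P \<and> A \<subseteq> P \<and> k \<le> card A")
  case True
  then have "k \<le> card P" using card_mono[of P A] by linarith
  then show ?thesis using True by (simp add: coupled_pick_def map_bind_pmf pmf.map_comp o_def pick_def bind_return_pmf' map_pmf_const)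
next
  case False
  show ?thesis unfolding coupled_pick_def if_not_P[OF False] by (rule map_snd_pair_pmf)
qed

lemma coupled_pick_size:
  assumes "finite P" "A \<subseteq> P" "k \<le> card A" "S \<subseteq> P" "card S = k"
  shows "k - card (S \<inter> A) \<le> card (A - S)" "card (S \<inter> A) \<le> k" "finite (A - S)"
proof -
  have "finite A" "finite S" using assms finite_subset by blast+
  then show "card (S \<inter> A) \<le> k" "finite (A - S)" using assms(5) by (auto intro: card_mono)
  have "card (A - S) = card A - card (S \<inter> A)"
    using \<open>finite S\<close> by (simp add: card_Diff_subset_Int Int_commute)
  then show "k - card (S \<inter> A) \<le> card (A - S)" using assms(3) by linarith
qed

text \<open>A permutation of \<open>A\<close> extends by the identity to a permutation of
  \<open>P\<close>, so the whole construction commutes with it and \<open>eq_ksubI\<close>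
  applies.\<close>

lemma map_fst_coupled_pick: "map_pmf fst (coupled_pick k A P D) = pick k A D"
proof (cases "finite P \<and> A \<subseteq> P \<and> k \<le> card A")
  case True
  then have fin: "finite A" "finite P" and AP: "A \<subseteq> P" and kA: "k \<le> card A" and kP: "k \<le> card P"
    using card_mono[of P A] finite_subset by (auto intro: order_trans)
  define g where "g = (\<lambda>S. map_pmf (\<lambda>R. S \<inter> A \<union> R) (ksub (k - card (S \<inter> A)) (A - S)))"
  have g: "map_pmf fst (coupled_pick k A P D) = bind_pmf (ksub k P) g"
    using True by (simp add: coupled_pick_def map_bind_pmf pmf.map_comp o_def g_def)
  have "bind_pmf (ksub k P) g = ksub k A"
  proof (rule eq_ksubI[OF fin(1)])
    fix X assume "X \<in> set_pmf (bind_pmf (ksub k P) g)"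
    then obtain S where S: "S \<subseteq> P" "card S = k" "X \<in> set_pmf (g S)" using fin kP by (auto simp: set_ksub)
    note cs = coupled_pick_size[OF fin(2) AP kA S(1,2)]
    from S(3) cs obtain R where R: "X = S \<inter> A \<union> R" "R \<subseteq> A - S" "card R = k - card (S \<inter> A)"
      by (auto simp: g_def set_ksub)
    have "finite S" "finite R" using S(1) R(2) fin finite_subset cs(3) by blast+
    then have "card X = card (S \<inter> A) + card R" unfolding R(1) using R(2) by (intro card_Un_disjoint) auto
    then show "X \<subseteq> A \<and> card X = k" using R cs(2) by auto
  next
    fix \<sigma> assume \<sigma>: "\<sigma> permutes A"
    have \<sigma>P: "\<sigma> permutes P" by (rule permutes_subset[OF \<sigma> AP])
    have inj: "inj \<sigma>" using \<sigma> by (rule permutes_inj)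
    have im: "\<sigma> ` A = A" "\<sigma> ` P = P" using \<sigma> \<sigma>P by (auto simp: permutes_image)
    have "map_pmf (image \<sigma>) (bind_pmf (ksub k P) g) = bind_pmf (ksub k P) (\<lambda>S. g (\<sigma> ` S))"
      unfolding map_bind_pmf
    proof (rule bind_pmf_cong[OF refl])
      fix S assume "S \<in> set_pmf (ksub k P)"
      then have S: "S \<subseteq> P" "card S = k" using fin kP by (auto simp: set_ksub)
      note cs = coupled_pick_size[OF fin(2) AP kA S]
      have 1: "\<sigma> ` S \<inter> A = \<sigma> ` (S \<inter> A)" using im inj by (metis image_Int)
      have 2: "A - \<sigma> ` S = \<sigma> ` (A - S)" using im inj by (metis image_set_diff)
      have 3: "card (\<sigma> ` (S \<inter> A)) = card (S \<inter> A)" using inj by (simp add: card_image inj_on_subset)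
      have 4: "ksub (k - card (S \<inter> A)) (\<sigma> ` (A - S)) = map_pmf (image \<sigma>) (ksub (k - card (S \<inter> A)) (A - S))"
        by (rule ksub_image[OF cs(3) inj_on_subset[OF inj subset_UNIV] cs(1), symmetric])
      show "map_pmf (image \<sigma>) (g S) = g (\<sigma> ` S)"
        unfolding g_def 1 2 3 4 by (simp add: pmf.map_comp o_def image_Un)
    qed
    also have "\<dots> = bind_pmf (map_pmf (image \<sigma>) (ksub k P)) g" by (simp add: bind_map_pmf)
    also have "map_pmf (image \<sigma>) (ksub k P) = ksub k P"
      using ksub_image[OF fin(2) _ kP, of \<sigma>] inj im by (simp add: inj_on_subset)
    finally show "map_pmf (image \<sigma>) (bind_pmf (ksub k P) g) = bind_pmf (ksub k P) g" .
  qed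
  then show ?thesis using g kA by (simp add: pick_def)
next
  case False
  show ?thesis unfolding coupled_pick_def if_not_P[OF False] by (rule map_fst_pair_pmf)
qed

lemma coupled_pick_support:
  assumes "finite P" "A \<subseteq> P" "k \<le> card A" "(Q, S) \<in> set_pmf (coupled_pick k A P D)"
  shows "S \<subseteq> Q \<union> (P - A)"
proof -
  have "k \<le> card P" using assms(1-3) card_mono[of P A] by linarith
  then obtain R where "S \<subseteq> P" "Q = S \<inter> A \<union> R"
    using assms by (auto simp: coupled_pick_def set_ksub)
  then show ?thesis by auto
qed

locale kout_process =
  fixes N :: "'v \<Rightarrow> 'v set" and k :: nat and a :: real
  assumes finN: "finite (N u)" and symN: "x \<in> N u \<longleftrightarrow> u \<in> N x" and irrN: "u \<notin> N u"
    and a01: "0 \<le> a" "a \<le> 1"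
begin

text \<open>\<open>T\<close> collects the exposed pairs \<open>(x, w)\<close> for which the later vertex \<open>w\<close> may, or in the view of
  the present round virtually may, choose \<open>x\<close>. The bits \<open>y\<close> are the virtual ones: they replace the
  permissions on the edges chosen by \<open>u\<close> itself.\<close>
primrec expose :: "('v \<Rightarrow> 'v set) \<Rightarrow> ('v \<Rightarrow> 'v set) \<Rightarrow> 'v list \<Rightarrow> ('v \<times> 'v) set \<Rightarrow> ('v \<Rightarrow> 'v set) pmf" where
  "expose B F [] T = return_pmf (\<lambda>_. {})"
| "expose B F (u # us) T = do {
     S \<leftarrow> pick k ((F u \<inter> set us \<union> {x. (x, u) \<in> T}) - B u) (N u - B u);
     y \<leftarrow> rsub a S;
     s \<leftarrow> expose B F us (T \<union> {u} \<times> (B u \<union> y));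
     return_pmf (s(u := S)) }"

text \<open>Only the virtual choice \<open>S\<close> feeds \<open>T\<close>, while the real choice
  \<open>Q\<close> refers to the fixed set \<open>A u\<close>. So the real choices remain
  independent of each other although the virtual ones influence later steps.\<close>

primrec expose_coupled :: "('v \<Rightarrow> 'v set) \<Rightarrow> ('v \<Rightarrow> 'v set) \<Rightarrow> ('v \<Rightarrow> 'v set) \<Rightarrow> 'v list \<Rightarrow> ('v \<times> 'v) set
    \<Rightarrow> (('v \<Rightarrow> 'v set) \<times> ('v \<Rightarrow> 'v set)) pmf" where
  "expose_coupled B F A [] T = return_pmf (\<lambda>_. {}, \<lambda>_. {})"
| "expose_coupled B F A (u # us) T = do {
     (Q, S) \<leftarrow> coupled_pick k (A u) ((F u \<inter> set us \<union> {x. (x, u) \<in> T}) - B u) (N u - B u);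
     y \<leftarrow> rsub a S;
     (q, s) \<leftarrow> expose_coupled B F A us (T \<union> {u} \<times> (B u \<union> y));
     return_pmf (q(u := Q), s(u := S)) }"

lemma map_snd_expose_coupled: "map_pmf snd (expose_coupled B F A us T) = expose B F us T"
proof (induction us arbitrary: T)
  case (Cons u us)
  let ?P = "(F u \<inter> set us \<union> {x. (x, u) \<in> T}) - B u"
  have "map_pmf snd (expose_coupled B F A (u # us) T) = do {
     (Q, S) \<leftarrow> coupled_pick k (A u) ?P (N u - B u);
     y \<leftarrow> rsub a S;
     s \<leftarrow> map_pmf snd (expose_coupled B F A us (T \<union> {u} \<times> (B u \<union> y)));
     return_pmf (s(u := S)) }"
    by (simp add: map_bind_pmf bind_map_pmf case_prod_unfold)
  also have "\<dots> = do {
     S \<leftarrow> map_pmf snd (coupled_pick k (A u) ?P (N u - B u));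
     y \<leftarrow> rsub a S;
     s \<leftarrow> expose B F us (T \<union> {u} \<times> (B u \<union> y));
     return_pmf (s(u := S)) }"
    by (simp add: Cons.IH bind_map_pmf case_prod_unfold)
  finally show ?case by (simp add: map_snd_coupled_pick)
qed simp

lemma map_fst_expose_coupled:
  "distinct us \<Longrightarrow> map_pmf fst (expose_coupled B F A us T) = Pi_pmf (set us) {} (\<lambda>u. pick k (A u) (N u - B u))"
proof (induction us arbitrary: T)
  case (Cons u us)
  let ?P = "(F u \<inter> set us \<union> {x. (x, u) \<in> T}) - B u"
  have "map_pmf fst (expose_coupled B F A (u # us) T) = do {
     (Q, S) \<leftarrow> coupled_pick k (A u) ?P (N u - B u);
     y \<leftarrow> rsub a S;
     q \<leftarrow> map_pmf fst (expose_coupled B F A us (T \<union> {u} \<times> (B u \<union> y)));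
     return_pmf (q(u := Q)) }"
    by (simp add: map_bind_pmf bind_map_pmf case_prod_unfold)
  also have "\<dots> = do {
     Q \<leftarrow> map_pmf fst (coupled_pick k (A u) ?P (N u - B u));
     q \<leftarrow> Pi_pmf (set us) {} (\<lambda>u. pick k (A u) (N u - B u));
     return_pmf (q(u := Q)) }"
    using Cons by (simp add: bind_map_pmf case_prod_unfold)
  also have "\<dots> = Pi_pmf (set (u # us)) {} (\<lambda>u. pick k (A u) (N u - B u))"
    using Cons.prems by (simp add: map_fst_coupled_pick Pi_pmf_insert')
  finally show ?case .
qed simp

lemma expose_cong:
  assumes "\<And>u. u \<in> set us \<Longrightarrow> B u = B' u \<and> F u = F' u"
    and "\<And>x u. u \<in> set us \<Longrightarrow> (x, u) \<in> T \<longleftrightarrow> (x, u) \<in> T'"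
  shows "expose B F us T = expose B' F' us T'"
  using assms
proof (induction us arbitrary: T T')
  case (Cons u us)
  have 1: "B u = B' u" "F u = F' u" "{x. (x, u) \<in> T} = {x. (x, u) \<in> T'}" using Cons.prems by auto
  have "expose B F us (T \<union> {u} \<times> (B u \<union> y)) = expose B' F' us (T' \<union> {u} \<times> (B' u \<union> y))" for y
    using Cons.prems by (intro Cons.IH) auto
  then show ?case by (simp only: expose.simps 1)
qed simp

text \<open>The coins from processed vertices \<open>D\<close> towards vertices \<open>W\<close>
  that have not yet looked at them.\<close>

definition bits :: "'v set \<Rightarrow> 'v set \<Rightarrow> ('v \<times> 'v) set" where
  "bits D W = {(x, w). x \<in> D \<and> w \<in> W \<and> w \<in> N x}"

lemma finite_bits: "finite D \<Longrightarrow> finite (bits D W)"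
  by (rule finite_subset[of _ "Sigma D N"]) (auto simp: bits_def finN)

definition envlaw :: "'v set \<Rightarrow> (('v \<Rightarrow> 'v set) \<times> ('v \<Rightarrow> 'v set)) pmf" where
  "envlaw V = pair_pmf (Pi_pmf V {} (\<lambda>u. perm_law k a (N u))) (Pi_pmf V {} (\<lambda>u. rsub a (N u)))"

text \<open>The generalisation over \<open>D\<close> is the invariant: to the unprocessed vertices,
  the coins of the processed ones form a binomial set that is independent of the data still to come.
  The first vertex \<open>u\<close> sees its own coins on later neighbours and \<open>T\<close> on
  earlier ones, together a binomial subset of \<open>N u\<close>. By \<open>exposure_step\<close>
  its choice is independent of \<open>B u \<union> y\<close>, which supplies the new coins for
  \<open>insert u D\<close>.\<close>

lemma expose_law:
  assumes "distinct us" "finite D" "set us \<inter> D = {}"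
    and "\<And>u. u \<in> set us \<Longrightarrow> N u \<subseteq> D \<union> set us" "\<And>u. u \<in> set us \<Longrightarrow> k \<le> card (N u)"
  shows "bind_pmf (pair_pmf (envlaw (set us)) (rsub a (bits D (set us)))) (\<lambda>((B, F), T). expose B F us T)
    = Pi_pmf (set us) {} (\<lambda>u. ksub k (N u))"
  using assms
proof (induction us arbitrary: D)
  case Nil
  then show ?case by (simp add: case_prod_unfold)
next
  case (Cons u us)
  let ?W = "set us"
  have u: "u \<notin> ?W" "u \<notin> D" "finite D" and ku: "k \<le> card (N u)" using Cons.prems by auto
  define E where "E = pair_pmf (envlaw ?W) (rsub a (bits D ?W))"
  define R where "R = pair_pmf (pair_pmf (perm_law k a (N u)) (rsub a (N u))) (rsub a (N u \<inter> D))"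
  \<comment> \<open>The process after \<open>u\<close>, given its choice \<open>S\<close> and the
    set \<open>Y\<close> that it reveals; only the part of \<open>Y\<close> among unprocessed
    vertices has an effect.\<close>
  define K where "K S Y = (\<lambda>((B, F), T). map_pmf (\<lambda>s. s(u := S)) (expose B F us (T \<union> {u} \<times> (Y \<inter> ?W))))"
    for S Y :: "'v set"
  have bits: "rsub a (bits D (set (u # us))) =
      map_pmf (\<lambda>(X, T). (\<lambda>x. (x, u)) ` X \<union> T) (pair_pmf (rsub a (N u \<inter> D)) (rsub a (bits D ?W)))"
  proof -
    have "bits D (set (u # us)) = (\<lambda>x. (x, u)) ` (N u \<inter> D) \<union> bits D ?W"
      using symN by (auto simp: bits_def)
    moreover have "(\<lambda>x. (x, u)) ` (N u \<inter> D) \<inter> bits D ?W = {}" using u by (auto simp: bits_def)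
    ultimately have "rsub a (bits D (set (u # us))) = map_pmf (\<lambda>(X, Y). X \<union> Y)
        (pair_pmf (rsub a ((\<lambda>x. (x, u)) ` (N u \<inter> D))) (rsub a (bits D ?W)))"
      using rsub_Un[of "(\<lambda>x. (x, u)) ` (N u \<inter> D)" "bits D ?W" a] u finN finite_bits by simp
    also have "rsub a ((\<lambda>x. (x, u)) ` (N u \<inter> D)) = map_pmf (image (\<lambda>x. (x, u))) (rsub a (N u \<inter> D))"
      using finN by (intro rsub_image) (auto simp: inj_on_def)
    finally show ?thesis by (simp add: pair_map_pmf1 pmf.map_comp o_def case_prod_unfold)
  qed
  have split: "pair_pmf (envlaw (set (u # us))) (rsub a (bits D (set (u # us)))) =
      map_pmf (\<lambda>(((b, f), X), ((B, F), T)). ((B(u := b), F(u := f)), (\<lambda>x. (x, u)) ` X \<union> T)) (pair_pmf R E)"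
  proof -
    have "pair_pmf (envlaw (set (u # us))) (rsub a (bits D (set (u # us)))) =
      map_pmf (\<lambda>(((b, B), (f, F)), (X, T)). ((B(u := b), F(u := f)), (\<lambda>x. (x, u)) ` X \<union> T))
       (pair_pmf (pair_pmf
          (pair_pmf (perm_law k a (N u)) (Pi_pmf ?W {} (\<lambda>u. perm_law k a (N u))))
          (pair_pmf (rsub a (N u)) (Pi_pmf ?W {} (\<lambda>u. rsub a (N u)))))
          (pair_pmf (rsub a (N u \<inter> D)) (rsub a (bits D ?W))))"
      unfolding bits unfolding envlaw_def list.set Pi_pmf_insert[OF finite_set u(1)]
      by (simp add: pair_map_pmf1 pair_map_pmf2 pmf.map_comp o_def case_prod_unfold)
    then show ?thesis unfolding pair_pmf_rearrange R_def E_def envlaw_def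
      by (simp add: pmf.map_comp o_def case_prod_unfold)
  qed
  have "bind_pmf (pair_pmf (envlaw (set (u # us))) (rsub a (bits D (set (u # us))))) (\<lambda>((B, F), T). expose B F (u # us) T)
    = bind_pmf R (\<lambda>((b, f), X). bind_pmf E (\<lambda>e.
        bind_pmf (pick k ((f \<inter> ?W \<union> X) - b) (N u - b)) (\<lambda>S. bind_pmf (rsub a S) (\<lambda>y. K S (b \<union> y) e))))"
  proof -
    have G: "expose (B(u := b)) (F(u := f)) (u # us) ((\<lambda>x. (x, u)) ` X \<union> T)
        = bind_pmf (pick k ((f \<inter> ?W \<union> X) - b) (N u - b)) (\<lambda>S. bind_pmf (rsub a S) (\<lambda>y. K S (b \<union> y) ((B, F), T)))"
      if T: "T \<subseteq> bits D ?W" for b f X B F T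
    proof -
      have 1: "{x. (x, u) \<in> (\<lambda>x. (x, u)) ` X \<union> T} = X" using T u(1) by (auto simp: bits_def)
      have 2: "bind_pmf (expose (B(u := b)) (F(u := f)) us ((\<lambda>x. (x, u)) ` X \<union> T \<union> {u} \<times> (b \<union> y)))
          (\<lambda>s. return_pmf (s(u := S))) = K S (b \<union> y) ((B, F), T)" for S y
      proof -
        have "expose (B(u := b)) (F(u := f)) us ((\<lambda>x. (x, u)) ` X \<union> T \<union> {u} \<times> (b \<union> y))
            = expose B F us (T \<union> {u} \<times> ((b \<union> y) \<inter> ?W))"
          using u(1) by (intro expose_cong) auto
        then show ?thesis by (simp add: K_def map_pmf_def)
      qed
      show ?thesis by (simp only: expose.simps fun_upd_same 1 2)
    qed
    have T: "snd e \<subseteq> bits D ?W" if "e \<in> set_pmf E" for e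
      using that set_rsub[OF finite_bits[OF u(3)], of "snd e" a ?W] by (auto simp: E_def)
    show ?thesis
      unfolding split bind_map_pmf pair_pmf_def[of R E] bind_assoc_pmf bind_return_pmf case_prod_unfold
      by (intro bind_pmf_cong refl) (simp add: G[OF T] del: expose.simps)
  qed
  \<comment> \<open>The remaining data \<open>E\<close> are independent of everything that
    \<open>u\<close> sees, so they can be drawn after \<open>u\<close> has chosen.\<close>
  also have "\<dots> = bind_pmf R (\<lambda>((b, f), X).
        bind_pmf (pick k ((f \<inter> ?W \<union> X) - b) (N u - b)) (\<lambda>S. bind_pmf (rsub a S) (\<lambda>y. bind_pmf E (K S (b \<union> y)))))"
    by (simp only: bind_commute_pmf[of E])
  also have "\<dots> = bind_pmf (perm_law k a (N u)) (\<lambda>b. bind_pmf (rsub a (N u)) (\<lambda>C.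
        bind_pmf (pick k (C - b) (N u - b)) (\<lambda>S. bind_pmf (rsub a S) (\<lambda>y. bind_pmf E (K S (b \<union> y))))))"
  proof -
    have C: "rsub a (N u) = map_pmf (\<lambda>(f, X). f \<inter> ?W \<union> X) (pair_pmf (rsub a (N u)) (rsub a (N u \<inter> D)))"
    proof -
      have "N u = (N u \<inter> ?W) \<union> (N u \<inter> D)" using Cons.prems(4)[of u] irrN by auto
      then have "rsub a (N u) = rsub a ((N u \<inter> ?W) \<union> (N u \<inter> D))" by simp
      also have "\<dots> = map_pmf (\<lambda>(X, Y). X \<union> Y) (pair_pmf (rsub a (N u \<inter> ?W)) (rsub a (N u \<inter> D)))"
        using Cons.prems(3) finN by (intro rsub_Un) auto
      also have "rsub a (N u \<inter> ?W) = map_pmf (\<lambda>f. f \<inter> ?W) (rsub a (N u))" using finN by (simp add: rsub_Int)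
      finally show ?thesis by (simp add: pair_map_pmf1 pmf.map_comp o_def case_prod_unfold)
    qed
    have Cb: "bind_pmf (rsub a (N u)) G = bind_pmf (rsub a (N u)) (\<lambda>f. bind_pmf (rsub a (N u \<inter> D)) (\<lambda>X. G (f \<inter> ?W \<union> X)))"
      for G :: "'v set \<Rightarrow> ('v \<Rightarrow> 'v set) pmf"
      by (subst C) (simp add: pair_pmf_def bind_map_pmf bind_assoc_pmf bind_return_pmf)
    show ?thesis
      unfolding R_def pair_pmf_def bind_assoc_pmf bind_return_pmf prod.case
      by (rule bind_pmf_cong[OF refl], rule Cb[symmetric])
  qed
  also have "\<dots> = bind_pmf (do {b \<leftarrow> perm_law k a (N u); C \<leftarrow> rsub a (N u); S \<leftarrow> pick k (C - b) (N u - b);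
        y \<leftarrow> rsub a S; return_pmf (S, b \<union> y)}) (\<lambda>(S, Y). bind_pmf E (K S Y))"
    by (simp add: bind_assoc_pmf bind_return_pmf)
  also have "\<dots> = bind_pmf (pair_pmf (ksub k (N u)) (rsub a (N u))) (\<lambda>(S, Y). bind_pmf E (K S Y))"
    by (simp only: exposure_step[OF finN ku a01])
  also have "\<dots> = bind_pmf (ksub k (N u)) (\<lambda>S. bind_pmf (rsub a (N u)) (\<lambda>Y. bind_pmf E (K S Y)))"
    by (simp add: pair_pmf_def bind_assoc_pmf bind_return_pmf)
  also have "\<dots> = bind_pmf (ksub k (N u)) (\<lambda>S. map_pmf (\<lambda>s. s(u := S)) (Pi_pmf ?W {} (\<lambda>u. ksub k (N u))))"
  proof (rule bind_pmf_cong[OF refl])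
    fix S
    have bits': "rsub a (bits (insert u D) ?W) = map_pmf (\<lambda>(Y, T). T \<union> {u} \<times> (Y \<inter> ?W)) (pair_pmf (rsub a (N u)) (rsub a (bits D ?W)))"
    proof -
      have "bits (insert u D) ?W = Pair u ` (N u \<inter> ?W) \<union> bits D ?W" by (auto simp: bits_def)
      moreover have "Pair u ` (N u \<inter> ?W) \<inter> bits D ?W = {}" using u by (auto simp: bits_def)
      ultimately have "rsub a (bits (insert u D) ?W) = map_pmf (\<lambda>(X, Y). X \<union> Y)
          (pair_pmf (rsub a (Pair u ` (N u \<inter> ?W))) (rsub a (bits D ?W)))"
        using rsub_Un[of "Pair u ` (N u \<inter> ?W)" "bits D ?W" a] u finN finite_bits by simp
      also have "rsub a (Pair u ` (N u \<inter> ?W)) = map_pmf (image (Pair u)) (map_pmf (\<lambda>Y. Y \<inter> ?W) (rsub a (N u)))"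
        using finN by (simp add: rsub_Int rsub_image inj_on_def)
      finally have "rsub a (bits (insert u D) ?W) =
          map_pmf (\<lambda>(Y, T). Pair u ` (Y \<inter> ?W) \<union> T) (pair_pmf (rsub a (N u)) (rsub a (bits D ?W)))"
        by (simp add: pair_map_pmf1 pmf.map_comp o_def case_prod_unfold)
      moreover have "(\<lambda>(Y, T). Pair u ` (Y \<inter> ?W) \<union> T) = (\<lambda>(Y, T). T \<union> {u} \<times> (Y \<inter> ?W))" by (auto simp: fun_eq_iff)
      ultimately show ?thesis by simp
    qed
    have IH: "bind_pmf (pair_pmf (envlaw ?W) (rsub a (bits (insert u D) ?W))) (\<lambda>((B, F), T). expose B F us T)
      = Pi_pmf ?W {} (\<lambda>u. ksub k (N u))"
      using Cons.prems by (intro Cons.IH) auto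
    have "bind_pmf (rsub a (N u)) (\<lambda>Y. bind_pmf E (K S Y)) = map_pmf (\<lambda>s. s(u := S))
       (bind_pmf (rsub a (N u)) (\<lambda>Y. bind_pmf (envlaw ?W) (\<lambda>(B, F). bind_pmf (rsub a (bits D ?W))
         (\<lambda>T. expose B F us (T \<union> {u} \<times> (Y \<inter> ?W))))))"
      unfolding E_def K_def pair_pmf_def[of "envlaw ?W"]
      by (simp add: map_bind_pmf bind_assoc_pmf bind_return_pmf case_prod_unfold)
    also have "bind_pmf (rsub a (N u)) (\<lambda>Y. bind_pmf (envlaw ?W) (\<lambda>(B, F). bind_pmf (rsub a (bits D ?W))
         (\<lambda>T. expose B F us (T \<union> {u} \<times> (Y \<inter> ?W))))) =
       bind_pmf (envlaw ?W) (\<lambda>(B, F). bind_pmf (rsub a (N u)) (\<lambda>Y. bind_pmf (rsub a (bits D ?W))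
         (\<lambda>T. expose B F us (T \<union> {u} \<times> (Y \<inter> ?W)))))"
      unfolding case_prod_unfold by (rule bind_commute_pmf)
    also have "\<dots> = Pi_pmf ?W {} (\<lambda>u. ksub k (N u))"
      unfolding IH[symmetric] bits' pair_pmf_def
      by (simp add: bind_assoc_pmf bind_return_pmf bind_map_pmf case_prod_unfold)
    finally show "bind_pmf (rsub a (N u)) (\<lambda>Y. bind_pmf E (K S Y)) =
      map_pmf (\<lambda>s. s(u := S)) (Pi_pmf ?W {} (\<lambda>u. ksub k (N u)))" .
  qed
  also have "\<dots> = Pi_pmf (set (u # us)) {} (\<lambda>u. ksub k (N u))"
    using u(1) by (simp add: Pi_pmf_insert' map_pmf_def)
  finally show ?case .
qed

text \<open>The edge to a later neighbour needs the coin of \<open>u\<close>, the edge to an earlier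
  one needs its permission. All of \<open>B u\<close> is removed, on earlier neighbours too: this
  gives the form \<open>C - B\<close> of \<open>exposure_step\<close> with \<open>C\<close> spread
  over the whole of \<open>N u\<close>.\<close>

definition pool :: "('v \<Rightarrow> nat) \<Rightarrow> 'v set \<Rightarrow> ('v \<Rightarrow> 'v set) \<Rightarrow> ('v \<Rightarrow> 'v set) \<Rightarrow> 'v \<Rightarrow> 'v set" where
  "pool r V B F u = ({x \<in> F u. r u < r x} \<union> {x \<in> V. r x < r u \<and> u \<in> B x}) - B u"

text \<open>\<open>s0\<close> holds the virtual choices of the processed vertices \<open>D\<close>.
  A neighbour \<open>x\<close> in the virtual but not in the real pool of \<open>u\<close> got there
  by a virtual coin, and such coins lie only on edges that \<open>x\<close> has chosen itself. Apart
  from these, the virtual choice of \<open>u\<close> is contained in the real one.\<close>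

lemma expose_coupled_support:
  assumes "(q, s) \<in> set_pmf (expose_coupled B F A us T)" and "sorted_wrt (\<lambda>x y. r x < r y) us"
    and "V = D \<union> set us" and "\<And>x u. x \<in> D \<Longrightarrow> u \<in> set us \<Longrightarrow> r x < r u" and "finite V"
    and "\<And>u. u \<in> V \<Longrightarrow> B u \<subseteq> N u \<and> F u \<subseteq> N u"
    and "\<And>u. u \<in> V \<Longrightarrow> N u \<subseteq> V"
    and "\<And>u. u \<in> set us \<Longrightarrow> A u = pool r V B F u \<and> k \<le> card (A u)"
    and "\<And>x w. (x, w) \<in> T \<Longrightarrow> w \<in> set us \<Longrightarrow> x \<in> D \<and> (w \<in> B x \<or> w \<in> s0 x)"
    and "\<And>x w. x \<in> D \<Longrightarrow> w \<in> set us \<Longrightarrow> w \<in> B x \<Longrightarrow> (x, w) \<in> T"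
    and "u \<in> set us" "x \<in> s u"
  shows "x \<in> q u \<or> (x \<in> D \<and> u \<in> s0 x) \<or> (x \<in> set us \<and> r x < r u \<and> u \<in> s x)"
  using assms
proof (induction us arbitrary: q s T D s0)
  case (Cons v us)
  let ?P = "(F v \<inter> set us \<union> {x. (x, v) \<in> T}) - B v"
  from Cons.prems(1) obtain Q S y q' s' where
    QS: "(Q, S) \<in> set_pmf (coupled_pick k (A v) ?P (N v - B v))" and y: "y \<in> set_pmf (rsub a S)"
    and qs': "(q', s') \<in> set_pmf (expose_coupled B F A us (T \<union> {v} \<times> (B v \<union> y)))"
    and q: "q = q'(v := Q)" and s: "s = s'(v := S)" by auto
  have v: "v \<in> V" "v \<notin> set us" "v \<notin> D" using Cons.prems(2-4) by auto
  have vD: "x \<in> D \<longleftrightarrow> x \<in> V \<and> r x < r v" and vus: "x \<in> set us \<longleftrightarrow> x \<in> V \<and> r v < r x" for x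
    using Cons.prems(2-4) by (auto dest: less_asym)
  have Av: "A v = pool r V B F v" "k \<le> card (A v)" using Cons.prems(8)[of v] list.set_intros(1)[of v us] by blast+
  have FV: "F v \<subseteq> V" using Cons.prems(6,7) v(1) by blast
  have TD: "{x. (x, v) \<in> T} \<subseteq> D" using Cons.prems(9)[of _ v] by auto
  have finP: "finite ?P"
    using FV TD Cons.prems(3,5) by (intro finite_subset[of ?P V]) auto
  \<comment> \<open>Real permissions of processed vertices are always recorded in \<open>T\<close>;
    hence the virtual pool contains the real one, as the coupling requires.\<close>
  have AP: "A v \<subseteq> ?P"
  proof
    fix x assume x: "x \<in> A v"
    then consider "x \<in> F v" "r v < r x" "x \<notin> B v" | "x \<in> V" "r x < r v" "v \<in> B x" "x \<notin> B v"
      by (auto simp: Av pool_def)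
    then show "x \<in> ?P"
    proof cases
      case 1 then show ?thesis using FV vus by auto
    next
      case 2 then show ?thesis using Cons.prems(10)[of x v] vD by auto
    qed
  qed
  have PA: "x \<in> D \<and> v \<in> s0 x" if "x \<in> ?P - A v" for x
  proof -
    have "x \<notin> F v \<inter> set us" using that vus by (auto simp: Av pool_def)
    then have xT: "(x, v) \<in> T" using that by auto
    then have "x \<in> D" "v \<in> B x \<or> v \<in> s0 x" using Cons.prems(9)[of x v] by auto
    then show ?thesis using that vD by (auto simp: Av pool_def)
  qed
  have SQ: "S \<subseteq> Q \<union> (?P - A v)" by (rule coupled_pick_support[OF finP AP Av(2) QS])
  have SP: "S \<subseteq> ?P"
  proof -
    have "S \<in> set_pmf (map_pmf snd (coupled_pick k (A v) ?P (N v - B v)))" using QS by force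
    moreover have "k \<le> card ?P" using Av(2) card_mono[OF finP AP] by linarith
    ultimately show ?thesis using finP by (simp add: map_snd_coupled_pick pick_def set_ksub)
  qed
  have yS: "y \<subseteq> S" using y SP finP finite_subset by (metis set_rsub)
  show ?case
  proof (cases "u = v")
    case True
    then have "x \<in> S" using Cons.prems(12) s by simp
    then show ?thesis using SQ PA[of x] True q by auto
  next
    case False
    then have u: "u \<in> set us" "x \<in> s' u" using Cons.prems(11,12) s by auto
    have "x \<in> q' u \<or> (x \<in> insert v D \<and> u \<in> (s0(v := S)) x) \<or> (x \<in> set us \<and> r x < r u \<and> u \<in> s' x)"
    proof (rule Cons.IH[OF qs' _ _ _ Cons.prems(5-7) _ _ _ u])
      show "(z \<in> insert v D) \<and> (w \<in> B z \<or> w \<in> (s0(v := S)) z)"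
        if "(z, w) \<in> T \<union> {v} \<times> (B v \<union> y)" "w \<in> set us" for z w
        using that Cons.prems(9)[of z w] yS v(3) by auto
      show "(z, w) \<in> T \<union> {v} \<times> (B v \<union> y)" if "z \<in> insert v D" "w \<in> set us" "w \<in> B z" for z w
        using that Cons.prems(10)[of z w] by auto
      show "A w = pool r V B F w \<and> k \<le> card (A w)" if "w \<in> set us" for w
        using Cons.prems(8)[of w] that list.set_intros(2)[of w us v] by blast
    qed (use Cons.prems(2,3,4) in auto)
    then show ?thesis using u v False q s Cons.prems(2) by auto
  qed
qed simp

definition choice_edges :: "'v set \<Rightarrow> ('v \<Rightarrow> 'v set) \<Rightarrow> 'v set set" where
  "choice_edges V s = {{v, u} |v u. v \<in> V \<and> u \<in> s v}"

lemma set_envlaw: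
  assumes "finite V" "\<And>u. u \<in> V \<Longrightarrow> k \<le> card (N u)" "(B, F) \<in> set_pmf (envlaw V)" "u \<in> V"
  shows "B u \<subseteq> N u" "F u \<subseteq> N u"
proof -
  have "B u \<in> set_pmf (perm_law k a (N u))" "F u \<in> set_pmf (rsub a (N u))"
    using assms(1,3,4) by (auto simp: envlaw_def set_Pi_pmf PiE_dflt_def)
  then show "B u \<subseteq> N u" "F u \<subseteq> N u"
    using set_perm_law[OF finN assms(2)[OF assms(4)]] set_rsub[OF finN] by auto
qed

text \<open>The virtual choices form an exact \<open>k\<close>-out graph by
  \<open>expose_law\<close>, and in the coupling its edges are among the real ones as soon as all
  pools have \<open>k\<close> elements. Monotonicity is asked only below
  \<open>choice_edges V N\<close>, since a graph property is monotone among simple graphs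
  only.\<close>

lemma kout_domination:
  fixes r :: "'v \<Rightarrow> nat" and \<Phi> :: "'v set set \<Rightarrow> bool"
  assumes V: "finite V" "inj_on r V" "\<And>u. u \<in> V \<Longrightarrow> N u \<subseteq> V" and kN: "\<And>u. u \<in> V \<Longrightarrow> k \<le> card (N u)"
    and mono: "\<And>E E'. E \<subseteq> E' \<Longrightarrow> E' \<subseteq> choice_edges V N \<Longrightarrow> \<Phi> E \<Longrightarrow> \<Phi> E'"
  shows "measure_pmf.prob (Pi_pmf V {} (\<lambda>u. ksub k (N u))) {s. \<Phi> (choice_edges V s)}
    \<le> measure_pmf.prob (bind_pmf (envlaw V) (\<lambda>(B, F). Pi_pmf V {} (\<lambda>u. pick k (pool r V B F u) (N u - B u)))) {q. \<Phi> (choice_edges V q)}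
      + measure_pmf.prob (envlaw V) {(B, F). \<exists>u\<in>V. card (pool r V B F u) < k}"
proof -
  define us where "us = map (inv_into V r) (sorted_list_of_set (r ` V))"
  have us: "set us = V" "distinct us" "sorted_wrt (\<lambda>x y. r x < r y) us"
  proof -
    show "set us = V" using V by (auto simp: us_def)
    show "distinct us" using V by (auto simp: us_def distinct_map inj_on_inv_into)
    have "sorted_wrt (\<lambda>x y. r (inv_into V r x) < r (inv_into V r y)) (sorted_list_of_set (r ` V))"
      using strict_sorted_list_of_set[of "r ` V"]
      by (rule sorted_wrt_mono_rel[rotated]) (use V in \<open>auto simp: f_inv_into_f\<close>)
    then show "sorted_wrt (\<lambda>x y. r x < r y) us" by (simp add: us_def sorted_wrt_map)
  qed
  define W where "W = bind_pmf (envlaw V) (\<lambda>(B, F). map_pmf (Pair (B, F)) (expose_coupled B F (pool r V B F) us {}))"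
  have Wfst: "map_pmf fst W = envlaw V"
    by (simp add: W_def map_bind_pmf pmf.map_comp o_def case_prod_unfold map_pmf_const bind_return_pmf')
  have Ws: "map_pmf (snd \<circ> snd) W = Pi_pmf V {} (\<lambda>u. ksub k (N u))"
  proof -
    have "map_pmf (snd \<circ> snd) W = bind_pmf (envlaw V) (\<lambda>(B, F). expose B F us {})"
      by (simp add: W_def map_bind_pmf pmf.map_comp o_def case_prod_unfold map_snd_expose_coupled)
    also have "\<dots> = bind_pmf (pair_pmf (envlaw (set us)) (rsub a (bits {} (set us)))) (\<lambda>((B, F), T). expose B F us T)"
      by (simp add: bits_def pair_pmf_def us bind_assoc_pmf bind_return_pmf case_prod_unfold)
    also have "\<dots> = Pi_pmf V {} (\<lambda>u. ksub k (N u))"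
      using expose_law[OF us(2), of "{}"] V(3) kN by (simp add: us)
    finally show ?thesis .
  qed
  have Wq: "map_pmf (fst \<circ> snd) W = bind_pmf (envlaw V) (\<lambda>(B, F). Pi_pmf V {} (\<lambda>u. pick k (pool r V B F u) (N u - B u)))"
    by (simp add: W_def map_bind_pmf pmf.map_comp o_def case_prod_unfold map_fst_expose_coupled us)
  define bad where "bad = {(B, F). \<exists>u\<in>V. card (pool r V B F u) < k}"
  have incl: "\<Phi> (choice_edges V q) \<or> (B, F) \<in> bad" if W: "((B, F), q, s) \<in> set_pmf W" and s: "\<Phi> (choice_edges V s)" for B F q s
  proof (rule disjCI)
    assume nb: "(B, F) \<notin> bad"
    have BF: "(B, F) \<in> set_pmf (envlaw V)" and qs: "(q, s) \<in> set_pmf (expose_coupled B F (pool r V B F) us {})"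
      using W by (auto simp: W_def)
    have BFN: "B u \<subseteq> N u" "F u \<subseteq> N u" if "u \<in> V" for u
      using set_envlaw(1,2)[of V B F u] V(1) kN BF that by auto
    have kA: "k \<le> card (pool r V B F u)" if "u \<in> V" for u using nb that by (auto simp: bad_def not_less)
    have step: "x \<in> q u \<or> (x \<in> V \<and> r x < r u \<and> u \<in> s x)" if "u \<in> V" "x \<in> s u" for u x
    proof -
      have "x \<in> q u \<or> (x \<in> {} \<and> u \<in> (\<lambda>_. {}) x) \<or> (x \<in> set us \<and> r x < r u \<and> u \<in> s x)"
        by (rule expose_coupled_support[OF qs us(3), of V "{}"]) (use us V BFN kA that in auto)
      then show ?thesis using us by auto
    qed
    have "choice_edges V s \<subseteq> choice_edges V q"
    proof
      fix e assume "e \<in> choice_edges V s"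
      then obtain u x where e: "e = {u, x}" "u \<in> V" "x \<in> s u" by (auto simp: choice_edges_def)
      show "e \<in> choice_edges V q"
      proof (cases "x \<in> q u")
        case True then show ?thesis using e by (auto simp: choice_edges_def)
      next
        case False
        then have "x \<in> V" "r x < r u" "u \<in> s x" using step[OF e(2,3)] by auto
        \<comment> \<open>The second application of \<open>step\<close> ends the recursion:
          \<open>x\<close> precedes \<open>u\<close>, so its choice of \<open>u\<close> cannot be
          charged to \<open>u\<close> again.\<close>
        then have "u \<in> q x" using step[of x u] by auto
        then show ?thesis using \<open>x \<in> V\<close> e by (auto simp: choice_edges_def)
      qed
    qed
    moreover have "choice_edges V q \<subseteq> choice_edges V N"
    proof -
      have "q \<in> set_pmf (map_pmf fst (expose_coupled B F (pool r V B F) us {}))" using qs by force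
      then have hq: "q u \<in> set_pmf (pick k (pool r V B F u) (N u - B u))" if "u \<in> V" for u
        using that V(1) by (auto simp: map_fst_expose_coupled us set_Pi_pmf PiE_dflt_def)
      have qk: "q u \<in> set_pmf (ksub k (pool r V B F u))" if "u \<in> V" for u
        using hq[OF that] kA[OF that] by (simp add: pick_def)
      have poolN: "pool r V B F u \<subseteq> N u" if u: "u \<in> V" for u
      proof
        fix x assume "x \<in> pool r V B F u"
        then consider "x \<in> F u" | "x \<in> V" "u \<in> B x" by (auto simp: pool_def)
        then show "x \<in> N u" using BFN(2)[OF u] BFN(1)[of x] symN[of x u] by cases auto
      qed
      have "q u \<subseteq> N u" if "u \<in> V" for u
        using qk[OF that] poolN[OF that] set_ksub[OF finite_subset[OF poolN[OF that] finN] kA[OF that]] by auto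
      then show ?thesis by (auto simp: choice_edges_def)
    qed
    ultimately show "\<Phi> (choice_edges V q)" using s by (rule mono)
  qed
  have "measure_pmf.prob (Pi_pmf V {} (\<lambda>u. ksub k (N u))) {s. \<Phi> (choice_edges V s)} = measure_pmf.prob W {w. \<Phi> (choice_edges V (snd (snd w)))}"
    unfolding Ws[symmetric] by (simp add: vimage_def)
  also have "\<dots> \<le> measure_pmf.prob W ({w. \<Phi> (choice_edges V (fst (snd w)))} \<union> {w. fst w \<in> bad})"
  proof (rule measure_pmf.finite_measure_mono_AE)
    show "AE x in measure_pmf W. x \<in> {w. \<Phi> (choice_edges V (snd (snd w)))} \<longrightarrow> x \<in> {w. \<Phi> (choice_edges V (fst (snd w)))} \<union> {w. fst w \<in> bad}"
    proof (rule AE_pmfI)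
      fix w assume w: "w \<in> set_pmf W"
      obtain B F q s where weq: "w = ((B, F), q, s)" by (metis prod.exhaust)
      show "w \<in> {w. \<Phi> (choice_edges V (snd (snd w)))} \<longrightarrow> w \<in> {w. \<Phi> (choice_edges V (fst (snd w)))} \<union> {w. fst w \<in> bad}"
        using incl[of B F q s] w unfolding weq by simp
    qed
  qed simp
  also have "\<dots> \<le> measure_pmf.prob W {w. \<Phi> (choice_edges V (fst (snd w)))} + measure_pmf.prob W {w. fst w \<in> bad}"
    by (rule measure_Un_le) auto
  also have "measure_pmf.prob W {w. \<Phi> (choice_edges V (fst (snd w)))} = measure_pmf.prob (map_pmf (fst \<circ> snd) W) {q. \<Phi> (choice_edges V q)}"
    by (simp add: vimage_def)
  also have "measure_pmf.prob W {w. fst w \<in> bad} = measure_pmf.prob (map_pmf fst W) bad"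
    by (simp add: vimage_def)
  finally show ?thesis unfolding Wq Wfst bad_def .
qed

end

section \<open>Size of the pools\<close>

lemma prob_bind_le:
  assumes "\<And>x. x \<in> set_pmf M \<Longrightarrow> x \<notin> bad \<Longrightarrow> measure_pmf.prob (f x) S \<le> measure_pmf.prob (g x) T + c"
    and "0 \<le> c"
  shows "measure_pmf.prob (bind_pmf M f) S \<le> measure_pmf.prob (bind_pmf M g) T + c + measure_pmf.prob M bad"
proof -
  have "emeasure (bind_pmf M f) S = (\<integral>\<^sup>+x. emeasure (f x) S \<partial>M)" by simp
  also have "\<dots> \<le> (\<integral>\<^sup>+x. (emeasure (g x) T + c) + indicator bad x \<partial>M)"
  proof (rule nn_integral_mono_AE, rule AE_pmfI)
    fix x assume x: "x \<in> set_pmf M"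
    show "emeasure (f x) S \<le> (emeasure (g x) T + c) + indicator bad x"
    proof (cases "x \<in> bad")
      case True
      have "emeasure (f x) S \<le> 1" by (simp add: measure_pmf.emeasure_eq_measure)
      then show ?thesis using True by (simp add: add_increasing)
    next
      case False
      then show ?thesis using assms(1)[OF x] assms(2)
        by (simp add: measure_pmf.emeasure_eq_measure flip: ennreal_plus)
    qed
  qed
  also have "\<dots> = (emeasure (bind_pmf M g) T + c) + emeasure M bad"
    by (simp add: nn_integral_add)
  finally show ?thesis
    using assms(2) by (simp add: measure_pmf.emeasure_eq_measure flip: ennreal_plus)
qed

lemma prob_bind_bound:
  assumes "\<And>x. x \<in> set_pmf M \<Longrightarrow> x \<notin> bad \<Longrightarrow> measure_pmf.prob (f x) S \<le> c" "0 \<le> c"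
  shows "measure_pmf.prob (bind_pmf M f) S \<le> c + measure_pmf.prob M bad"
  using prob_bind_le[of M bad f S "\<lambda>_. return_pmf ()" "{}" c] assms by simp

lemma rsub_diff:
  assumes "finite A" "0 \<le> a" "a \<le> 1"
  shows "map_pmf (\<lambda>(X,Y). X - Y) (pair_pmf (rsub a A) (rsub a A)) = rsub (a * (1 - a)) A"
proof -
  have ab: "0 \<le> a * (1 - a)" "a * (1 - a) \<le> 1" using assms by (auto intro: mult_le_one)
  have ber: "map_pmf (\<lambda>(u,v). u \<and> \<not> v) (pair_pmf (bernoulli_pmf a) (bernoulli_pmf a)) = bernoulli_pmf (a * (1 - a))"
  proof (rule pmf_eqI)
    fix x
    have T: "pmf (map_pmf (\<lambda>(u,v). u \<and> \<not> v) (pair_pmf (bernoulli_pmf a) (bernoulli_pmf a))) True = a * (1 - a)"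
    proof -
      have "(\<lambda>(u,v). u \<and> \<not> v) -` {True} = {(True, False)}" by auto
      then show ?thesis using assms by (simp add: pmf_map measure_pmf_single pmf_pair)
    qed
    then show "pmf (map_pmf (\<lambda>(u,v). u \<and> \<not> v) (pair_pmf (bernoulli_pmf a) (bernoulli_pmf a))) x
        = pmf (bernoulli_pmf (a * (1 - a))) x"
      using ab by (cases x) (auto simp: pmf_False_conv_True)
  qed
  have "rsub (a * (1 - a)) A = map_pmf Collect (map_pmf (\<lambda>(f,g) x. f x \<and> \<not> g x)
     (pair_pmf (Pi_pmf A False (\<lambda>_. bernoulli_pmf a)) (Pi_pmf A False (\<lambda>_. bernoulli_pmf a))))"
    unfolding rsub_def ber[symmetric] by (subst Pi_pmf_zip[OF assms(1)]) auto
  also have "\<dots> = map_pmf (\<lambda>(X,Y). X - Y) (pair_pmf (rsub a A) (rsub a A))"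
    unfolding rsub_def by (simp add: map_pair[symmetric] pmf.map_comp o_def case_prod_unfold set_diff_eq)
  finally show ?thesis by simp
qed

lemma rsub_tail:
  assumes "finite A" "0 \<le> q" "q \<le> 1" "0 < \<gamma>" "\<gamma> < 1"
  shows "measure_pmf.prob (rsub q A) {S. real (card S) \<le> (1 - \<gamma>) * q * card A} \<le> exp (- (tail_rate \<gamma> * q * card A))"
proof -
  let ?P = "Pi_pmf A False (\<lambda>_. bernoulli_pmf q)"
  have "measure_pmf.prob (rsub q A) {S. real (card S) \<le> (1 - \<gamma>) * q * card A}
      = measure_pmf.prob ?P {f. real (card (Collect f)) \<le> (1 - \<gamma>) * q * card A}"
    by (simp add: rsub_def vimage_def)
  also have "\<dots> \<le> measure_pmf.prob ?P {f. real (card {i\<in>A. f i \<in> {True}}) \<le> (1 - \<gamma>) * q * card A}"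
  proof (rule measure_pmf.finite_measure_mono_AE)
    show "AE f in ?P. f \<in> {f. real (card (Collect f)) \<le> (1 - \<gamma>) * q * card A} \<longrightarrow>
        f \<in> {f. real (card {i\<in>A. f i \<in> {True}}) \<le> (1 - \<gamma>) * q * card A}"
    proof (rule AE_pmfI)
      fix f assume "f \<in> set_pmf ?P"
      then have "{i\<in>A. f i \<in> {True}} = Collect f" using Pi_pmf_dflt_outside[of f A False] assms(1) by auto
      then show "f \<in> {f. real (card (Collect f)) \<le> (1 - \<gamma>) * q * card A} \<longrightarrow>
        f \<in> {f. real (card {i\<in>A. f i \<in> {True}}) \<le> (1 - \<gamma>) * q * card A}" by simp
    qed
  qed simp
  also have "\<dots> \<le> exp (- (tail_rate \<gamma> * q * card A))"
    by (rule Pi_pmf_lower_tail) (use assms in \<open>auto simp: measure_pmf_single\<close>)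
  finally show ?thesis .
qed

lemma prob_ksub_notin:
  assumes "finite A" "k \<le> card A" "u \<in> A"
  shows "measure_pmf.prob (ksub k A) {S. u \<notin> S} = 1 - k / card A"
proof -
  have eq: "{S. S \<subseteq> A \<and> card S = k} \<inter> {S. u \<notin> S} = {S. S \<subseteq> A - {u} \<and> card S = k}" by auto
  have n: "card A > 0" using assms by (auto simp: card_gt_0_iff)
  have "measure_pmf.prob (ksub k A) {S. u \<notin> S} = card {S. S \<subseteq> A - {u} \<and> card S = k} / card {S. S \<subseteq> A \<and> card S = k}"
    unfolding ksub_def using ksub_ne[OF assms(1,2)] by (simp add: measure_pmf_of_set eq)
  also have "\<dots> = real ((card A - 1) choose k) / real (card A choose k)"
    using assms by (simp add: n_subsets)
  also have "\<dots> = 1 - k / card A"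
  proof -
    have "real (card A - k) * real (card A choose k) = real (card A) * real ((card A - 1) choose k)"
      using binomial_absorb_comp[of "card A" k] by (metis of_nat_mult)
    moreover have "real (card A choose k) > 0" using assms(2) by (simp add: zero_less_binomial)
    ultimately show ?thesis using n assms(2) by (simp add: field_simps of_nat_diff)
  qed
  finally show ?thesis .
qed

context kout_process
begin

text \<open>In the matrix of coins, row \<open>u\<close> and column \<open>u\<close> share only the
  diagonal entry, which is absent because \<open>u \<notin> N u\<close>. The coins that the two ends
  of an edge toss for it are independent.\<close>

lemma column_law:
  assumes V: "finite V" "u \<in> V" "N u \<subseteq> V"
  shows "map_pmf (\<lambda>Y. (Y u, {x \<in> V. u \<in> Y x})) (Pi_pmf V {} (\<lambda>u. rsub a (N u)))
    = pair_pmf (rsub a (N u)) (rsub a (N u))"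
proof -
  let ?R = "Pi_pmf (V - {u}) {} (\<lambda>x. rsub a (N x))"
  have V': "V = insert u (V - {u})" "finite (V - {u})" using V by auto
  have "map_pmf (\<lambda>Y. (Y u, {x \<in> V. u \<in> Y x})) (Pi_pmf V {} (\<lambda>u. rsub a (N u)))
     = map_pmf (\<lambda>(S, Y). (S, {x \<in> V. u \<in> (Y(u := S)) x})) (pair_pmf (rsub a (N u)) ?R)"
    by (subst V'(1), subst Pi_pmf_insert) (use V' in \<open>auto simp: pmf.map_comp o_def case_prod_unfold insert_absorb[OF V(2)]\<close>)
  also have "\<dots> = map_pmf (\<lambda>(S, Y). (S, {x \<in> V - {u}. u \<in> Y x})) (pair_pmf (rsub a (N u)) ?R)"
  proof (rule map_pmf_cong[OF refl])
    fix p assume p: "p \<in> set_pmf (pair_pmf (rsub a (N u)) ?R)"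
    obtain S Y where SY: "p = (S, Y)" by force
    have "u \<notin> S" using p set_rsub[OF finN, of S a u] irrN[of u] by (auto simp: SY)
    then show "(\<lambda>(S, Y). (S, {x \<in> V. u \<in> (Y(u := S)) x})) p = (\<lambda>(S, Y). (S, {x \<in> V - {u}. u \<in> Y x})) p"
      by (auto simp: SY)
  qed
  also have "\<dots> = pair_pmf (rsub a (N u)) (map_pmf (\<lambda>Y. {x \<in> V - {u}. u \<in> Y x}) ?R)"
    by (simp add: pair_map_pmf2 apsnd_def map_prod_def case_prod_unfold)
  also have "map_pmf (\<lambda>Y. {x \<in> V - {u}. u \<in> Y x}) ?R = map_pmf Collect (map_pmf (\<lambda>Y. (\<lambda>S. u \<in> S) \<circ> Y) ?R)"
    unfolding pmf.map_comp
  proof (rule map_pmf_cong[OF refl])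
    fix Y assume "Y \<in> set_pmf ?R"
    then show "{x \<in> V - {u}. u \<in> Y x} = (Collect \<circ> (\<lambda>Y. (\<lambda>S. u \<in> S) \<circ> Y)) Y"
      using Pi_pmf_dflt_outside[of Y "V - {u}" "{}"] V by fastforce
  qed
  also have "map_pmf (\<lambda>Y. (\<lambda>S. u \<in> S) \<circ> Y) ?R = Pi_pmf (V - {u}) False (\<lambda>x. map_pmf (\<lambda>S. u \<in> S) (rsub a (N x)))"
    using V' by (intro Pi_pmf_map[symmetric]) auto
  also have "\<dots> = Pi_pmf (V - {u}) False (\<lambda>x. if x \<in> N u then bernoulli_pmf a else return_pmf False)"
  proof (intro Pi_pmf_cong refl)
    fix x
    have "map_pmf (\<lambda>S. u \<in> S) (rsub a (N x)) = map_pmf (\<lambda>f. f u) (Pi_pmf (N x) False (\<lambda>_. bernoulli_pmf a))"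
      by (simp add: rsub_def pmf.map_comp o_def)
    then show "map_pmf (\<lambda>S. u \<in> S) (rsub a (N x)) = (if x \<in> N u then bernoulli_pmf a else return_pmf False)"
      using finN symN[of x u] by (simp add: Pi_pmf_component)
  qed
  also have "\<dots> = Pi_pmf (N u) False (\<lambda>_. bernoulli_pmf a)"
  proof -
    have "{x \<in> V - {u}. x \<in> N u} = N u" using V(3) irrN by auto
    then show ?thesis using V' by (simp add: Pi_pmf_if_set)
  qed
  finally show ?thesis by (simp add: rsub_def)
qed

lemma envlaw_eq:
  assumes "finite V"
  shows "envlaw V = map_pmf (\<lambda>((Y, Z), F). (\<lambda>u. Y u - Z u, F))
    (pair_pmf (pair_pmf (Pi_pmf V {} (\<lambda>u. rsub a (N u))) (Pi_pmf V {} (\<lambda>u. ksub k (N u)))) (Pi_pmf V {} (\<lambda>u. rsub a (N u))))"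
proof -
  have "Pi_pmf V {} (\<lambda>u. perm_law k a (N u)) = map_pmf (\<lambda>(Y, Z) u. Y u - Z u)
      (pair_pmf (Pi_pmf V {} (\<lambda>u. rsub a (N u))) (Pi_pmf V {} (\<lambda>u. ksub k (N u))))"
    unfolding perm_law_def by (rule Pi_pmf_zip[OF assms]) simp
  then show ?thesis unfolding envlaw_def by (simp add: pair_map_pmf1 case_prod_unfold apfst_def map_prod_def)
qed

text \<open>The pool of \<open>u\<close> contains \<open>(C - Y u) \<inter> D\<close>, where \<open>C\<close> and \<open>Y u\<close> are independent random subsets
  of \<open>N u\<close> and \<open>D\<close> consists of the neighbours \<open>x\<close> with \<open>u \<notin> Z x\<close>.\<close>
lemma small_pool_prob:
  fixes r :: "'v \<Rightarrow> nat" and M :: nat and \<gamma> \<pi> \<delta> :: real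
  assumes V: "finite V" "inj_on r V" "\<And>u. u \<in> V \<Longrightarrow> N u \<subseteq> V"
    and \<delta>: "\<And>u. u \<in> V \<Longrightarrow> \<delta> \<le> card (N u)" "k < \<delta>" and \<pi>: "\<pi> = 1 - k / \<delta>"
    and \<gamma>: "0 < \<gamma>" "\<gamma> < 1" and M: "M \<le> (1 - \<gamma>) * (a * (1 - a)) * ((1 - \<gamma>) * \<pi> * \<delta>)"
  shows "measure_pmf.prob (envlaw V) {(B, F). \<exists>u\<in>V. card (pool r V B F u) < M}
    \<le> card V * (exp (- (tail_rate \<gamma> * (a * (1 - a)) * ((1 - \<gamma>) * \<pi> * \<delta>))) + exp (- (tail_rate \<gamma> * \<pi> * \<delta>)))"
proof -
  let ?PY = "Pi_pmf V {} (\<lambda>u. rsub a (N u))" and ?PZ = "Pi_pmf V {} (\<lambda>u. ksub k (N u))"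
  define \<beta> where "\<beta> = a * (1 - a)"
  have \<beta>: "0 \<le> \<beta>" "\<beta> \<le> 1" using a01 by (auto simp: \<beta>_def intro: mult_le_one)
  have h0: "tail_rate \<gamma> > 0" using \<gamma> by (rule tail_rate_pos)
  have \<pi>01: "0 \<le> \<pi>" "\<pi> \<le> 1" using \<delta>(2) by (auto simp: \<pi> field_simps)
  have \<delta>0: "\<delta> > 0" using \<delta>(2) by linarith
  have kN: "k \<le> card (N u)" if "u \<in> V" for u
    using \<delta>(1)[OF that] \<delta>(2) by linarith
  define x0 where "x0 = (1 - \<gamma>) * \<pi> * \<delta>"
  have one: "measure_pmf.prob (envlaw V) {(B, F). card (pool r V B F u) < M}
      \<le> exp (- (tail_rate \<gamma> * \<beta> * x0)) + exp (- (tail_rate \<gamma> * \<pi> * \<delta>))" if u: "u \<in> V" for u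
  proof -
    have d: "\<delta> \<le> card (N u)" using \<delta>(1) u by simp
    define Dset where "Dset Z = {x \<in> N u. u \<notin> Z x}" for Z :: "'v \<Rightarrow> 'v set"
    \<comment> \<open>The sets \<open>Z x\<close> are independent, and each misses \<open>u\<close>
      with probability at least \<open>\<pi>\<close>. Outside this event, \<open>u\<close> loses few
      permissions to the subtraction of \<open>Z\<close>.\<close>
    define badZ where "badZ = {Z. real (card {x \<in> N u. Z x \<in> {S. u \<notin> S}}) \<le> (1 - \<gamma>) * \<pi> * card (N u)}"
    have PbadZ: "measure_pmf.prob ?PZ badZ \<le> exp (- (tail_rate \<gamma> * \<pi> * \<delta>))"
    proof -
      have "measure_pmf.prob ?PZ badZ \<le> exp (- (tail_rate \<gamma> * \<pi> * card (N u)))"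
        unfolding badZ_def
      proof (rule Pi_pmf_lower_tail[OF V(1) V(3)[OF u] \<pi>01(1) _ \<gamma>])
        fix x assume x: "x \<in> N u"
        then have xV: "x \<in> V" using V(3)[OF u] by auto
        have "u \<in> N x" using x symN by blast
        have "measure_pmf.prob (ksub k (N x)) {S. u \<notin> S} = 1 - k / card (N x)"
          by (rule prob_ksub_notin[OF finN kN[OF xV] \<open>u \<in> N x\<close>])
        moreover have "k / card (N x) \<le> k / \<delta>" using \<delta>(1)[OF xV] \<delta>0 by (intro divide_left_mono) auto
        ultimately show "\<pi> \<le> measure_pmf.prob (ksub k (N x)) {S. u \<notin> S}" by (simp add: \<pi>)
      qed
      also have "\<dots> \<le> exp (- (tail_rate \<gamma> * \<pi> * \<delta>))"
        using d h0 \<pi>01 by (simp add: mult_left_mono)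
      finally show ?thesis .
    qed
    \<comment> \<open>On \<open>Dset Z\<close> the permission \<open>u \<in> Y x - Z x\<close>
      reduces to \<open>u \<in> Y x\<close>, and removing \<open>Y u\<close> instead of
      \<open>Y u - Z u\<close> only shrinks the pool. Afterwards \<open>Z\<close> matters through
      \<open>Dset Z\<close> alone, so one can condition on it.\<close>
    have pool_sup: "((({x\<in>F u. r u < r x} \<union> {x \<in> {x\<in>V. u \<in> Y x}. r x < r u}) - Y u) \<inter> Dset Z) \<subseteq> pool r V (\<lambda>u. Y u - Z u) F u" for Y Z F
      by (auto simp: pool_def Dset_def)
    have finpool: "finite (pool r V B F u)" if "finite (F u)" for B F
      using that V(1) by (auto simp: pool_def)
    let ?RZ = "\<lambda>Z. bind_pmf ?PY (\<lambda>Y. map_pmf (\<lambda>F. ((Y, Z), F)) ?PY)"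
    have "measure_pmf.prob (envlaw V) {(B, F). card (pool r V B F u) < M}
        = measure_pmf.prob (bind_pmf ?PZ ?RZ) {((Y, Z), F). card (pool r V (\<lambda>u. Y u - Z u) F u) < M}"
    proof -
      have "pair_pmf (pair_pmf ?PY ?PZ) ?PY = bind_pmf ?PY (\<lambda>Y. bind_pmf ?PZ (\<lambda>Z. map_pmf (\<lambda>F. ((Y, Z), F)) ?PY))"
        by (simp add: pair_pmf_def bind_assoc_pmf bind_return_pmf map_pmf_def)
      also have "\<dots> = bind_pmf ?PZ ?RZ" by (rule bind_commute_pmf)
      finally show ?thesis unfolding envlaw_eq[OF V(1)] by (simp add: vimage_def case_prod_unfold)
    qed
    also have "\<dots> \<le> exp (- (tail_rate \<gamma> * \<beta> * x0)) + measure_pmf.prob ?PZ badZ"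
    proof (rule prob_bind_bound)
      fix Z assume Z: "Z \<notin> badZ"
      then have D: "(1 - \<gamma>) * \<pi> * card (N u) < card (Dset Z)" by (simp add: badZ_def Dset_def)
      have "x0 \<le> (1 - \<gamma>) * \<pi> * card (N u)" unfolding x0_def using d \<gamma> \<pi>01 by (intro mult_left_mono) auto
      then have x0: "x0 \<le> card (Dset Z)" using D by linarith
      have finD: "finite (Dset Z)" using finN by (auto simp: Dset_def)
      define \<Psi> where "\<Psi> = (\<lambda>(F, (S, X)). ((({x\<in>F. r u < r x} \<union> {x \<in> X. r x < r u}) - S) \<inter> Dset Z :: 'v set))"
      have law: "bind_pmf ?PY (\<lambda>Y. map_pmf (\<lambda>F. \<Psi> (F u, (Y u, {x \<in> V. u \<in> Y x}))) ?PY) = rsub \<beta> (Dset Z)"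
      proof -
        have comp: "map_pmf (\<lambda>F. F u) ?PY = rsub a (N u)" using V(1) u by (simp add: Pi_pmf_component)
        have "bind_pmf ?PY (\<lambda>Y. map_pmf (\<lambda>F. \<Psi> (F u, (Y u, {x \<in> V. u \<in> Y x}))) ?PY)
          = bind_pmf (map_pmf (\<lambda>Y. (Y u, {x \<in> V. u \<in> Y x})) ?PY) (\<lambda>p. map_pmf (\<lambda>F. \<Psi> (F, p)) (map_pmf (\<lambda>F. F u) ?PY))"
          by (simp add: bind_map_pmf pmf.map_comp o_def)
        also have "\<dots> = bind_pmf (pair_pmf (rsub a (N u)) (rsub a (N u))) (\<lambda>p. map_pmf (\<lambda>F. \<Psi> (F, p)) (rsub a (N u)))"
          unfolding comp column_law[OF V(1) u V(3)[OF u]] ..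
        also have "\<dots> = bind_pmf (rsub a (N u)) (\<lambda>S. bind_pmf (rsub a (N u)) (\<lambda>X. bind_pmf (rsub a (N u)) (\<lambda>F.
            return_pmf (((({x\<in>F. r u < r x} \<union> {x \<in> X. r x < r u}) - S) \<inter> Dset Z)))))"
          by (simp add: pair_pmf_def bind_assoc_pmf bind_return_pmf map_pmf_def \<Psi>_def)
        \<comment> \<open>Own coins on later neighbours and the column on earlier ones live on
          complementary parts of \<open>N u\<close>, as ranks are distinct; they merge into one
          binomial set \<open>C\<close>.\<close>
        also have "\<dots> = bind_pmf (rsub a (N u)) (\<lambda>S. bind_pmf (rsub a (N u)) (\<lambda>C. return_pmf ((C - S) \<inter> Dset Z)))"
        proof -
          have "N u = (N u \<inter> {x. r x < r u}) \<union> (N u \<inter> {x. r u < r x})"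
          proof -
            have "r x \<noteq> r u" if "x \<in> N u" for x
              using that V(2,3) u irrN by (metis inj_onD subsetD)
            then show ?thesis by (auto simp: neq_iff)
          qed
          then have "rsub a (N u) = rsub a ((N u \<inter> {x. r x < r u}) \<union> (N u \<inter> {x. r u < r x}))" by simp
          also have "\<dots> = map_pmf (\<lambda>(X, Y). X \<union> Y) (pair_pmf (rsub a (N u \<inter> {x. r x < r u})) (rsub a (N u \<inter> {x. r u < r x})))"
            using finN by (intro rsub_Un) auto
          also have "\<dots> = bind_pmf (rsub a (N u)) (\<lambda>X. bind_pmf (rsub a (N u)) (\<lambda>F. return_pmf ({x\<in>F. r u < r x} \<union> {x \<in> X. r x < r u})))"
            unfolding rsub_Int[OF finN, symmetric]
            by (simp add: pair_pmf_def bind_map_pmf map_bind_pmf bind_assoc_pmf bind_return_pmf Int_def Un_commute)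
          finally have fu: "rsub a (N u) = bind_pmf (rsub a (N u)) (\<lambda>X. bind_pmf (rsub a (N u))
              (\<lambda>F. return_pmf ({x\<in>F. r u < r x} \<union> {x \<in> X. r x < r u})))" .
          have "bind_pmf (rsub a (N u)) (\<lambda>C. return_pmf ((C - S) \<inter> Dset Z)) =
              bind_pmf (rsub a (N u)) (\<lambda>X. bind_pmf (rsub a (N u)) (\<lambda>F. return_pmf ((({x\<in>F. r u < r x} \<union> {x \<in> X. r x < r u}) - S) \<inter> Dset Z)))" for S
            by (subst fu) (simp add: bind_assoc_pmf bind_return_pmf)
          then show ?thesis by simp
        qed
        also have "\<dots> = map_pmf (\<lambda>W. W \<inter> Dset Z) (map_pmf (\<lambda>(X,Y). X - Y) (pair_pmf (rsub a (N u)) (rsub a (N u))))"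
          unfolding pair_pmf_def map_bind_pmf map_return_pmf prod.case
          by (rule bind_commute_pmf)
        also have "\<dots> = rsub \<beta> (N u \<inter> Dset Z)"
          unfolding rsub_diff[OF finN a01] \<beta>_def by (rule rsub_Int[OF finN])
        also have "N u \<inter> Dset Z = Dset Z" by (auto simp: Dset_def)
        finally show ?thesis .
      qed
      have "measure_pmf.prob (?RZ Z) {((Y, Z), F). card (pool r V (\<lambda>u. Y u - Z u) F u) < M}
          \<le> measure_pmf.prob (?RZ Z) {((Y, Z'), F). card (\<Psi> (F u, (Y u, {x \<in> V. u \<in> Y x}))) < M}"
      proof (rule measure_pmf.finite_measure_mono_AE)
        show "AE w in ?RZ Z. w \<in> {((Y, Z), F). card (pool r V (\<lambda>u. Y u - Z u) F u) < M} \<longrightarrow>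
            w \<in> {((Y, Z'), F). card (\<Psi> (F u, (Y u, {x \<in> V. u \<in> Y x}))) < M}"
        proof (rule AE_pmfI, clarify)
          fix Y Z' F assume w: "((Y, Z'), F) \<in> set_pmf (?RZ Z)" and c: "card (pool r V (\<lambda>u. Y u - Z' u) F u) < M"
          have "Z' = Z" "F \<in> set_pmf ?PY" using w by auto
          then have "F u \<in> set_pmf (rsub a (N u))" using V(1) u by (auto simp: set_Pi_pmf PiE_dflt_def)
          then have "finite (F u)" using set_rsub[OF finN] finN finite_subset by metis
          then have "card (\<Psi> (F u, (Y u, {x \<in> V. u \<in> Y x}))) \<le> card (pool r V (\<lambda>u. Y u - Z' u) F u)"
            using pool_sup[of F Y Z] finpool unfolding \<Psi>_def \<open>Z' = Z\<close> by (intro card_mono) auto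
          then show "card (\<Psi> (F u, (Y u, {x \<in> V. u \<in> Y x}))) < M" using c by simp
        qed
      qed simp
      also have "\<dots> = measure_pmf.prob (rsub \<beta> (Dset Z)) {W. card W < M}"
        unfolding law[symmetric] by (simp add: measure_pmf.emeasure_eq_measure[symmetric] vimage_def Sigma_Algebra.measure_def)
      also have "\<dots> \<le> measure_pmf.prob (rsub \<beta> (Dset Z)) {W. real (card W) \<le> (1 - \<gamma>) * \<beta> * card (Dset Z)}"
      proof (rule measure_pmf.finite_measure_mono)
        have "real M \<le> (1 - \<gamma>) * \<beta> * x0" using M by (simp add: \<beta>_def x0_def)
        also have "\<dots> \<le> (1 - \<gamma>) * \<beta> * card (Dset Z)" using x0 \<gamma> \<beta> by (intro mult_left_mono) auto
        finally show "{W :: 'v set. card W < M} \<subseteq> {W. real (card W) \<le> (1 - \<gamma>) * \<beta> * card (Dset Z)}"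
          by (auto simp flip: of_nat_less_iff)
      qed simp
      also have "\<dots> \<le> exp (- (tail_rate \<gamma> * \<beta> * card (Dset Z)))"
        using finD \<beta> \<gamma> by (intro rsub_tail) auto
      also have "\<dots> \<le> exp (- (tail_rate \<gamma> * \<beta> * x0))"
        using x0 h0 \<beta> by (simp add: mult_left_mono)
      finally show "measure_pmf.prob (?RZ Z) {((Y, Z), F). card (pool r V (\<lambda>u. Y u - Z u) F u) < M} \<le> exp (- (tail_rate \<gamma> * \<beta> * x0))" .
    qed simp
    finally show ?thesis using PbadZ by linarith
  qed
  have "measure_pmf.prob (envlaw V) {(B, F). \<exists>u\<in>V. card (pool r V B F u) < M}
      = measure_pmf.prob (envlaw V) (\<Union>u\<in>V. {(B, F). card (pool r V B F u) < M})"
    by (rule arg_cong[of _ _ "measure_pmf.prob _"]) auto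
  also have "\<dots> \<le> (\<Sum>u\<in>V. measure_pmf.prob (envlaw V) {(B, F). card (pool r V B F u) < M})"
    using V(1) by (intro measure_pmf.finite_measure_subadditive_finite) auto
  also have "\<dots> \<le> (\<Sum>u\<in>V. exp (- (tail_rate \<gamma> * \<beta> * x0)) + exp (- (tail_rate \<gamma> * \<pi> * \<delta>)))"
    by (intro sum_mono one)
  finally show ?thesis by (simp add: \<beta>_def x0_def)
qed

end

text \<open>Relabelling the entries by a permutation of \<open>A\<close> preserves the uniform
  ordering, so \<open>eq_ksubI\<close> applies. The guard \<open>j < length xs\<close> gives the
  same expression a meaning for pools that are too short; under the hypothesis on \<open>J\<close>
  it always holds.\<close>

lemma set_take_permutation_uniform:
  assumes "finite A" "J \<subseteq> {..<card A}"
  shows "map_pmf (\<lambda>xs. {xs ! j |j. j \<in> J \<and> j < length xs}) (pmf_of_set (permutations_of_set A)) = ksub (card J) A"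
proof (rule eq_ksubI[OF assms(1)])
  let ?P = "pmf_of_set (permutations_of_set A)"
  have setP: "set_pmf ?P = permutations_of_set A" using assms(1) by (intro set_pmf_of_set) auto
  show "S \<subseteq> A \<and> card S = card J" if S: "S \<in> set_pmf (map_pmf (\<lambda>xs. {xs ! j |j. j \<in> J \<and> j < length xs}) ?P)" for S
  proof -
    obtain xs where xs: "xs \<in> permutations_of_set A" "S = {xs ! j |j. j \<in> J \<and> j < length xs}"
      using S setP by auto
    have d: "distinct xs" "set xs = A" "length xs = card A"
      using xs(1) permutations_of_setD[OF xs(1)] distinct_card[of xs] by auto
    then have "S = (\<lambda>j. xs ! j) ` J" using xs(2) assms(2) by auto
    moreover have "inj_on (\<lambda>j. xs ! j) J" using d assms(2) by (intro inj_on_nth) auto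
    ultimately show ?thesis using d assms(2) by (auto simp: card_image)
  qed
  fix \<sigma> assume \<sigma>: "\<sigma> permutes A"
  have "map_pmf (image \<sigma>) (map_pmf (\<lambda>xs. {xs ! j |j. j \<in> J \<and> j < length xs}) ?P)
      = map_pmf (\<lambda>xs. {xs ! j |j. j \<in> J \<and> j < length xs}) (map_pmf (map \<sigma>) ?P)"
  proof -
    have "\<sigma> ` {xs ! j |j. j \<in> J \<and> j < length xs} = {map \<sigma> xs ! j |j. j \<in> J \<and> j < length (map \<sigma> xs)}" for xs
    proof -
      have im: "{ys ! j |j. j \<in> J \<and> j < length ys} = (\<lambda>j. ys ! j) ` {j \<in> J. j < length ys}" for ys :: "'a list" by auto
      show ?thesis unfolding im[of xs] im[of "map \<sigma> xs"] image_image by (rule image_cong) auto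
    qed
    then show ?thesis by (simp add: pmf.map_comp o_def)
  qed
  also have "map_pmf (map \<sigma>) ?P = ?P"
  proof -
    have "inj_on (map \<sigma>) (permutations_of_set A)" using permutes_inj[OF \<sigma>] by (simp add: inj_on_def)
    moreover have "map \<sigma> ` permutations_of_set A = permutations_of_set A"
      using permutations_of_set_image_permutes[OF \<sigma>] .
    ultimately show ?thesis using assms(1) by (subst map_pmf_of_set_inj) auto
  qed
  finally show "map_pmf (image \<sigma>) (map_pmf (\<lambda>xs. {xs ! j |j. j \<in> J \<and> j < length xs}) ?P)
      = map_pmf (\<lambda>xs. {xs ! j |j. j \<in> J \<and> j < length xs}) ?P" .
qed

section \<open>The binomial random graph built from the coins, and indices for its edges\<close>

lemma random_colored_subgraph_rsub:
  assumes "finite (edges G)"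
  shows "random_colored_subgraph c G p =
    bind_pmf (rsub p (edges G)) (\<lambda>K. Pi_pmf K None (\<lambda>_. map_pmf Some (pmf_of_set {1..c})))"
  unfolding random_colored_subgraph_def rsub_def bind_map_pmf
proof (rule bind_pmf_cong[OF refl])
  fix f assume "f \<in> set_pmf (Pi_pmf (edges G) False (\<lambda>_. bernoulli_pmf p))"
  then have "{e \<in> edges G. f e} = Collect f" using Pi_pmf_dflt_outside[of f "edges G" False] assms by auto
  then show "Pi_pmf {e \<in> edges G. f e} None (\<lambda>_. map_pmf Some (pmf_of_set {1..c}))
    = Pi_pmf (Collect f) None (\<lambda>_. map_pmf Some (pmf_of_set {1..c}))" by simp
qed

lemma simple_graph_neighbors:
  assumes "simple_graph G"
  shows "finite (neighbors G u)" "x \<in> neighbors G u \<longleftrightarrow> u \<in> neighbors G x" "u \<notin> neighbors G u"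
    "neighbors G u \<subseteq> verts G" "finite (verts G)" "finite (edges G)"
proof -
  show fin: "finite (verts G)" using assms by (simp add: simple_graph_def)
  show sub: "neighbors G u \<subseteq> verts G" using assms by (auto simp: simple_graph_def neighbors_def)
  show "finite (neighbors G u)" using fin sub finite_subset by blast
  show "x \<in> neighbors G u \<longleftrightarrow> u \<in> neighbors G x" by (simp add: neighbors_def insert_commute)
  show "u \<notin> neighbors G u" using assms by (auto simp: simple_graph_def neighbors_def)
  have "edges G \<subseteq> Pow (verts G)" using assms by (auto simp: simple_graph_def)
  then show "finite (edges G)" using fin by (simp add: finite_subset)
qed

lemma edges_ordered:
  assumes G: "simple_graph G" and r: "inj_on (r :: 'v \<Rightarrow> nat) (verts G)"
  shows "edges G = {{u, x} |u x. u \<in> verts G \<and> x \<in> neighbors G u \<and> r u < r x}"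
proof (intro equalityI subsetI)
  fix e assume e: "e \<in> edges G"
  then have "card e = 2" "e \<subseteq> verts G" using G by (auto simp: simple_graph_def)
  then obtain a b where ab: "e = {a, b}" "a \<noteq> b" by (auto simp: card_2_iff)
  then have "a \<in> verts G" "b \<in> verts G" using \<open>e \<subseteq> verts G\<close> by auto
  then have "r a \<noteq> r b" using r ab(2) by (auto dest: inj_onD)
  then consider "r a < r b" | "r b < r a" by linarith
  then show "e \<in> {{u, x} |u x. u \<in> verts G \<and> x \<in> neighbors G u \<and> r u < r x}"
  proof cases
    case 1
    then show ?thesis using e ab \<open>a \<in> verts G\<close> by (auto simp: neighbors_def)
  next
    case 2
    moreover have "{b, a} \<in> edges G" "e = {b, a}" using e ab by (simp_all add: insert_commute)
    ultimately have "e = {b, a} \<and> b \<in> verts G \<and> a \<in> neighbors G b \<and> r b < r a"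
      using \<open>b \<in> verts G\<close> by (simp add: neighbors_def)
    then show ?thesis by blast
  qed
qed (auto simp: neighbors_def)

context kout_process
begin

text \<open>Every edge is listed at its end of smaller rank, so a single membership decides about
  it.\<close>

definition kept :: "('v \<Rightarrow> nat) \<Rightarrow> 'v set \<Rightarrow> ('v \<Rightarrow> 'v set) \<Rightarrow> 'v set set" where
  "kept r V U = {{u, x} |u x. u \<in> V \<and> x \<in> U u \<and> r u < r x}"

lemma kept_law:
  assumes "finite V"
  shows "map_pmf (kept r V) (Pi_pmf V {} (\<lambda>u. rsub p (N u))) = rsub p (kept r V N)"
  using assms
proof (induction V)
  case empty
  then show ?case by (simp add: kept_def)
next
  case (insert u V)
  let ?f = "\<lambda>x. {u, x}" and ?L = "{x. r u < r x}"
  have kept_insert: "kept r (insert u V) U = ?f ` (U u \<inter> ?L) \<union> kept r V U" for U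
    by (auto simp: kept_def)
  have "kept r V N \<subseteq> (\<lambda>(v, x). {v, x}) ` Sigma V N" by (auto simp: kept_def)
  then have finK: "finite (kept r V N)"
    by (rule finite_subset) (intro finite_imageI finite_SigmaI insert(1) finN)
  have disj: "?f ` (N u \<inter> ?L) \<inter> kept r V N = {}"
  proof (intro equals0I)
    fix e assume "e \<in> ?f ` (N u \<inter> ?L) \<inter> kept r V N"
    then obtain x v y where "e = {u, x}" "r u < r x" "e = {v, y}" "v \<in> V" "r v < r y"
      by (auto simp: kept_def)
    then have "{u, x} = {v, y}" by simp
    then consider "u = v" | "u = y" "x = v" by (auto simp: doubleton_eq_iff)
    then show False using \<open>v \<in> V\<close> \<open>r u < r x\<close> \<open>r v < r y\<close> insert(2) by cases auto
  qed
  have "map_pmf (kept r (insert u V)) (Pi_pmf (insert u V) {} (\<lambda>u. rsub p (N u)))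
      = map_pmf (\<lambda>(S, U). ?f ` (S \<inter> ?L) \<union> kept r V U) (pair_pmf (rsub p (N u)) (Pi_pmf V {} (\<lambda>u. rsub p (N u))))"
  proof -
    have "kept r V (U(u := S)) = kept r V U" for U S using insert(2) by (auto simp: kept_def)
    then show ?thesis using insert by (simp add: Pi_pmf_insert pmf.map_comp o_def case_prod_unfold kept_insert)
  qed
  also have "\<dots> = map_pmf (\<lambda>(X, Y). X \<union> Y) (pair_pmf (map_pmf (image ?f) (map_pmf (\<lambda>S. S \<inter> ?L) (rsub p (N u))))
      (map_pmf (kept r V) (Pi_pmf V {} (\<lambda>u. rsub p (N u)))))"
    by (simp add: pair_map_pmf1 pair_map_pmf2 pmf.map_comp o_def case_prod_unfold)
  also have "map_pmf (image ?f) (map_pmf (\<lambda>S. S \<inter> ?L) (rsub p (N u))) = rsub p (?f ` (N u \<inter> ?L))"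
    using finN by (simp add: rsub_Int rsub_image inj_on_def doubleton_eq_iff)
  also have "map_pmf (\<lambda>(X, Y). X \<union> Y) (pair_pmf (rsub p (?f ` (N u \<inter> ?L))) (map_pmf (kept r V) (Pi_pmf V {} (\<lambda>u. rsub p (N u)))))
      = rsub p (?f ` (N u \<inter> ?L) \<union> kept r V N)"
    unfolding insert.IH using finN finK disj by (intro rsub_Un[symmetric]) auto
  finally show ?case by (simp add: kept_insert)
qed

text \<open>The lower end of an edge holds two coins for it, one for its own use and one for the
  permission, and either suffices; this is the origin of
  \<open>2 * a - a\<^sup>2 = 1 - (1 - a)\<^sup>2\<close>. The permission coin is taken from
  \<open>Y\<close>, before the \<open>k\<close>-set is subtracted, since the difference is not
  binomial.\<close>

lemma kept_union_law:
  assumes "finite V"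
  shows "map_pmf (\<lambda>(Y, F). kept r V (\<lambda>u. F u \<union> Y u)) (pair_pmf (Pi_pmf V {} (\<lambda>u. rsub a (N u))) (Pi_pmf V {} (\<lambda>u. rsub a (N u))))
    = rsub (2 * a - a\<^sup>2) (kept r V N)"
proof -
  have 1: "map_pmf (\<lambda>(Y, F). F \<union> Y) (pair_pmf (rsub a (N u)) (rsub a (N u))) = rsub (2 * a - a\<^sup>2) (N u)" for u
    using rsub_union_indep[OF finN[of u] a01 a01] by (simp add: Un_commute power2_eq_square)
  have "map_pmf (\<lambda>(Y, F). kept r V (\<lambda>u. F u \<union> Y u)) (pair_pmf (Pi_pmf V {} (\<lambda>u. rsub a (N u))) (Pi_pmf V {} (\<lambda>u. rsub a (N u))))
     = map_pmf (kept r V) (Pi_pmf V {} (\<lambda>u. rsub (2 * a - a\<^sup>2) (N u)))"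
    unfolding 1[symmetric] by (subst Pi_pmf_zip[OF assms, of _ "{}" "{}"]) (auto simp: pmf.map_comp o_def case_prod_unfold)
  also have "\<dots> = rsub (2 * a - a\<^sup>2) (kept r V N)" by (rule kept_law[OF assms])
  finally show ?thesis .
qed

text \<open>The position \<open>(u, i)\<close> of an edge in the pools, if it has one, carries its colour.\<close>
definition index_of :: "'v set \<Rightarrow> nat \<Rightarrow> ('v \<Rightarrow> 'v list) \<Rightarrow> 'v set \<Rightarrow> ('v \<times> nat) + 'v set" where
  "index_of V M xs e = (if \<exists>u i. u \<in> V \<and> i < M \<and> i < length (xs u) \<and> e = {u, xs u ! i}
     then Inl (SOME (u, i). u \<in> V \<and> i < M \<and> i < length (xs u) \<and> e = {u, xs u ! i}) else Inr e)"

lemma index_of_cases: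
  "(\<exists>u i. index_of V M xs e = Inl (u, i) \<and> u \<in> V \<and> i < M \<and> i < length (xs u) \<and> e = {u, xs u ! i}) \<or>
   index_of V M xs e = Inr e"
proof (cases "\<exists>u i. u \<in> V \<and> i < M \<and> i < length (xs u) \<and> e = {u, xs u ! i}")
  case True
  let ?p = "SOME (u, i). u \<in> V \<and> i < M \<and> i < length (xs u) \<and> e = {u, xs u ! i}"
  have "case ?p of (u, i) \<Rightarrow> u \<in> V \<and> i < M \<and> i < length (xs u) \<and> e = {u, xs u ! i}"
    by (rule someI_ex) (use True in auto)
  moreover have "index_of V M xs e = Inl ?p" using True by (simp add: index_of_def)
  ultimately show ?thesis by (cases ?p) auto
next
  case False
  show ?thesis unfolding index_of_def if_not_P[OF False] by simp
qed

text \<open>The edge can be read off from its index in both cases, for arbitrary lists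
  \<open>xs\<close>; an edge that occupies several positions still gets one index.\<close>

lemma inj_index_of: "inj (index_of V M xs)"
proof (rule injI)
  fix e e' assume "index_of V M xs e = index_of V M xs e'"
  with index_of_cases[of V M xs e] index_of_cases[of V M xs e'] show "e = e'"
    by (elim disjE exE conjE) simp_all
qed

lemma index_of_position:
  assumes "u \<in> V" "i < M" "i < length (xs u)"
    and "\<And>u' i'. u' \<in> V \<Longrightarrow> i' < length (xs u') \<Longrightarrow> {u', xs u' ! i'} = {u, xs u ! i} \<Longrightarrow> u' = u \<and> i' = i"
  shows "index_of V M xs {u, xs u ! i} = Inl (u, i)"
proof -
  have "index_of V M xs {u, xs u ! i} \<noteq> Inr {u, xs u ! i}" using assms(1-3) by (auto simp: index_of_def)
  with index_of_cases[of V M xs "{u, xs u ! i}"] show ?thesis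
  proof (elim disjE exE conjE)
    fix u' i' assume *: "index_of V M xs {u, xs u ! i} = Inl (u', i')" "u' \<in> V" "i' < length (xs u')"
      "{u, xs u ! i} = {u', xs u' ! i'}"
    show ?thesis using assms(4)[OF *(2,3) *(4)[symmetric]] *(1) by simp
  qed simp
qed

text \<open>If \<open>r u < r x\<close>, the pool of \<open>u\<close> admits \<open>x\<close> only
  for \<open>x \<notin> B u\<close>, and the pool of \<open>x\<close> admits \<open>u\<close> only
  for \<open>x \<in> B u\<close>: the permission decides which end owns the edge.\<close>

lemma pool_edge_unique:
  assumes "u \<in> V" "u' \<in> V" "x \<in> pool r V B F u" "x' \<in> pool r V B F u'" "{u', x'} = {u, x}"
  shows "u' = u \<and> x' = x"
proof (rule ccontr)
  assume "\<not> (u' = u \<and> x' = x)"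
  then have "u' = x" "x' = u" using assms(5) by (auto simp: doubleton_eq_iff)
  then show False using assms by (auto simp: pool_def)
qed

end

section \<open>A sparse random graph\<close>

lemma Pi_pmf_reindex_subset:
  assumes "finite I" "finite A" "inj_on h A" "h ` A \<subseteq> I"
  shows "map_pmf (\<lambda>f x. if x \<in> A then f (h x) else d) (Pi_pmf I d' p) = Pi_pmf A d (\<lambda>x. p (h x))"
proof -
  have "Pi_pmf A d (\<lambda>x. p (h x)) = map_pmf (\<lambda>f x. if x \<in> A then f (h x) else d)
      (map_pmf (\<lambda>f y. if y \<in> h ` A then f y else d') (Pi_pmf I d' p))"
    unfolding Pi_pmf_subset[OF assms(1,4), symmetric] by (rule Pi_pmf_reindex[OF assms(2,3), symmetric])
  also have "\<dots> = map_pmf (\<lambda>f x. if x \<in> A then f (h x) else d) (Pi_pmf I d' p)"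
    unfolding pmf.map_comp by (intro map_pmf_cong refl) (auto simp: fun_eq_iff)
  finally show ?thesis ..
qed

lemma Pi_pmf_map_dep:
  assumes "finite A"
  shows "Pi_pmf A e (\<lambda>x. map_pmf (f x) (p x)) = map_pmf (\<lambda>h x. if x \<in> A then f x (h x) else e) (Pi_pmf A d p)"
proof -
  have "Pi_pmf A e (\<lambda>x. map_pmf (f x) (p x)) = bind_pmf (Pi_pmf A d p) (\<lambda>h. Pi_pmf A e (\<lambda>x. return_pmf (f x (h x))))"
    unfolding map_pmf_def by (rule Pi_pmf_bind[OF assms])
  then show ?thesis using assms by (simp add: map_pmf_def)
qed

text \<open>This allows the colours to be drawn on an index set before the graph is known: any fixed
  injective indexing of the kept edges transfers them to independent colours of the edges.\<close>

lemma random_coloring: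
  fixes \<iota> :: "'e \<Rightarrow> 'i"
  assumes "finite I" "finite K" "inj_on \<iota> K" "\<iota> ` K \<subseteq> I"
  shows "map_pmf (\<lambda>col e. if e \<in> K then Some (col (\<iota> e)) else None) (Pi_pmf I d (\<lambda>_. q)) = Pi_pmf K None (\<lambda>_. map_pmf Some q)"
proof -
  have "Pi_pmf K None (\<lambda>_. map_pmf Some q) = map_pmf (\<lambda>h e. if e \<in> K then Some (h e) else None)
      (map_pmf (\<lambda>col e. if e \<in> K then col (\<iota> e) else d) (Pi_pmf I d (\<lambda>_. q)))"
    unfolding Pi_pmf_reindex_subset[OF assms] by (rule Pi_pmf_map_dep[OF assms(2)])
  also have "\<dots> = map_pmf (\<lambda>col e. if e \<in> K then Some (col (\<iota> e)) else None) (Pi_pmf I d (\<lambda>_. q))"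
    unfolding pmf.map_comp by (intro map_pmf_cong refl) (auto simp: fun_eq_iff)
  finally show ?thesis ..
qed

text \<open>Since the colours come first, a round is a fixed set of \<open>k\<close> positions per
  vertex when the pools are ordered, so it picks a uniform \<open>k\<close>-subset of each pool. The
  small-pool error is counted twice: once for the domination of the \<open>k\<close>-out graph by
  choices from the pools, once because positions describe such choices only if each pool fills all
  \<open>k * m\<close> of them.\<close>

lemma single_class:
  fixes G :: "'v ugraph" and P :: "'v ugraph \<Rightarrow> bool" and a p \<gamma> \<delta> \<pi> :: real and k m t n :: nat
  assumes G: "simple_graph G" "card (verts G) = n" and n: "n > 0" and k: "k > 0" and P: "monotone_increasing P"
    and a01: "0 \<le> a" "a \<le> 1" and p: "p = 2 * a - a\<^sup>2"
    and \<delta>: "\<And>u. u \<in> verts G \<Longrightarrow> \<delta> \<le> card (neighbors G u)" "k < \<delta>" and \<pi>: "\<pi> = 1 - k / \<delta>"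
    and \<gamma>: "0 < \<gamma>" "\<gamma> < 1" and M: "real (k * m) \<le> (1 - \<gamma>) * (a * (1 - a)) * ((1 - \<gamma>) * \<pi> * \<delta>)"
    and t: "real t \<le> (1 - \<gamma>) * m" and m: "8 * ln (real (k * n) + 1) \<le> tail_rate \<gamma> * m"
  shows "\<exists>W :: ('v colored_graph \<times> (nat \<Rightarrow> 'v set set)) pmf.
    map_pmf fst W = random_colored_subgraph (k * n) G p \<and>
    (\<forall>(H, Hs)\<in>set_pmf W. (\<forall>i<t. Hs i \<subseteq> dom H) \<and> (\<forall>i<t. \<forall>j<t. i \<noteq> j \<longrightarrow> Hs i \<inter> Hs j = {})) \<and>
    measure_pmf.prob W {(H, Hs). \<not> (\<forall>i<t. rainbow H (Hs i))} \<le> 18 / real (k * n) \<and>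
    (\<forall>i<t. measure_pmf.prob (k_out k G) {K. P K} \<le> measure_pmf.prob W {(H, Hs). P (verts G, Hs i)} +
       2 * (n * (exp (- (tail_rate \<gamma> * (a * (1 - a)) * ((1 - \<gamma>) * \<pi> * \<delta>))) + exp (- (tail_rate \<gamma> * \<pi> * \<delta>)))))"
proof -
  define V where "V = verts G"
  define N where "N = neighbors G"
  note sg = simple_graph_neighbors[OF G(1)]
  interpret kout_process N k a
    by unfold_locales (use sg a01 in \<open>auto simp: N_def\<close>)
  have finV: "finite V" and finE: "finite (edges G)" and NV: "N u \<subseteq> V" for u
    using sg by (auto simp: V_def N_def)
  have cV: "card V = n" using G by (simp add: V_def)
  obtain r :: "'v \<Rightarrow> nat" where r: "inj_on r V" using finite_imp_inj_to_nat_seg[OF finV] by blast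
  have kN: "k \<le> card (N u)" if "u \<in> V" for u
    using \<delta>(1)[of u] \<delta>(2) that by (simp add: V_def N_def)
  have edgesG: "edges G = kept r V N"
    using edges_ordered[OF G(1), of r] r by (simp add: V_def N_def kept_def)
  have h0: "tail_rate \<gamma> > 0" using \<gamma> by (rule tail_rate_pos)
  have kn: "k * n > 0" using k n by simp
  have m0: "m > 0"
  proof (rule ccontr)
    assume "\<not> m > 0"
    then have "ln (real (k * n) + 1) \<le> 0" using m by simp
    then show False using kn by (simp add: ln_le_zero_iff add_pos_pos del: of_nat_mult)
  qed
  define M' where "M' = k * m"
  have kM: "k \<le> M'" using m0 by (simp add: M'_def)
  define C where "C = {1..k * n}"
  define L where "L = V \<times> {..<k}"
  define PA where "PA = L \<times> {..<m}"
  \<comment> \<open>The first \<open>k * m\<close> places of the list of \<open>u\<close> are cut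
    into \<open>k\<close> blocks of \<open>m\<close>; slot \<open>s\<close> owns the block that
    starts at \<open>s * m\<close>.\<close>
  define pose :: "('v \<times> nat) \<times> nat \<Rightarrow> ('v \<times> nat) + 'v set" where
    "pose = (\<lambda>((u, s), j). Inl (u, s * m + j))"
  have divmod: "s = s' \<and> j = j'" if "s * m + j = s' * m + j'" "j < m" "j' < m" for s s' j j'
  proof -
    have "(s * m + j) div m = s" "(s' * m + j') div m = s'" using that(2,3) m0 by auto
    then have "s = s'" using that(1) by metis
    then show ?thesis using that(1) by simp
  qed
  have pos_less: "s * m + j < M'" if "s < k" "j < m" for s j
  proof -
    have "s * m + j < s * m + m" using that by simp
    also have "\<dots> = Suc s * m" by simp
    also have "\<dots> \<le> k * m" using that by (intro mult_le_mono) auto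
    finally show ?thesis by (simp add: M'_def)
  qed
  \<comment> \<open>\<open>Inl\<close> stands for the positions, whether a pool fills them or not;
    \<open>Inr\<close> provides colours for kept edges that have no position.\<close>
  define I where "I = Inl ` (V \<times> {..<M'}) \<union> Inr ` edges G"
  have finI: "finite I" using finV finE by (simp add: I_def)
  define COL where "COL = Pi_pmf I (0 :: nat) (\<lambda>_. pmf_of_set C)"
  define cof where "cof = (\<lambda>col x. if x \<in> PA then col (pose x) else (0 :: nat))"
  have cof_law: "map_pmf cof COL = Pi_pmf PA 0 (\<lambda>_. pmf_of_set C)"
    unfolding cof_def COL_def
  proof (rule Pi_pmf_reindex_subset[OF finI])
    show "finite PA" using finV by (simp add: PA_def L_def)
    show "inj_on pose PA"
    proof (rule inj_onI)
      fix x y assume *: "x \<in> PA" "y \<in> PA" "pose x = pose y"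
      obtain u s j u' s' j' where xy: "x = ((u, s), j)" "y = ((u', s'), j')" by (metis prod.exhaust)
      show "x = y" using * divmod[of s j s' j'] by (auto simp: xy pose_def PA_def)
    qed
    show "pose ` PA \<subseteq> I" using pos_less by (auto simp: pose_def PA_def L_def I_def)
  qed
  \<comment> \<open>Validity asks only for positions in range that differ between rounds. The
    rainbow property is left out because the comparison with \<open>k_out\<close> has to hold for
    all colours.\<close>
  define valid where "valid g \<longleftrightarrow> (\<forall>i<t. \<forall>s\<in>L. g i s < m) \<and> (\<forall>i<t. \<forall>j<t. \<forall>s\<in>L. i \<noteq> j \<longrightarrow> g i s \<noteq> g j s)"
    for g :: "nat \<Rightarrow> 'v \<times> nat \<Rightarrow> nat"
  define good where "good c \<longleftrightarrow> (\<exists>g. valid g \<and> (\<forall>i<t. inj_on (\<lambda>s. c (s, g i s)) L))" for c :: "('v \<times> nat) \<times> nat \<Rightarrow> nat"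
  have "\<exists>g. valid g \<and> (good c \<longrightarrow> (\<forall>i<t. inj_on (\<lambda>s. c (s, g i s)) L))" for c
  proof (cases "good c")
    case True
    then show ?thesis by (auto simp: good_def)
  next
    case False
    have "real t \<le> real m" using t \<gamma> by (smt (verit) mult_left_le_one_le of_nat_0_le_iff)
    \<comment> \<open>Fallback for bad colours: round \<open>i\<close> takes the \<open>i\<close>-th
      position of every slot, which exists since \<open>t \<le> m\<close>.\<close>
    then have "valid (\<lambda>i s. i)" by (auto simp: valid_def)
    then show ?thesis using False by blast
  qed
  then obtain \<tau> where \<tau>: "\<And>c. valid (\<tau> c)" "\<And>c i. good c \<Longrightarrow> i < t \<Longrightarrow> inj_on (\<lambda>s. c (s, \<tau> c i s)) L"
    by metis
  have good_alt: "good c \<longleftrightarrow> (\<exists>g :: nat \<Rightarrow> 'v \<times> nat \<Rightarrow> nat. (\<forall>i<t. (\<forall>s\<in>L. g i s < m) \<and> inj_on (\<lambda>s. c (s, g i s)) L) \<and>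
            (\<forall>i<t. \<forall>j<t. \<forall>s\<in>L. i \<noteq> j \<longrightarrow> g i s \<noteq> g j s))" for c
    unfolding good_def valid_def by (rule ex_cong1) auto
  have Pgood: "measure_pmf.prob COL {col. \<not> good (cof col)} \<le> 18 / real (k * n)"
  proof -
    have "measure_pmf.prob COL {col. \<not> good (cof col)} = measure_pmf.prob (Pi_pmf PA 0 (\<lambda>_. pmf_of_set C)) {c. \<not> good c}"
      unfolding cof_law[symmetric] by (simp add: vimage_def)
    also have "\<dots> \<le> 18 / real (k * n)"
      using random_matchings[of L C "k * n" \<gamma> t m 0] finV cV kn \<gamma> t m unfolding good_alt PA_def
      by (simp add: L_def C_def card_cartesian_product mult.commute)
    finally show ?thesis .
  qed
  define posn where "posn col i u = (\<lambda>s. s * m + \<tau> (cof col) i (u, s)) ` {..<k}" for col i u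
  have \<tau>m: "\<tau> c i (u, s) < m" if "i < t" "u \<in> V" "s < k" for c i u s
    using \<tau>(1)[of c] that by (auto simp: valid_def L_def)
  have posn: "posn col i u \<subseteq> {..<M'}" "card (posn col i u) = k" if "i < t" "u \<in> V" for col i u
  proof -
    show "posn col i u \<subseteq> {..<M'}" using pos_less \<tau>m that by (auto simp: posn_def)
    have "inj_on (\<lambda>s. s * m + \<tau> (cof col) i (u, s)) {..<k}"
    proof (rule inj_onI)
      fix s s' assume ss: "s \<in> {..<k}" "s' \<in> {..<k}"
        and eq: "s * m + \<tau> (cof col) i (u, s) = s' * m + \<tau> (cof col) i (u, s')"
      from divmod[OF eq \<tau>m \<tau>m] that ss show "s = s'" by auto
    qed
    then show "card (posn col i u) = k" by (simp add: posn_def card_image)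
  qed
  let ?PY = "Pi_pmf V {} (\<lambda>u. rsub a (N u))" and ?PZ = "Pi_pmf V {} (\<lambda>u. ksub k (N u))"
  \<comment> \<open>\<open>Y\<close> and \<open>Z\<close> are drawn separately: the pools use
    \<open>Y u - Z u\<close>, the law of the graph uses all of \<open>Y u\<close>.\<close>
  define ENV where "ENV = pair_pmf (pair_pmf ?PY ?PZ) ?PY"
  define pl where "pl = (\<lambda>((Y, Z), F). pool r V (\<lambda>u. Y u - Z u) F :: 'v \<Rightarrow> 'v set)"
  define kp where "kp = (\<lambda>((Y, Z :: 'v \<Rightarrow> 'v set), F). kept r V (\<lambda>u. F u \<union> Y u :: 'v set))"
  define ORD where "ORD w = Pi_pmf V [] (\<lambda>u. pmf_of_set (permutations_of_set (pl w u)))" for w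
  define Hof where "Hof col w xs = (\<lambda>e. if e \<in> kp w then Some (col (index_of V M' xs e)) else None)"
    for col :: "('v \<times> nat) + 'v set \<Rightarrow> nat" and w xs
  define pick_pos where "pick_pos col i xs = (\<lambda>u. {xs u ! j |j. j \<in> posn col i u \<and> j < length (xs u)})"
    for col i and xs :: "'v \<Rightarrow> 'v list"
  define Hsof where "Hsof col xs = (\<lambda>i. choice_edges V (pick_pos col i xs))" for col xs
  define W where "W = bind_pmf COL (\<lambda>col. bind_pmf ENV (\<lambda>w. map_pmf (\<lambda>xs. (Hof col w xs, Hsof col xs)) (ORD w)))"

  have ENVsub: "Y u \<subseteq> N u" "F u \<subseteq> N u" if "((Y, Z), F) \<in> set_pmf ENV" "u \<in> V" for Y Z F u
    using that finV set_rsub[OF finN, of "Y u" a u] set_rsub[OF finN, of "F u" a u]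
    by (auto simp: ENV_def set_Pi_pmf PiE_dflt_def)
  have plV: "pl w u \<subseteq> V" if "w \<in> set_pmf ENV" "u \<in> V" for w u
  proof -
    obtain Y Z F where w: "w = ((Y, Z), F)" by (metis prod.exhaust)
    show ?thesis using ENVsub(2)[of Y Z F u] that NV[of u] by (auto simp: w pl_def pool_def)
  qed
  have kpE: "kp w \<subseteq> edges G" if "w \<in> set_pmf ENV" for w
  proof -
    obtain Y Z F where w: "w = ((Y, Z), F)" by (metis prod.exhaust)
    show ?thesis using ENVsub[of Y Z F] that unfolding edgesG by (fastforce simp: w kp_def kept_def)
  qed
  have ORDs: "distinct (xs u) \<and> set (xs u) = pl w u" if "w \<in> set_pmf ENV" "xs \<in> set_pmf (ORD w)" "u \<in> V" for w xs u
  proof -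
    have "finite (pl w u)" using plV[OF that(1,3)] finV finite_subset by blast
    then have "xs u \<in> permutations_of_set (pl w u)"
      using that(2,3) finV by (auto simp: ORD_def set_Pi_pmf PiE_dflt_def)
    then show ?thesis by (auto dest: permutations_of_setD)
  qed
  have pl_kp: "{u, x} \<in> kp w" if "x \<in> pl w u" "u \<in> V" for x u w
  proof -
    obtain Y Z F where w: "w = ((Y, Z), F)" by (metis prod.exhaust)
    from that(1) consider "x \<in> F u" "r u < r x" | "x \<in> V" "r x < r u" "u \<in> Y x"
      by (auto simp: w pl_def pool_def)
    then show ?thesis
    proof cases
      case 1 then show ?thesis using that(2) by (auto simp: w kp_def kept_def)
    next
      case 2
      then have "{x, u} \<in> kp w" by (auto simp: w kp_def kept_def)
      then show ?thesis by (simp add: insert_commute)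
    qed
  qed
  have uniq: "u' = u \<and> i' = i" if "w \<in> set_pmf ENV" "xs \<in> set_pmf (ORD w)" "u \<in> V" "u' \<in> V"
      "i < length (xs u)" "i' < length (xs u')" "{u', xs u' ! i'} = {u, xs u ! i}" for w xs u u' i i'
  proof -
    obtain Y Z F where w: "w = ((Y, Z), F)" by (metis prod.exhaust)
    have in_pl: "xs u ! i \<in> pl w u" "xs u' ! i' \<in> pl w u'"
      using ORDs[OF that(1,2,3)] ORDs[OF that(1,2,4)] nth_mem that(5,6) by blast+
    have "u' = u \<and> xs u' ! i' = xs u ! i"
      using pool_edge_unique[OF that(3,4) in_pl(1)[unfolded w pl_def prod.case] in_pl(2)[unfolded w pl_def prod.case] that(7)] .
    then show ?thesis using ORDs[OF that(1,2,3)] that(5,6) by (auto simp: nth_eq_iff_index_eq)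
  qed
  have Hs_elem: "\<exists>u s. u \<in> V \<and> s < k \<and> s * m + \<tau> (cof col) i (u, s) < length (xs u) \<and> e = {u, xs u ! (s * m + \<tau> (cof col) i (u, s))}"
    if "e \<in> Hsof col xs i" for e col xs i
    using that by (auto simp: Hsof_def choice_edges_def pick_pos_def posn_def)

  have law_fst: "map_pmf fst W = random_colored_subgraph (k * n) G p"
  proof -
    have "map_pmf fst W = bind_pmf COL (\<lambda>col. bind_pmf ENV (\<lambda>w. map_pmf (Hof col w) (ORD w)))"
      by (simp add: W_def map_bind_pmf pmf.map_comp o_def)
    also have "\<dots> = bind_pmf ENV (\<lambda>w. bind_pmf COL (\<lambda>col. map_pmf (Hof col w) (ORD w)))"
      by (rule bind_commute_pmf)
    also have "\<dots> = bind_pmf ENV (\<lambda>w. bind_pmf (ORD w) (\<lambda>xs. map_pmf (\<lambda>col. Hof col w xs) COL))"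
      unfolding map_pmf_def by (intro bind_pmf_cong refl bind_commute_pmf)
    \<comment> \<open>The index at which the colour of a kept edge is read depends on the pools and
      their orders, but not on the colours.\<close>
    also have "\<dots> = bind_pmf ENV (\<lambda>w. bind_pmf (ORD w) (\<lambda>xs. Pi_pmf (kp w) None (\<lambda>_. map_pmf Some (pmf_of_set C))))"
    proof (intro bind_pmf_cong refl)
      fix w xs assume w: "w \<in> set_pmf ENV"
      have "index_of V M' xs ` kp w \<subseteq> I"
      proof
        fix z assume "z \<in> index_of V M' xs ` kp w"
        then obtain e where e: "e \<in> edges G" "z = index_of V M' xs e" using kpE[OF w] by auto
        from index_of_cases[of V M' xs e] show "z \<in> I"
          by (elim disjE exE conjE) (use e in \<open>auto simp: I_def\<close>)
      qed
      then show "map_pmf (\<lambda>col. Hof col w xs) COL = Pi_pmf (kp w) None (\<lambda>_. map_pmf Some (pmf_of_set C))"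
        unfolding Hof_def COL_def
        using finite_subset[OF kpE[OF w] finE] inj_index_of[of V M' xs]
        by (intro random_coloring finI) (auto intro: inj_on_subset)
    qed
    also have "\<dots> = bind_pmf (map_pmf kp ENV) (\<lambda>K. Pi_pmf K None (\<lambda>_. map_pmf Some (pmf_of_set C)))"
      by (simp add: bind_map_pmf)
    also have "map_pmf kp ENV = rsub p (edges G)"
    proof -
      have "map_pmf kp ENV = map_pmf (\<lambda>(Y, F). kept r V (\<lambda>u. F u \<union> Y u)) (map_pmf (\<lambda>((Y, Z), F). (Y, F)) ENV)"
        by (simp add: pmf.map_comp o_def kp_def case_prod_unfold)
      also have "map_pmf (\<lambda>((Y, Z), F). (Y, F)) ENV = pair_pmf ?PY ?PY"
        by (simp add: ENV_def pair_pmf_def map_bind_pmf bind_assoc_pmf bind_return_pmf)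
      finally show ?thesis using kept_union_law[OF finV, of r] by (simp add: p edgesG)
    qed
    finally show ?thesis by (simp add: random_colored_subgraph_rsub[OF finE] C_def)
  qed

  have domH: "dom (Hof col w xs) = kp w" for col w xs by (auto simp: Hof_def dom_def)
  have Hs_dom: "Hsof col xs i \<subseteq> dom (Hof col w xs)" if "w \<in> set_pmf ENV" "xs \<in> set_pmf (ORD w)" for col w xs i
  proof
    fix e assume "e \<in> Hsof col xs i"
    then obtain u j where "u \<in> V" "j < length (xs u)" "e = {u, xs u ! j}" using Hs_elem by blast
    then show "e \<in> dom (Hof col w xs)" using ORDs[OF that, of u] pl_kp[of "xs u ! j" w u] nth_mem[of j "xs u"] domH by auto
  qed
  have Hs_disj: "Hsof col xs i \<inter> Hsof col xs j = {}"
    if "w \<in> set_pmf ENV" "xs \<in> set_pmf (ORD w)" "i < t" "j < t" "i \<noteq> j" for col w xs i j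
  proof (intro equals0I)
    fix e assume e: "e \<in> Hsof col xs i \<inter> Hsof col xs j"
    from Hs_elem[of e col xs i] e obtain u s where us: "u \<in> V" "s < k"
        "s * m + \<tau> (cof col) i (u, s) < length (xs u)" "e = {u, xs u ! (s * m + \<tau> (cof col) i (u, s))}" by auto
    from Hs_elem[of e col xs j] e obtain u' s' where us': "u' \<in> V" "s' < k"
        "s' * m + \<tau> (cof col) j (u', s') < length (xs u')" "e = {u', xs u' ! (s' * m + \<tau> (cof col) j (u', s'))}" by auto
    have "u' = u" "s' * m + \<tau> (cof col) j (u', s') = s * m + \<tau> (cof col) i (u, s)"
      using uniq[OF that(1,2) us(1) us'(1) us(3) us'(3)] us(4) us'(4) by auto
    then have "s' = s" "\<tau> (cof col) j (u, s) = \<tau> (cof col) i (u, s)"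
      using divmod[of s' "\<tau> (cof col) j (u', s')" s "\<tau> (cof col) i (u, s)"] \<tau>m that(3,4) us us' by auto
    then show False using \<tau>(1)[of "cof col"] that(3-5) us(1,2) by (auto simp: valid_def L_def)
  qed
  have Hs_rainbow: "rainbow (Hof col w xs) (Hsof col xs i)"
    if "w \<in> set_pmf ENV" "xs \<in> set_pmf (ORD w)" "good (cof col)" "i < t" for col w xs i
    unfolding rainbow_def
  proof (intro conjI inj_onI)
    show "Hsof col xs i \<subseteq> dom (Hof col w xs)" by (rule Hs_dom[OF that(1,2)])
    fix e e' assume ee: "e \<in> Hsof col xs i" "e' \<in> Hsof col xs i" and eq: "Hof col w xs e = Hof col w xs e'"
    have col_e: "Hof col w xs {u, xs u ! (s * m + \<tau> (cof col) i (u, s))} = Some (cof col ((u, s), \<tau> (cof col) i (u, s)))"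
      if us: "u \<in> V" "s < k" "s * m + \<tau> (cof col) i (u, s) < length (xs u)"
        and e: "{u, xs u ! (s * m + \<tau> (cof col) i (u, s))} \<in> Hsof col xs i" for u s
    proof -
      let ?j = "s * m + \<tau> (cof col) i (u, s)"
      have "index_of V M' xs {u, xs u ! ?j} = Inl (u, ?j)"
        using uniq[OF \<open>w \<in> set_pmf ENV\<close> \<open>xs \<in> set_pmf (ORD w)\<close> us(1) _ us(3)] us pos_less \<tau>m[OF \<open>i < t\<close> us(1,2)]
        by (intro index_of_position) auto
      moreover have "{u, xs u ! ?j} \<in> kp w"
        using e Hs_dom[OF \<open>w \<in> set_pmf ENV\<close> \<open>xs \<in> set_pmf (ORD w)\<close>] domH by blast
      ultimately show ?thesis
        using us \<tau>m[OF \<open>i < t\<close> us(1,2)] by (simp add: Hof_def cof_def PA_def L_def pose_def)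
    qed
    from Hs_elem[OF ee(1)] obtain u s where us: "u \<in> V" "s < k"
        "s * m + \<tau> (cof col) i (u, s) < length (xs u)" "e = {u, xs u ! (s * m + \<tau> (cof col) i (u, s))}" by auto
    from Hs_elem[OF ee(2)] obtain u' s' where us': "u' \<in> V" "s' < k"
        "s' * m + \<tau> (cof col) i (u', s') < length (xs u')" "e' = {u', xs u' ! (s' * m + \<tau> (cof col) i (u', s'))}" by auto
    have "cof col ((u, s), \<tau> (cof col) i (u, s)) = cof col ((u', s'), \<tau> (cof col) i (u', s'))"
      using eq col_e[OF us(1-3)] col_e[OF us'(1-3)] ee us(4) us'(4) by simp
    then have "(u, s) = (u', s')"
      using inj_onD[OF \<tau>(2)[OF that(3,4)], of "(u, s)" "(u', s')"] us us' by (simp add: L_def)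
    then show "e = e'" using us(4) us'(4) by simp
  qed

  have rain: "measure_pmf.prob W {(H, Hs). \<not> (\<forall>i<t. rainbow H (Hs i))} \<le> 18 / real (k * n)"
  proof -
    have "measure_pmf.prob W {(H, Hs). \<not> (\<forall>i<t. rainbow H (Hs i))} \<le> 0 + measure_pmf.prob COL {col. \<not> good (cof col)}"
      unfolding W_def
    proof (rule prob_bind_bound)
      fix col assume "col \<notin> {col. \<not> good (cof col)}"
      then have "measure_pmf.prob (bind_pmf ENV (\<lambda>w. map_pmf (\<lambda>xs. (Hof col w xs, Hsof col xs)) (ORD w)))
          {(H, Hs). \<not> (\<forall>i<t. rainbow H (Hs i))} = 0"
        using Hs_rainbow by (subst measure_pmf_zero_iff) auto
      then show "measure_pmf.prob (bind_pmf ENV (\<lambda>w. map_pmf (\<lambda>xs. (Hof col w xs, Hsof col xs)) (ORD w)))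
          {(H, Hs). \<not> (\<forall>i<t. rainbow H (Hs i))} \<le> 0" by simp
    qed simp
    then show ?thesis using Pgood by simp
  qed

  define bd where "bd = n * (exp (- (tail_rate \<gamma> * (a * (1 - a)) * ((1 - \<gamma>) * \<pi> * \<delta>))) + exp (- (tail_rate \<gamma> * \<pi> * \<delta>)))"
  have env_bad: "measure_pmf.prob (envlaw V) {(B, F). \<exists>u\<in>V. card (pool r V B F u) < M'} \<le> bd"
    using small_pool_prob[OF finV r NV _ \<delta>(2) \<pi> \<gamma>, of M'] M \<delta>(1) cV by (simp add: bd_def M'_def V_def N_def)
  have envENV: "envlaw V = map_pmf (\<lambda>((Y, Z), F). (\<lambda>u. Y u - Z u, F)) ENV"
    unfolding ENV_def by (rule envlaw_eq[OF finV])
  have dom: "measure_pmf.prob (k_out k G) {K. P K} \<le> measure_pmf.prob W {(H, Hs). P (verts G, Hs i)} + 2 * bd" if i: "i < t" for i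
  proof -
    define \<Phi> where "\<Phi> E \<longleftrightarrow> P (V, E)" for E
    define Qlaw where "Qlaw = bind_pmf (envlaw V) (\<lambda>(B, F). Pi_pmf V {} (\<lambda>u. pick k (pool r V B F u) (N u - B u)))"
    have edN: "choice_edges V N \<subseteq> edges G" by (auto simp: choice_edges_def N_def neighbors_def)
    have "measure_pmf.prob (k_out k G) {K. P K} = measure_pmf.prob (Pi_pmf V {} (\<lambda>u. ksub k (N u))) {s. \<Phi> (choice_edges V s)}"
      unfolding k_out_def by (simp add: vimage_def \<Phi>_def choice_edges_def V_def N_def ksub_def)
    also have "\<dots> \<le> measure_pmf.prob Qlaw {q. \<Phi> (choice_edges V q)} + measure_pmf.prob (envlaw V) {(B, F). \<exists>u\<in>V. card (pool r V B F u) < k}"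
      unfolding Qlaw_def
    proof (rule kout_domination[OF finV r NV kN])
      fix E E' assume E: "E \<subseteq> E'" "E' \<subseteq> choice_edges V N" "\<Phi> E"
      have "simple_graph (V, E'')" if "E'' \<subseteq> E'" for E''
      proof -
        have "E'' \<subseteq> edges G" using that E(2) edN by blast
        then show ?thesis using G(1) unfolding simple_graph_def V_def fst_conv snd_conv by blast
      qed
      then have "simple_graph (V, E)" "simple_graph (V, E')" using E(1) by auto
      then show "\<Phi> E'" using P E(1,3) unfolding monotone_increasing_def \<Phi>_def by fastforce
    qed
    also have "measure_pmf.prob (envlaw V) {(B, F). \<exists>u\<in>V. card (pool r V B F u) < k}
        \<le> measure_pmf.prob (envlaw V) {(B, F). \<exists>u\<in>V. card (pool r V B F u) < M'}"
      using kM by (intro measure_pmf.finite_measure_mono) (auto intro: less_le_trans)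
    also have "\<dots> \<le> bd" by (rule env_bad)
    also have "measure_pmf.prob Qlaw {q. \<Phi> (choice_edges V q)} \<le> measure_pmf.prob W {(H, Hs). P (verts G, Hs i)} + bd"
    proof -
      \<comment> \<open>The comparison is made for each \<open>col\<close> separately, good or bad,
        so no exceptional set of colours is paid for.\<close>
      have "measure_pmf.prob (bind_pmf COL (\<lambda>_. Qlaw)) {q. \<Phi> (choice_edges V q)}
          \<le> measure_pmf.prob W {(H, Hs). P (verts G, Hs i)} + bd + measure_pmf.prob COL {}"
        unfolding W_def
      proof (rule prob_bind_le)
        fix col
        define badE where "badE = {w. \<exists>u\<in>V. card (pl w u) < M'}"
        have QE: "Qlaw = bind_pmf ENV (\<lambda>w. Pi_pmf V {} (\<lambda>u. pick k (pl w u) (N u - (fst (fst w) u - snd (fst w) u))))"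
          by (simp add: Qlaw_def envENV bind_map_pmf case_prod_unfold pl_def)
        have "measure_pmf.prob Qlaw {q. \<Phi> (choice_edges V q)}
            \<le> measure_pmf.prob (bind_pmf ENV (\<lambda>w. map_pmf (\<lambda>xs. (Hof col w xs, Hsof col xs)) (ORD w))) {(H, Hs). P (verts G, Hs i)}
              + 0 + measure_pmf.prob ENV badE"
          unfolding QE
        proof (rule prob_bind_le)
          fix w assume w: "w \<in> set_pmf ENV" "w \<notin> badE"
          have "pick k (pl w u) (N u - (fst (fst w) u - snd (fst w) u)) =
              map_pmf (\<lambda>xs. {xs ! j |j. j \<in> posn col i u \<and> j < length xs}) (pmf_of_set (permutations_of_set (pl w u)))"
            if u: "u \<in> V" for u
          proof -
            have cM: "M' \<le> card (pl w u)" using w(2) u by (auto simp: badE_def not_less)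
            have fin: "finite (pl w u)" using plV[OF w(1) u] finV finite_subset by blast
            have "posn col i u \<subseteq> {..<card (pl w u)}" using posn(1)[OF i u] cM by force
            from set_take_permutation_uniform[OF fin this] show ?thesis
              using cM kM posn(2)[OF i u] by (simp add: pick_def)
          qed
          then have "Pi_pmf V {} (\<lambda>u. pick k (pl w u) (N u - (fst (fst w) u - snd (fst w) u))) =
              Pi_pmf V {} (\<lambda>u. map_pmf (\<lambda>xs. {xs ! j |j. j \<in> posn col i u \<and> j < length xs}) (pmf_of_set (permutations_of_set (pl w u))))"
            by (intro Pi_pmf_cong refl)
          also have "\<dots> = map_pmf (\<lambda>xs u. if u \<in> V then {xs u ! j |j. j \<in> posn col i u \<and> j < length (xs u)} else {}) (ORD w)"
            unfolding ORD_def by (rule Pi_pmf_map_dep[OF finV])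
          finally have eq: "Pi_pmf V {} (\<lambda>u. pick k (pl w u) (N u - (fst (fst w) u - snd (fst w) u))) = \<dots>" .
          have "choice_edges V (\<lambda>u. if u \<in> V then {xs u ! j |j. j \<in> posn col i u \<and> j < length (xs u)} else {}) = Hsof col xs i" for xs
            by (auto simp: choice_edges_def Hsof_def pick_pos_def)
          then show "measure_pmf.prob (Pi_pmf V {} (\<lambda>u. pick k (pl w u) (N u - (fst (fst w) u - snd (fst w) u)))) {q. \<Phi> (choice_edges V q)}
              \<le> measure_pmf.prob (map_pmf (\<lambda>xs. (Hof col w xs, Hsof col xs)) (ORD w)) {(H, Hs). P (verts G, Hs i)} + 0"
            unfolding eq by (simp add: vimage_def \<Phi>_def V_def)
        qed simp
        also have "measure_pmf.prob ENV badE = measure_pmf.prob (envlaw V) {(B, F). \<exists>u\<in>V. card (pool r V B F u) < M'}"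
          unfolding envENV by (simp add: vimage_def badE_def pl_def case_prod_unfold)
        also have "\<dots> \<le> bd" by (rule env_bad)
        finally show "measure_pmf.prob Qlaw {q. \<Phi> (choice_edges V q)}
            \<le> measure_pmf.prob (bind_pmf ENV (\<lambda>w. map_pmf (\<lambda>xs. (Hof col w xs, Hsof col xs)) (ORD w))) {(H, Hs). P (verts G, Hs i)} + bd"
          by simp
      qed (simp add: bd_def)
      then show ?thesis by simp
    qed
    finally show ?thesis by simp
  qed
  have supp: "\<forall>(H, Hs)\<in>set_pmf W. (\<forall>i<t. Hs i \<subseteq> dom H) \<and> (\<forall>i<t. \<forall>j<t. i \<noteq> j \<longrightarrow> Hs i \<inter> Hs j = {})"
    using Hs_dom Hs_disj by (auto simp: W_def)
  show ?thesis
    using law_fst supp rain dom unfolding bd_def by (intro exI[of _ W]) blast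
qed

section \<open>Splitting into sparse random graphs\<close>

definition packing_event :: "nat \<Rightarrow> ('v colored_graph \<times> (nat \<Rightarrow> 'v set set)) set" where
  "packing_event t = {(H, Hs). dom H = (\<Union>i\<in>{0..t}. Hs i) \<and> disjoint_family_on Hs {0..t} \<and>
     (\<forall>i\<in>{1..t}. rainbow H (Hs i))}"

text \<open>The conditional law of the second coordinate given the first, used to resample a packing
  for a class graph that arose in a different way.\<close>

definition disint :: "('a \<times> 'b) pmf \<Rightarrow> 'a \<Rightarrow> 'b pmf" where
  "disint M h = map_pmf snd (cond_pmf M {x. fst x = h})"

lemma bind_disint: "bind_pmf (map_pmf fst M) (\<lambda>h. map_pmf (Pair h) (disint M h)) = M"
proof -
  have "bind_pmf (map_pmf fst M) (\<lambda>h. map_pmf (Pair h) (disint M h))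
      = bind_pmf (map_pmf fst M) (\<lambda>h. cond_pmf M {x. fst x = h})"
  proof (rule bind_pmf_cong[OF refl])
    fix h assume "h \<in> set_pmf (map_pmf fst M)"
    then have ne: "set_pmf M \<inter> {x. fst x = h} \<noteq> {}" by auto
    have "map_pmf (Pair h) (disint M h) = map_pmf id (cond_pmf M {x. fst x = h})"
      unfolding disint_def pmf.map_comp by (rule map_pmf_cong[OF refl]) (auto simp: set_cond_pmf[OF ne])
    then show "map_pmf (Pair h) (disint M h) = cond_pmf M {x. fst x = h}" by simp
  qed
  also have "\<dots> = M"
  proof (rule bind_cond_pmf_cancel)
    show "measure_pmf.prob M {y. fst y = x} = measure_pmf.prob (map_pmf fst M) {h. fst y = h}"
      if "fst y = x" for x and y :: "'a \<times> 'b"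
      using that by (simp add: vimage_def eq_commute)
  qed auto
  finally show ?thesis .
qed

section \<open>Random labels on the edges and the thinned graphs that they define\<close>

lemma random_colored_subgraph_Pi:
  assumes "finite (edges G)"
  shows "random_colored_subgraph c G p = Pi_pmf (edges G) None
    (\<lambda>_. bind_pmf (bernoulli_pmf p) (\<lambda>b. if b then map_pmf Some (pmf_of_set {1..c}) else return_pmf None))"
  unfolding random_colored_subgraph_def
  by (subst Pi_pmf_bind[OF assms, where d' = False]) (simp add: Pi_pmf_if_set[OF assms])

definition label_edge :: "nat \<Rightarrow> nat \<Rightarrow> real \<Rightarrow> (nat \<times> nat) option pmf" where
  "label_edge m c p = bind_pmf (bernoulli_pmf p)
     (\<lambda>b. if b then map_pmf Some (pair_pmf (pmf_of_set {..<m}) (pmf_of_set {1..c})) else return_pmf None)"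

definition restrict_label :: "nat \<Rightarrow> (nat \<times> nat) option \<Rightarrow> nat option" where
  "restrict_label l x = (case x of None \<Rightarrow> None | Some (l', c) \<Rightarrow> if l' = l then Some c else None)"

lemma map_label_edge_snd:
  "map_pmf (map_option snd) (label_edge m c p) =
   bind_pmf (bernoulli_pmf p) (\<lambda>b. if b then map_pmf Some (pmf_of_set {1..c}) else return_pmf None)"
  unfolding label_edge_def map_bind_pmf
proof (intro bind_pmf_cong refl)
  fix b
  have "map_pmf (map_option snd) (map_pmf Some (pair_pmf (pmf_of_set {..<m}) (pmf_of_set {1..c})))
      = map_pmf Some (map_pmf snd (pair_pmf (pmf_of_set {..<m}) (pmf_of_set {1..c})))"
    by (simp only: pmf.map_comp) (simp add: o_def)
  then show "map_pmf (map_option snd) (if b then map_pmf Some (pair_pmf (pmf_of_set {..<m}) (pmf_of_set {1..c})) else return_pmf None)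
      = (if b then map_pmf Some (pmf_of_set {1..c}) else return_pmf None)"
    by (simp add: map_snd_pair_pmf)
qed

lemma map_label_edge_restrict:
  fixes l m c :: nat and p :: real
  assumes "l < m" "0 \<le> p" "p \<le> 1"
  shows "map_pmf (restrict_label l) (label_edge m c p) =
   bind_pmf (bernoulli_pmf (p / m)) (\<lambda>b. if b then map_pmf Some (pmf_of_set {1..c}) else return_pmf None)"
proof -
  let ?q = "\<lambda>b. if b then map_pmf Some (pmf_of_set {1..c}) else return_pmf None"
  let ?thin = "bind_pmf (bernoulli_pmf p) (\<lambda>b. if b then map_pmf (\<lambda>l'. l' = l) (pmf_of_set {..<m}) else return_pmf False)"
  have m: "m > 0" using assms by simp
  have "map_pmf (restrict_label l) (map_pmf Some (pair_pmf (pmf_of_set {..<m}) (pmf_of_set {1..c})))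
      = bind_pmf (pmf_of_set {..<m}) (\<lambda>l'. ?q (l' = l))"
    unfolding pmf.map_comp pair_pmf_def map_bind_pmf
    by (intro bind_pmf_cong refl) (auto simp: restrict_label_def map_pmf_def bind_return_pmf)
  then have "map_pmf (restrict_label l) (label_edge m c p) = bind_pmf ?thin ?q"
    unfolding label_edge_def map_bind_pmf bind_assoc_pmf
    by (intro bind_pmf_cong refl) (auto simp: bind_map_pmf bind_return_pmf restrict_label_def)
  moreover have "?thin = bernoulli_pmf (p / m)"
  proof (rule pmf_eqI)
    fix b
    have pm: "0 \<le> p / m" "p / m \<le> 1" using assms m by (auto simp: divide_le_eq)
    have "pmf (map_pmf (\<lambda>l'. l' = l) (pmf_of_set {..<m})) True = 1 / m"
    proof -
      have "{..<m} \<inter> (\<lambda>l'. l' = l) -` {True} = {l}" using assms(1) by auto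
      moreover have "{..<m} \<noteq> {}" using m by auto
      ultimately show ?thesis by (simp add: pmf_map measure_pmf_of_set)
    qed
    then have T: "pmf ?thin True = p / m" using assms by (simp add: pmf_bind)
    show "pmf ?thin b = pmf (bernoulli_pmf (p / m)) b"
      using T pm by (cases b) (simp_all add: pmf_False_conv_True)
  qed
  ultimately show ?thesis by simp
qed

text \<open>Every edge of \<open>H\<close> receives one of \<open>m\<close> labels; conditionally on the subgraph \<open>H\<^sub>l\<close> of the
  edges labelled \<open>l\<close>, which is distributed like the first component of \<open>W\<close>, the second
  component of \<open>W\<close> is sampled.\<close>
lemma combine_classes:
  fixes G :: "'v ugraph" and W :: "('v colored_graph \<times> (nat \<Rightarrow> 'v set set)) pmf" and p x b \<rho> :: real
    and c m t t' :: nat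
  assumes fin: "finite (edges G)" and m: "m > 0" and p: "0 \<le> p" "p \<le> 1" and t: "t \<le> m * t'"
    and Wfst: "map_pmf fst W = random_colored_subgraph c G (p / m)"
    and Wsupp: "\<forall>(H, Hs)\<in>set_pmf W. (\<forall>i<t'. Hs i \<subseteq> dom H) \<and> (\<forall>i<t'. \<forall>j<t'. i \<noteq> j \<longrightarrow> Hs i \<inter> Hs j = {})"
    and Wrain: "measure_pmf.prob W {(H, Hs). \<not> (\<forall>i<t'. rainbow H (Hs i))} \<le> \<rho>"
    and WP: "\<And>i. i < t' \<Longrightarrow> x \<le> measure_pmf.prob W {(H, Hs). Q (Hs i)} + b"
  shows "\<exists>M :: ('v colored_graph \<times> (nat \<Rightarrow> 'v set set)) pmf.
    map_pmf fst M = random_colored_subgraph c G p \<and>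
    (\<forall>(H, Hs)\<in>set_pmf M. \<forall>i\<in>{0..t}. Hs i \<subseteq> edges G) \<and>
    measure_pmf.prob M (packing_event t) \<ge> 1 - m * \<rho> \<and>
    (\<forall>i\<in>{1..t}. x \<le> measure_pmf.prob M {(H, Hs). Q (Hs i)} + b)"
proof -
  define XL where "XL = Pi_pmf (edges G) None (\<lambda>_. label_edge m c p)"
  define K where "K = disint W"
  define Hf where "Hf = (\<lambda>(X :: 'v set \<Rightarrow> (nat \<times> nat) option) e. map_option snd (X e))"
  define Hl where "Hl = (\<lambda>l (X :: 'v set \<Rightarrow> (nat \<times> nat) option) e. restrict_label l (X e))"
  \<comment> \<open>Rounds are numbered from 1, as index 0 is reserved for the leftover edges.
    Consecutive rounds run cyclically through the \<open>m\<close> classes; the quotient is the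
    number within the class, counted from 0.\<close>
  define part where "part = (\<lambda>(hs :: nat \<Rightarrow> nat \<Rightarrow> 'v set set) i. hs ((i - 1) mod m) ((i - 1) div m))"
  define comb where "comb = (\<lambda>X hs i. if i = 0 then dom (Hf X) - (\<Union>j\<in>{1..t}. part hs j) else part hs i)"
  \<comment> \<open>Given the labels, the packings of the classes are resampled independently. The
    class graphs are dependent, being edge-disjoint, but only the law of each single class is used,
    together with a union bound over the classes.\<close>
  define J where "J = bind_pmf XL (\<lambda>X. map_pmf (Pair X) (Pi_pmf {..<m} (\<lambda>_. {}) (\<lambda>l. K (Hl l X))))"
  define M where "M = map_pmf (\<lambda>(X, hs). (Hf X, comb X hs)) J"
  have Jfst: "map_pmf fst J = XL"
    by (simp add: J_def map_bind_pmf pmf.map_comp o_def map_pmf_const bind_return_pmf')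
  have Hf_alt: "Hf = (\<lambda>X. map_option snd \<circ> X)" and Hl_alt: "Hl l = (\<lambda>X. restrict_label l \<circ> X)" for l
    by (simp_all add: Hf_def Hl_def fun_eq_iff)
  have Hf_law: "map_pmf Hf XL = random_colored_subgraph c G p"
    unfolding random_colored_subgraph_Pi[OF fin] map_label_edge_snd[of m, symmetric] XL_def
    unfolding Hf_alt by (rule Pi_pmf_map[OF fin, symmetric]) simp
  have Hl_law: "map_pmf (Hl l) XL = map_pmf fst W" if "l < m" for l
    unfolding Wfst random_colored_subgraph_Pi[OF fin] map_label_edge_restrict[OF that p, symmetric] XL_def
    unfolding Hl_alt by (rule Pi_pmf_map[OF fin, symmetric]) (simp add: restrict_label_def)
  have Mfst: "map_pmf fst M = random_colored_subgraph c G p"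
  proof -
    have "map_pmf fst M = map_pmf Hf (map_pmf fst J)"
      by (simp add: M_def pmf.map_comp o_def case_prod_unfold)
    then show ?thesis by (simp add: Jfst Hf_law)
  qed
  have class_law: "map_pmf (\<lambda>(X, hs). (Hl l X, hs l)) J = W" if l: "l < m" for l
  proof -
    have "map_pmf (\<lambda>(X, hs). (Hl l X, hs l)) J =
        bind_pmf XL (\<lambda>X. map_pmf (Pair (Hl l X)) (map_pmf (\<lambda>hs. hs l) (Pi_pmf {..<m} (\<lambda>_. {}) (\<lambda>l. K (Hl l X)))))"
      by (simp add: J_def map_bind_pmf pmf.map_comp o_def)
    also have "\<dots> = bind_pmf (map_pmf (Hl l) XL) (\<lambda>h. map_pmf (Pair h) (K h))"
      using l by (simp add: Pi_pmf_component bind_map_pmf)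
    also have "\<dots> = W" unfolding Hl_law[OF l] K_def by (rule bind_disint)
    finally show ?thesis .
  qed
  have JW: "(Hl l X, hs l) \<in> set_pmf W" if "(X, hs) \<in> set_pmf J" "l < m" for l X hs
    using that(1) by (subst class_law[OF that(2), symmetric]) force
  have Hl_dom: "dom (Hl l X) \<subseteq> dom (Hf X)" "Hl l X e = Some y \<Longrightarrow> Hf X e = Some y"
    "l \<noteq> l' \<Longrightarrow> dom (Hl l X) \<inter> dom (Hl l' X) = {}" for l l' X e y
    by (auto simp: Hl_def Hf_def restrict_label_def split: option.splits if_splits)
  have idx: "(i - 1) mod m < m" "(i - 1) div m < t'" if "i \<in> {1..t}" for i
  proof -
    show "(i - 1) mod m < m" using m by simp
    have "i - 1 < t" using that by auto
    then have "i - 1 < t' * m" using t by (simp add: mult.commute)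
    then show "(i - 1) div m < t'" by (rule less_mult_imp_div_less)
  qed
  have part_sub: "part hs i \<subseteq> dom (Hl ((i - 1) mod m) X)" if "(X, hs) \<in> set_pmf J" "i \<in> {1..t}" for X hs i
    using bspec[OF Wsupp JW[OF that(1) idx(1)[OF that(2)]]] idx(2)[OF that(2)] by (auto simp: part_def)
  have part_disj: "part hs i \<inter> part hs j = {}" if J: "(X, hs) \<in> set_pmf J" and ij: "i \<in> {1..t}" "j \<in> {1..t}" "i \<noteq> j" for X hs i j
  proof (cases "(i - 1) mod m = (j - 1) mod m")
    case True
    have "(i - 1) div m \<noteq> (j - 1) div m"
    proof
      assume "(i - 1) div m = (j - 1) div m"
      then have "i - 1 = j - 1" using True by (metis div_mult_mod_eq)
      then show False using ij by auto
    qed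
    then show ?thesis
      using bspec[OF Wsupp JW[OF J idx(1)[OF ij(1)]]] idx(2)[OF ij(1)] idx(2)[OF ij(2)] True by (auto simp: part_def)
  next
    case False
    then show ?thesis using part_sub[OF J ij(1)] part_sub[OF J ij(2)] Hl_dom(3) by blast
  qed
  have domE: "dom (Hf X) \<subseteq> edges G" if "(X, hs) \<in> set_pmf J" for X hs
  proof -
    have "X \<in> set_pmf (map_pmf fst J)" using that by force
    then have "X e = None" if "e \<notin> edges G" for e
      using Pi_pmf_dflt_outside[of X "edges G" None] fin that unfolding Jfst XL_def by blast
    then show ?thesis by (force simp: Hf_def)
  qed
  have parts_dom: "part hs i \<subseteq> dom (Hf X)" if "(X, hs) \<in> set_pmf J" "i \<in> {1..t}" for X hs i
    using part_sub[OF that] Hl_dom(1) by blast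
  have comb_pos: "comb X hs i = part hs i" if "i \<in> {1..t}" for X hs i using that by (auto simp: comb_def)
  have supp: "Hs i \<subseteq> edges G" if HM: "(H, Hs) \<in> set_pmf M" "i \<in> {0..t}" for H Hs i
  proof -
    obtain X hs where J: "(X, hs) \<in> set_pmf J" "Hs = comb X hs" using HM(1) by (auto simp: M_def)
    show ?thesis
    proof (cases "i = 0")
      case True then show ?thesis using domE[OF J(1)] J(2) by (auto simp: comb_def)
    next
      case False
      then have i: "i \<in> {1..t}" using HM(2) by auto
      show ?thesis using parts_dom[OF J(1) i] domE[OF J(1)] J(2) comb_pos[OF i] by blast
    qed
  qed
  have cover: "dom (Hf X) = (\<Union>i\<in>{0..t}. comb X hs i)" if J: "(X, hs) \<in> set_pmf J" for X hs
  proof -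
    have "{0..t} = insert 0 {1..t}" by auto
    then have "(\<Union>i\<in>{0..t}. comb X hs i) = comb X hs 0 \<union> (\<Union>i\<in>{1..t}. comb X hs i)" by simp
    also have "(\<Union>i\<in>{1..t}. comb X hs i) = (\<Union>i\<in>{1..t}. part hs i)" by (simp add: comb_pos)
    also have "comb X hs 0 = dom (Hf X) - (\<Union>i\<in>{1..t}. part hs i)" by (simp add: comb_def)
    finally show ?thesis using UN_least[OF parts_dom[OF J], of "{1..t}" "\<lambda>i. i"] by blast
  qed
  have disj: "disjoint_family_on (comb X hs) {0..t}" if J: "(X, hs) \<in> set_pmf J" for X hs
    unfolding disjoint_family_on_def
  proof (intro ballI impI)
    fix i j assume ij: "i \<in> {0..t}" "j \<in> {0..t}" "i \<noteq> j"
    have zero: "comb X hs 0 \<inter> part hs l = {}" if "l \<in> {1..t}" for l using that by (auto simp: comb_def)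
    show "comb X hs i \<inter> comb X hs j = {}"
    proof (cases "i = 0 \<or> j = 0")
      case True
      then show ?thesis using zero[of i] zero[of j] ij comb_pos[of i X hs] comb_pos[of j X hs] by fastforce
    next
      case False
      then have "i \<in> {1..t}" "j \<in> {1..t}" using ij by auto
      then show ?thesis using part_disj[OF J] ij(3) comb_pos by simp
    qed
  qed
  define bad where "bad l = {(X, hs). \<not> (\<forall>i<t'. rainbow (Hl l X) (hs l i))}" for l
  have rain: "rainbow (Hf X) (comb X hs i)"
    if J: "(X, hs) \<in> set_pmf J" and nb: "(X, hs) \<notin> (\<Union>l<m. bad l)" and i: "i \<in> {1..t}" for X hs i
  proof -
    have "rainbow (Hl ((i - 1) mod m) X) (part hs i)"
      using nb idx[OF i] by (auto simp: bad_def part_def)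
    then have sub: "part hs i \<subseteq> dom (Hl ((i - 1) mod m) X)" and inj: "inj_on (Hl ((i - 1) mod m) X) (part hs i)"
      by (auto simp: rainbow_def)
    have "Hf X e = Hl ((i - 1) mod m) X e" if "e \<in> part hs i" for e
      using sub that Hl_dom(2) by fastforce
    then have "inj_on (Hf X) (part hs i)" using inj by (simp cong: inj_on_cong)
    then show ?thesis using parts_dom[OF J i] comb_pos[OF i] by (simp add: rainbow_def)
  qed
  have bad_prob: "measure_pmf.prob J (bad l) \<le> \<rho>" if l: "l < m" for l
  proof -
    have "measure_pmf.prob J (bad l) = measure_pmf.prob (map_pmf (\<lambda>(X, hs). (Hl l X, hs l)) J) {(H, Hs). \<not> (\<forall>i<t'. rainbow H (Hs i))}"
      by (simp add: vimage_def bad_def case_prod_unfold)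
    then show ?thesis using Wrain by (simp add: class_law[OF l])
  qed
  have okp: "measure_pmf.prob M (packing_event t) \<ge> 1 - m * \<rho>"
  proof -
    have "measure_pmf.prob J (UNIV - (\<Union>l<m. bad l)) \<le> measure_pmf.prob J {(X, hs). (Hf X, comb X hs) \<in> packing_event t}"
    proof (rule measure_pmf.finite_measure_mono_AE)
      show "AE w in J. w \<in> UNIV - (\<Union>l<m. bad l) \<longrightarrow> w \<in> {(X, hs). (Hf X, comb X hs) \<in> packing_event t}"
      proof (rule AE_pmfI, rule impI)
        fix w assume w: "w \<in> set_pmf J" "w \<in> UNIV - (\<Union>l<m. bad l)"
        obtain X hs where X: "w = (X, hs)" by force
        show "w \<in> {(X, hs). (Hf X, comb X hs) \<in> packing_event t}"
          using cover[of X hs] disj[of X hs] rain[of X hs] w unfolding X packing_event_def by simp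
      qed
    qed simp
    also have "\<dots> = measure_pmf.prob M (packing_event t)" by (simp add: M_def vimage_def case_prod_unfold)
    finally have 1: "measure_pmf.prob J (UNIV - (\<Union>l<m. bad l)) \<le> measure_pmf.prob M (packing_event t)" .
    have "measure_pmf.prob J (UNIV - (\<Union>l<m. bad l)) = 1 - measure_pmf.prob J (\<Union>l<m. bad l)"
      using measure_pmf.prob_compl[of "\<Union>l<m. bad l" J] by simp
    moreover have "measure_pmf.prob J (\<Union>l<m. bad l) \<le> (\<Sum>l<m. measure_pmf.prob J (bad l))"
      by (rule measure_pmf.finite_measure_subadditive_finite) auto
    moreover have "\<dots> \<le> (\<Sum>l<m. \<rho>)" by (intro sum_mono bad_prob) auto
    ultimately show ?thesis using 1 by simp
  qed
  have PM: "x \<le> measure_pmf.prob M {(H, Hs). Q (Hs i)} + b" if i: "i \<in> {1..t}" for i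
  proof -
    let ?l = "(i - 1) mod m" and ?j = "(i - 1) div m"
    have "measure_pmf.prob M {(H, Hs). Q (Hs i)} = measure_pmf.prob J {(X, hs). Q (hs ?l ?j)}"
      using comb_pos[OF i] by (simp add: M_def vimage_def case_prod_unfold part_def)
    also have "\<dots> = measure_pmf.prob (map_pmf (\<lambda>(X, hs). (Hl ?l X, hs ?l)) J) {(H, Hs). Q (Hs ?j)}"
      by (simp add: vimage_def case_prod_unfold)
    finally show ?thesis using WP[OF idx(2)[OF i]] unfolding class_law[OF idx(1)[OF i]] by simp
  qed
  show ?thesis
    using Mfst supp okp PM by (intro exI[of _ M]) blast
qed

section \<open>Choice of the parameters\<close>

lemma min_degree_le:
  assumes "simple_graph G" "u \<in> verts G"
  shows "min_degree G \<le> card (neighbors G u)"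
  unfolding min_degree_def using assms simple_graph_neighbors(5)[OF assms(1)] by (intro Min_le) auto

definition has_packing :: "nat \<Rightarrow> ('v ugraph \<Rightarrow> bool) \<Rightarrow> 'v ugraph \<Rightarrow> real \<Rightarrow> nat \<Rightarrow> real \<Rightarrow> real \<Rightarrow> bool" where
  "has_packing k P G p t \<eta> b \<longleftrightarrow> (\<exists>M :: ('v colored_graph \<times> (nat \<Rightarrow> 'v set set)) pmf.
     map_pmf fst M = random_colored_subgraph (k * card (verts G)) G p \<and>
     (\<forall>(H, Hs)\<in>set_pmf M. \<forall>i\<in>{0..t}. Hs i \<subseteq> edges G) \<and>
     measure_pmf.prob M (packing_event t) \<ge> 1 - \<eta> \<and>
     (\<forall>i\<in>{1..t}. measure_pmf.prob (k_out k G) {K. P K} \<le> measure_pmf.prob M {(H, Hs). P (verts G, Hs i)} + b))"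

text \<open>The loss consists of five factors \<open>1 - \<gamma>\<close>: the Chernoff bounds for
  the surviving permissions and for the pools, the bounds on \<open>\<pi>\<close> and on
  \<open>1 - a\<close>, and the passage from \<open>N\<close> positions per slot to
  \<open>t'\<close> rounds. The constants are quantified before graph and density, which makes the
  statement uniform in \<open>n\<close>.\<close>

lemma rainbow_packing:
  fixes \<epsilon> :: real and k :: nat and P :: "'v ugraph \<Rightarrow> bool"
  assumes \<epsilon>: "\<epsilon> > 0" and k: "k \<ge> 1" and P: "monotone_increasing P"
  shows "\<exists>c0 L c m :: real. c > 0 \<and> (\<forall>(G :: 'v ugraph) (p :: real) (n :: nat) (\<delta> :: real).
     simple_graph G \<longrightarrow> card (verts G) = n \<longrightarrow> n > 0 \<longrightarrow> 0 < p \<longrightarrow> p \<le> 1 \<longrightarrow> \<delta> = real (min_degree G) \<longrightarrow>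
     \<delta> * p \<ge> c0 \<longrightarrow> \<delta> * p \<ge> L * ln (real (k * n) + 1) \<longrightarrow>
     has_packing k P G p (nat \<lfloor>(1 - \<epsilon>) * (\<delta> * p / (2 * real k))\<rfloor>) (m * (18 / real (k * n))) (4 * real n * exp (- (c * (\<delta> * p)))))"
proof -
  \<comment> \<open>The cap at 1/2 keeps \<open>\<gamma>\<close> below 1 for large
    \<open>\<epsilon>\<close>; a smaller \<open>\<epsilon>'\<close> only asks for more
    rounds.\<close>
  define \<epsilon>' where "\<epsilon>' = min \<epsilon> (1/2)"
  \<comment> \<open>Five factors cost at most \<open>5 * \<gamma> = \<epsilon>' / 2\<close>; the
    other half of \<open>\<epsilon>'\<close> pays for rounding.\<close>
  define \<gamma> where "\<gamma> = \<epsilon>' / 10"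
  have \<epsilon>': "0 < \<epsilon>'" "\<epsilon>' \<le> 1/2" "\<epsilon>' \<le> \<epsilon>" using \<epsilon> by (auto simp: \<epsilon>'_def)
  have \<gamma>: "0 < \<gamma>" "\<gamma> \<le> 1/20" "\<gamma> < 1" using \<epsilon>' by (auto simp: \<gamma>_def)
  have rate: "tail_rate \<gamma> > 0" by (rule tail_rate_pos[OF \<gamma>(1,3)])
  \<comment> \<open>The number of classes: it brings the edge probability \<open>p / m\<close> of a
    class below \<open>\<gamma>\<close>, whence \<open>a \<le> \<gamma>\<close>.\<close>
  define m where "m = nat \<lceil>1 / \<gamma>\<rceil>"
  have m\<gamma>: "1 / \<gamma> \<le> real m" unfolding m_def by (simp add: real_nat_ceiling_ge)
  have m0: "m > 0" using m\<gamma> \<gamma>(1) by (cases "m = 0") (auto simp: field_simps)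
  define c where "c = tail_rate \<gamma> * (1 - \<gamma>) ^ 3 / (2 * m)"
  have c0: "c > 0" unfolding c_def using rate \<gamma> m0 by (intro divide_pos_pos mult_pos_pos) auto
  \<comment> \<open>Pools of size \<open>(1 - \<gamma>) ^ 4 * x / (2 * m)\<close> are guaranteed,
    with \<open>x = \<delta> * p\<close>; division by \<open>k\<close> leaves \<open>q * x\<close>
    positions per slot.\<close>
  define q where "q = (1 - \<gamma>) ^ 4 / (2 * k * m)"
  have q0: "q > 0" unfolding q_def using \<gamma> m0 k by (intro divide_pos_pos) auto
  \<comment> \<open>The thresholds ensure, in this order,
    \<open>k / \<delta> \<le> \<gamma>\<close>, \<open>q * x \<ge> 2\<close>, and a total rounding
    loss of at most the fraction \<open>\<epsilon>' / 2\<close> of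
    \<open>x / (2 * k)\<close>.\<close>
  define c0 where "c0 = max (2 * k / \<gamma>) (max (2 / q) (8 * k * m / \<epsilon>'))"
  \<comment> \<open>Twice the constant 8 of \<open>random_matchings\<close>, because rounding down
    is only known to leave \<open>N \<ge> q * x / 2\<close>.\<close>
  define L where "L = 16 / (tail_rate \<gamma> * q)"
  show ?thesis
  proof (rule exI[of _ c0], rule exI[of _ L], rule exI[of _ c], rule exI[of _ "real m"], intro conjI allI impI \<open>c > 0\<close>)
    fix G :: "'v ugraph" and p \<delta> :: real and n :: nat
    assume G: "simple_graph G" "card (verts G) = n" and n: "n > 0" and p: "0 < p" "p \<le> 1" and \<delta>: "\<delta> = real (min_degree G)"
      and \<delta>1: "\<delta> * p \<ge> c0" and \<delta>2: "\<delta> * p \<ge> L * ln (real (k * n) + 1)"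
    define t where "t = nat \<lfloor>(1 - \<epsilon>) * (\<delta> * p / (2 * real k))\<rfloor>"
    define x where "x = \<delta> * p"
    have x0: "x \<ge> 2 * k / \<gamma>" "x \<ge> 2 / q" "x \<ge> 8 * k * m / \<epsilon>'" using \<delta>1 by (auto simp: c0_def x_def)
    have k0: "real k > 0" using k by simp
    have xpos: "x > 0"
    proof -
      have "2 * real k / \<gamma> > 0" using k0 \<gamma>(1) by simp
      then show ?thesis using x0(1) by linarith
    qed
    have \<delta>x: "x \<le> \<delta>" unfolding x_def using p \<delta> by (simp add: mult_left_le)
    have \<delta>pos: "\<delta> > 0" using xpos \<delta>x by linarith
    have k\<delta>: "k / \<delta> \<le> \<gamma>"
    proof -
      have "2 * k / \<gamma> \<le> \<delta>" using x0(1) \<delta>x by linarith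
      then have "2 * real k \<le> \<delta> * \<gamma>" using \<gamma>(1) by (simp add: field_simps)
      then show ?thesis using \<delta>pos k0 by (simp add: field_simps)
    qed
    have k_less: "real k < \<delta>"
    proof -
      have "real k \<le> \<gamma> * \<delta>" using k\<delta> \<delta>pos by (simp add: field_simps)
      also have "\<dots> < 1 * \<delta>" using \<gamma>(3) \<delta>pos by (intro mult_strict_right_mono)
      finally show ?thesis by simp
    qed
    define \<pi> where "\<pi> = 1 - k / \<delta>"
    have \<pi>: "1 - \<gamma> \<le> \<pi>" using k\<delta> by (simp add: \<pi>_def)
    define p' where "p' = p / m"
    have p': "0 < p'" "p' \<le> \<gamma>"
    proof -
      show "0 < p'" using p m0 by (simp add: p'_def)
      have "p' \<le> 1 / m" unfolding p'_def using p m0 by (intro divide_right_mono) auto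
      also have "\<dots> \<le> \<gamma>" using m\<gamma> m0 \<gamma>(1) by (simp add: field_simps)
      finally show "p' \<le> \<gamma>" .
    qed
    \<comment> \<open>The root of \<open>2 * a - a\<^sup>2 = p'\<close> in the unit interval, so
      that two coins of probability \<open>a\<close> produce a graph of density
      \<open>p'\<close>.\<close>
    define a where "a = 1 - sqrt (1 - p')"
    have p'1: "p' \<le> 1" using p'(2) \<gamma>(3) by linarith
    have a: "0 \<le> a" "a \<le> 1" using p'(1) p'1 by (auto simp: a_def)
    have pa: "p' = 2 * a - a\<^sup>2" using p'1 by (simp add: a_def power2_eq_square algebra_simps)
    have a1: "p' / 2 \<le> a" using pa by simp
    have a2: "a \<le> \<gamma>"
    proof -
      have "a * 1 \<le> a * (2 - a)" using a by (intro mult_left_mono) auto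
      then have "a \<le> p'" by (simp add: pa power2_eq_square algebra_simps)
      then show ?thesis using p'(2) by linarith
    qed
    have \<beta>: "(1 - \<gamma>) * (p' / 2) \<le> a * (1 - a)"
    proof -
      have "(p' / 2) * (1 - \<gamma>) \<le> a * (1 - a)" using a1 a2 a \<gamma>(3) p' by (intro mult_mono) auto
      then show ?thesis by (simp add: mult.commute)
    qed
    have big: "(1 - \<gamma>) ^ 3 * (x / (2 * m)) \<le> (a * (1 - a)) * ((1 - \<gamma>) * \<pi> * \<delta>)"
    proof -
      have h1: "(1 - \<gamma>) * (1 - \<gamma>) * \<delta> \<le> (1 - \<gamma>) * \<pi> * \<delta>"
        using \<pi> \<gamma>(3) \<delta>pos by (intro mult_right_mono mult_left_mono) auto
      have "((1 - \<gamma>) * (p' / 2)) * ((1 - \<gamma>) * (1 - \<gamma>) * \<delta>) \<le> (a * (1 - a)) * ((1 - \<gamma>) * \<pi> * \<delta>)"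
        by (rule mult_mono[OF \<beta> h1]) (use a \<gamma>(3) \<delta>pos in auto)
      moreover have "((1 - \<gamma>) * (p' / 2)) * ((1 - \<gamma>) * (1 - \<gamma>) * \<delta>) = (1 - \<gamma>) ^ 3 * (x / (2 * m))"
        by (simp add: p'_def x_def power3_eq_cube mult_ac)
      ultimately show ?thesis by simp
    qed
    define N where "N = nat \<lfloor>q * x\<rfloor>"
    have qx: "q * x \<ge> 2" using x0(2) q0 by (simp add: field_simps)
    have N1: "real N \<le> q * x" using q0 xpos by (simp add: N_def)
    have N2: "real N \<ge> q * x - 1" using q0 xpos by (simp add: N_def)
    have kN: "real (k * N) \<le> (1 - \<gamma>) * (a * (1 - a)) * ((1 - \<gamma>) * \<pi> * \<delta>)"
    proof -
      have "real (k * N) \<le> k * (q * x)" using N1 k0 by simp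
      also have "\<dots> = (1 - \<gamma>) * ((1 - \<gamma>) ^ 3 * (x / (2 * m)))" using k0 by (simp add: q_def eval_nat_numeral)
      also have "\<dots> \<le> (1 - \<gamma>) * ((a * (1 - a)) * ((1 - \<gamma>) * \<pi> * \<delta>))"
        using big \<gamma>(3) by (intro mult_left_mono) auto
      finally show ?thesis by (simp only: mult.assoc)
    qed
    define t' where "t' = nat \<lfloor>(1 - \<gamma>) * N\<rfloor>"
    have t'1: "real t' \<le> (1 - \<gamma>) * N" using \<gamma>(3) by (simp add: t'_def)
    have t'2: "real t' \<ge> (1 - \<gamma>) * N - 1" using \<gamma>(3) by (simp add: t'_def)
    have lnN: "8 * ln (real (k * n) + 1) \<le> tail_rate \<gamma> * N"
    proof -
      have "q * x / 2 \<le> N" using N2 qx by linarith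
      then have "tail_rate \<gamma> * (q * x / 2) \<le> tail_rate \<gamma> * N" using rate by simp
      moreover have "8 * ln (real (k * n) + 1) \<le> tail_rate \<gamma> * (q * x / 2)"
        using \<delta>2 rate q0 by (simp add: L_def x_def field_simps)
      ultimately show ?thesis by linarith
    qed
    have tm: "t \<le> m * t'"
    proof -
      define D where "D = x / (2 * k)"
      have D0: "D > 0" using xpos k0 by (simp add: D_def)
      have "(1 - \<gamma>) ^ 5 \<ge> 1 - 5 * \<gamma>"
        using Bernoulli_inequality[of "- \<gamma>" 5] \<gamma>(3) by simp
      then have 1: "(1 - 5 * \<gamma>) * D \<le> (1 - \<gamma>) ^ 5 * D" using D0 by (intro mult_right_mono) auto
      have "(1 - \<gamma>) * (q * x - 1) \<le> (1 - \<gamma>) * N" using N2 \<gamma>(3) by (intro mult_left_mono) auto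
      \<comment> \<open>Each class loses at most one round by rounding \<open>N\<close> and one by
        rounding \<open>t'\<close>.\<close>
      then have "(1 - \<gamma>) * (q * x) - 2 \<le> real t'" using t'2 \<gamma>(1) by (simp add: algebra_simps)
      then have "m * ((1 - \<gamma>) * (q * x) - 2) \<le> m * real t'" by (intro mult_left_mono) auto
      moreover have "m * ((1 - \<gamma>) * (q * x)) = (1 - \<gamma>) ^ 5 * D"
        using m0 k0 by (simp add: q_def D_def eval_nat_numeral)
      ultimately have 2: "(1 - \<gamma>) ^ 5 * D - 2 * m \<le> m * real t'" by (simp add: algebra_simps)
      have "8 * k * m \<le> \<epsilon>' * x" using x0(3) \<epsilon>'(1) by (simp add: field_simps)
      then have 3: "2 * m \<le> (\<epsilon>' / 2) * D" using k0 by (simp add: D_def field_simps)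
      have 4: "(1 - \<epsilon>) * D \<le> (1 - \<epsilon>') * D" using \<epsilon>'(3) D0 by (intro mult_right_mono) auto
      have "(1 - \<epsilon>) * D \<le> m * real t'"
        using 1 2 3 4 by (simp add: \<gamma>_def algebra_simps)
      then have fl: "\<lfloor>(1 - \<epsilon>) * D\<rfloor> \<le> int (m * t')" by (simp add: floor_le_iff)
      have "t = nat \<lfloor>(1 - \<epsilon>) * D\<rfloor>" by (simp add: t_def D_def x_def)
      then show ?thesis using fl by (simp only: nat_le_iff)
    qed
    have \<delta>u: "\<delta> \<le> card (neighbors G u)" if "u \<in> verts G" for u
      using min_degree_le[OF G(1) that] by (simp add: \<delta>)
    obtain W :: "('v colored_graph \<times> (nat \<Rightarrow> 'v set set)) pmf" where
      W1: "map_pmf fst W = random_colored_subgraph (k * n) G p'" and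
      W2: "\<forall>(H, Hs)\<in>set_pmf W. (\<forall>i<t'. Hs i \<subseteq> dom H) \<and> (\<forall>i<t'. \<forall>j<t'. i \<noteq> j \<longrightarrow> Hs i \<inter> Hs j = {})" and
      W3: "measure_pmf.prob W {(H, Hs). \<not> (\<forall>i<t'. rainbow H (Hs i))} \<le> 18 / real (k * n)" and
      W4: "\<forall>i<t'. measure_pmf.prob (k_out k G) {K. P K} \<le> measure_pmf.prob W {(H, Hs). P (verts G, Hs i)} +
       2 * (n * (exp (- (tail_rate \<gamma> * (a * (1 - a)) * ((1 - \<gamma>) * \<pi> * \<delta>))) + exp (- (tail_rate \<gamma> * \<pi> * \<delta>))))"
      using single_class[OF G n _ P a pa \<delta>u k_less \<pi>_def \<gamma>(1,3) kN t'1 lnN] k by auto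
    have err: "2 * (n * (exp (- (tail_rate \<gamma> * (a * (1 - a)) * ((1 - \<gamma>) * \<pi> * \<delta>))) + exp (- (tail_rate \<gamma> * \<pi> * \<delta>))))
        \<le> 4 * real n * exp (- (c * (\<delta> * p)))"
    proof -
      have "c * x = tail_rate \<gamma> * ((1 - \<gamma>) ^ 3 * (x / (2 * m)))" by (simp add: c_def)
      also have "\<dots> \<le> tail_rate \<gamma> * ((a * (1 - a)) * ((1 - \<gamma>) * \<pi> * \<delta>))" using big rate by (intro mult_left_mono) auto
      finally have e1: "exp (- (tail_rate \<gamma> * (a * (1 - a)) * ((1 - \<gamma>) * \<pi> * \<delta>))) \<le> exp (- (c * x))" by (simp add: mult.assoc)
      have "a * (1 - a) * (1 - \<gamma>) \<le> 1" using a \<gamma> by (intro mult_le_one) auto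
      then have "(a * (1 - a) * (1 - \<gamma>)) * (\<pi> * \<delta>) \<le> 1 * (\<pi> * \<delta>)"
        using \<pi> \<gamma>(3) \<delta>pos by (intro mult_right_mono) auto
      then have "tail_rate \<gamma> * ((a * (1 - a)) * ((1 - \<gamma>) * \<pi> * \<delta>)) \<le> tail_rate \<gamma> * (\<pi> * \<delta>)"
        using rate by (simp add: mult.assoc)
      then have e2: "exp (- (tail_rate \<gamma> * \<pi> * \<delta>)) \<le> exp (- (c * x))"
        using \<open>c * x = _\<close> \<open>_ \<le> tail_rate \<gamma> * ((a * (1 - a)) * ((1 - \<gamma>) * \<pi> * \<delta>))\<close> by (simp add: mult.assoc)
      have "real n * (exp (- (tail_rate \<gamma> * (a * (1 - a)) * ((1 - \<gamma>) * \<pi> * \<delta>))) + exp (- (tail_rate \<gamma> * \<pi> * \<delta>))) \<le> n * (2 * exp (- (c * x)))"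
      proof (rule mult_left_mono)
        show "exp (- (tail_rate \<gamma> * (a * (1 - a)) * ((1 - \<gamma>) * \<pi> * \<delta>))) + exp (- (tail_rate \<gamma> * \<pi> * \<delta>)) \<le> 2 * exp (- (c * x))"
          using e1 e2 by linarith
      qed simp
      then show ?thesis by (simp add: x_def)
    qed
    show "has_packing k P G p (nat \<lfloor>(1 - \<epsilon>) * (\<delta> * p / (2 * real k))\<rfloor>) (m * (18 / real (k * n))) (4 * real n * exp (- (c * (\<delta> * p))))"
      unfolding has_packing_def t_def[symmetric] G(2)
    proof (rule combine_classes[OF _ m0 _ p(2) tm _ W2 W3])
      show "map_pmf fst W = random_colored_subgraph (k * n) G (p / m)" using W1 by (simp add: p'_def)
      show "measure_pmf.prob (k_out k G) {K. P K} \<le> measure_pmf.prob W {(H, Hs). P (verts G, Hs i)} + 4 * real n * exp (- (c * (\<delta> * p)))"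
        if "i < t'" for i
        using W4 that err by (meson add_left_mono order_trans)
    qed (use p simple_graph_neighbors(6)[OF G(1)] in auto)
  qed
qed

theorem theorem1p2:
  fixes \<epsilon> :: real and k :: nat and P :: "'v ugraph \<Rightarrow> bool"
    and G :: "nat \<Rightarrow> 'v ugraph" and p :: "nat \<Rightarrow> real" and t :: "nat \<Rightarrow> nat"
  assumes "\<epsilon> > 0" and "k \<ge> 2" and "monotone_increasing P"
    and "\<And>n. simple_graph (G n)" and "\<And>n. card (verts (G n)) = n"
    and "(\<lambda>n. real (min_degree (G n))) \<in> \<omega>(\<lambda>n. ln (real n))"
    and "\<And>n. 0 < p n \<and> p n \<le> 1"
    and "p \<in> \<omega>(\<lambda>n. ln (real n) / real (min_degree (G n)))"
    and "\<And>n. t n = nat \<lfloor>(1 - \<epsilon>) * (real (min_degree (G n)) * p n / (2 * real k))\<rfloor>"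
  shows "\<exists>(M :: nat \<Rightarrow> ('v colored_graph \<times> (nat \<Rightarrow> 'v set set)) pmf) (err :: nat \<Rightarrow> real).
      superpolynomially_small err \<and>
      (\<forall>n. map_pmf fst (M n) = random_colored_subgraph (k * n) (G n) (p n)) \<and>
      (\<forall>n. \<forall>(H, Hs) \<in> set_pmf (M n). \<forall>i\<in>{0..t n}. Hs i \<subseteq> edges (G n)) \<and>
      (\<lambda>n. measure_pmf.prob (M n)
             {(H, Hs). dom H = (\<Union>i\<in>{0..t n}. Hs i) \<and>
                       disjoint_family_on Hs {0..t n} \<and>
                       (\<forall>i\<in>{1..t n}. rainbow H (Hs i))}) \<longlonglongrightarrow> 1 \<and>
      (\<forall>\<^sub>F n in sequentially. \<forall>i\<in>{1..t n}.
         measure_pmf.prob (k_out k (G n)) {K. P K}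
           \<le> measure_pmf.prob (M n) {(H, Hs). P (verts (G n), Hs i)} + err n)"
proof -
  define x where "x n = real (min_degree (G n)) * p n" for n
  have big: "\<forall>\<^sub>F n in sequentially. C * ln (real n) \<le> x n" if C: "C > 0" for C :: real
  proof -
    have "\<forall>\<^sub>F n in sequentially. norm (real (min_degree (G n))) \<ge> 1 * norm (ln (real n))"
      by (rule landau_omega.smallD[OF assms(6)]) simp
    moreover have "\<forall>\<^sub>F n in sequentially. norm (p n) \<ge> C * norm (ln (real n) / real (min_degree (G n)))"
      by (rule landau_omega.smallD[OF assms(8) C])
    moreover have "\<forall>\<^sub>F n in sequentially. n \<ge> (2::nat)" by (rule eventually_ge_at_top)
    ultimately show ?thesis
    proof eventually_elim
      case (elim n)
      have ln0: "ln (real n) > 0" using elim(3) by simp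
      \<comment> \<open>The degree hypothesis excludes minimum degree 0, for which the quotient in
        the hypothesis on \<open>p\<close> would be 0 by convention and give no information.\<close>
      then have d: "real (min_degree (G n)) > 0" using elim(1) by (cases "min_degree (G n) = 0") auto
      have "C * (ln (real n) / real (min_degree (G n))) \<le> p n" using elim(2) ln0 d assms(7)[of n] by simp
      then show ?case using d by (simp add: x_def field_simps)
    qed
  qed
  have "k \<ge> 1" using assms(2) by simp
  from rainbow_packing[OF assms(1) this assms(3)] obtain c0 L c m where c: "c > 0" and
    pack: "\<forall>(G :: 'v ugraph) (p :: real) (n :: nat) (\<delta> :: real).
     simple_graph G \<longrightarrow> card (verts G) = n \<longrightarrow> n > 0 \<longrightarrow> 0 < p \<longrightarrow> p \<le> 1 \<longrightarrow> \<delta> = real (min_degree G) \<longrightarrow>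
     \<delta> * p \<ge> c0 \<longrightarrow> \<delta> * p \<ge> L * ln (real (k * n) + 1) \<longrightarrow>
     has_packing k P G p (nat \<lfloor>(1 - \<epsilon>) * (\<delta> * p / (2 * real k))\<rfloor>) (m * (18 / real (k * n))) (4 * real n * exp (- (c * (\<delta> * p))))"
    by (elim exE conjE) (rule that)
  \<comment> \<open>The law of \<open>H\<close> and the inclusion in \<open>G n\<close> are claimed
    for every \<open>n\<close>, the construction works for large \<open>n\<close> only. Other
    \<open>n\<close> are served by empty subgraphs, so \<open>spec\<close> demands the remaining
    properties under \<open>Good n\<close>.\<close>
  define Good where "Good n \<longleftrightarrow> n > 0 \<and> x n \<ge> c0 \<and> x n \<ge> L * ln (real (k * n) + 1)" for n
  define err where "err n = 4 * real n * exp (- (c * x n))" for n :: nat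
  define spec where "spec n M \<longleftrightarrow> map_pmf fst M = random_colored_subgraph (k * n) (G n) (p n) \<and>
      (\<forall>(H, Hs) \<in> set_pmf M. \<forall>i\<in>{0..t n}. Hs i \<subseteq> edges (G n)) \<and>
      (Good n \<longrightarrow> measure_pmf.prob M (packing_event (t n)) \<ge> 1 - m * (18 / real (k * n)) \<and>
        (\<forall>i\<in>{1..t n}. measure_pmf.prob (k_out k (G n)) {K. P K} \<le> measure_pmf.prob M {(H, Hs). P (verts (G n), Hs i)} + err n))"
    for n and M :: "('v colored_graph \<times> (nat \<Rightarrow> 'v set set)) pmf"
  have "\<exists>M. spec n M" for n
  proof (cases "Good n")
    case True
    then show ?thesis
      using pack[rule_format, OF assms(4) assms(5), of n "p n"] assms(5,7)
      unfolding Good_def x_def spec_def err_def has_packing_def assms(9) by simp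
  next
    case False
    then have "spec n (map_pmf (\<lambda>H. (H, \<lambda>_. {})) (random_colored_subgraph (k * n) (G n) (p n)))"
      by (auto simp: spec_def pmf.map_comp o_def)
    then show ?thesis by blast
  qed
  then obtain M where M: "\<And>n. spec n (M n)" by metis
  have evGood: "\<forall>\<^sub>F n in sequentially. Good n"
  proof -
    have "\<forall>\<^sub>F n in sequentially. max 1 c0 * ln (real n) \<le> x n" by (rule big) simp
    moreover have "\<forall>\<^sub>F n in sequentially. max 1 (2 * L) * ln (real n) \<le> x n" by (rule big) simp
    \<comment> \<open>\<open>n \<ge> 3\<close> yields \<open>ln (real n) \<ge> 1\<close>, and
      \<open>n \<ge> k + 1\<close> yields \<open>k * n + 1 \<le> n * n\<close>, so the logarithm of
      the number of colours is at most twice that of \<open>n\<close>.\<close>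
    moreover have "\<forall>\<^sub>F n in sequentially. n \<ge> max 3 (k + 1)" by (rule eventually_ge_at_top)
    ultimately show ?thesis
    proof eventually_elim
      case (elim n)
      have n: "n \<ge> 3" "n \<ge> k + 1" using elim(3) by auto
      have ln1: "ln (real n) \<ge> 1"
      proof -
        have "exp 1 \<le> real n" using n(1) exp_le by linarith
        then show ?thesis using n(1) by (simp add: ln_ge_iff)
      qed
      have "c0 \<le> max 1 c0 * 1" by simp
      also have "\<dots> \<le> max 1 c0 * ln (real n)" using ln1 by (intro mult_left_mono) auto
      finally have 1: "c0 \<le> x n" using elim(1) by linarith
      have 2: "L * ln (real (k * n) + 1) \<le> x n"
      proof -
        have "k * n + 1 \<le> (k + 1) * n" using n(1) by simp
        also have "\<dots> \<le> n * n" using n(2) by (intro mult_right_mono) auto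
        finally have le: "real (k * n) + 1 \<le> real n * real n" by (metis of_nat_1 of_nat_add of_nat_le_iff of_nat_mult)
        have "0 < real (k * n) + 1" by (simp only: add_nonneg_pos of_nat_0_le_iff zero_less_one)
        moreover have "0 < real n * real n" using n(1) by simp
        ultimately have "ln (real (k * n) + 1) \<le> ln (real n * real n)" using le ln_le_cancel_iff by blast
        also have "\<dots> = 2 * ln (real n)" using n(1) by (simp add: ln_mult)
        finally have l: "ln (real (k * n) + 1) \<le> 2 * ln (real n)" .
        have l0: "0 \<le> ln (real (k * n) + 1)" by simp
        show ?thesis
        proof (cases "L \<le> 0")
          case True
          then have "L * ln (real (k * n) + 1) \<le> 0" using l0 by (simp add: mult_nonpos_nonneg)
          also have "0 \<le> max 1 (2 * L) * ln (real n)" using ln1 by (intro mult_nonneg_nonneg) auto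
          finally show ?thesis using elim(2) by linarith
        next
          case False
          then have "L * ln (real (k * n) + 1) \<le> L * (2 * ln (real n))" using l by (intro mult_left_mono) auto
          also have "\<dots> = (2 * L) * ln (real n)" by simp
          also have "\<dots> \<le> max 1 (2 * L) * ln (real n)" using ln1 by (intro mult_right_mono) auto
          finally show ?thesis using elim(2) by linarith
        qed
      qed
      show ?case using 1 2 n by (simp add: Good_def)
    qed
  qed
  have small: "superpolynomially_small err"
    unfolding superpolynomially_small_def
  proof
    fix C :: real
    \<comment> \<open>Of the three extra powers of \<open>n\<close>, one cancels the factor
      \<open>n\<close> in \<open>err\<close> and one the factor 4, for which
      \<open>n \<ge> 5\<close> is required.\<close>
    have "\<forall>\<^sub>F n in sequentially. ((\<bar>C\<bar> + 3) / c) * ln (real n) \<le> x n" by (rule big) (use c in auto)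
    moreover have "\<forall>\<^sub>F n in sequentially. n \<ge> (5::nat)" by (rule eventually_ge_at_top)
    ultimately show "\<forall>\<^sub>F n in sequentially. \<bar>err n\<bar> < real n powr (- C)"
    proof eventually_elim
      case (elim n)
      have n: "real n > 0" "real n \<ge> 5" using elim(2) by auto
      have "(\<bar>C\<bar> + 3) * ln (real n) \<le> c * x n" using elim(1) c by (simp add: field_simps)
      then have "exp (- (c * x n)) \<le> exp (- ((\<bar>C\<bar> + 3) * ln (real n)))" by simp
      also have "\<dots> = real n powr (- (\<bar>C\<bar> + 3))" using n by (simp add: powr_def algebra_simps)
      finally have "err n \<le> 4 * real n * real n powr (- (\<bar>C\<bar> + 3))" unfolding err_def by (intro mult_left_mono) auto
      also have "\<dots> < real n * real n * real n powr (- (\<bar>C\<bar> + 3))" using n by (intro mult_strict_right_mono) auto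
      also have "\<dots> = real n powr 2 * real n powr (- (\<bar>C\<bar> + 3))" using n by (simp add: power2_eq_square)
      also have "\<dots> = real n powr (- \<bar>C\<bar> - 1)"
      proof -
        have "2 + - (\<bar>C\<bar> + 3) = - \<bar>C\<bar> - 1" by simp
        then show ?thesis by (simp only: powr_add[symmetric])
      qed
      also have "\<dots> \<le> real n powr (- C)" using n by (intro powr_mono) auto
      finally show ?case by (simp add: err_def)
    qed
  qed
  have lim: "(\<lambda>n. measure_pmf.prob (M n) (packing_event (t n))) \<longlonglongrightarrow> 1"
  proof (rule tendsto_sandwich)
    show "\<forall>\<^sub>F n in sequentially. 1 - m * (18 / real (k * n)) \<le> measure_pmf.prob (M n) (packing_event (t n))"
      using evGood by eventually_elim (use M in \<open>auto simp: spec_def\<close>)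
    show "\<forall>\<^sub>F n in sequentially. measure_pmf.prob (M n) (packing_event (t n)) \<le> 1" by simp
    have "(\<lambda>n. 1 - (m * 18 / k) * inverse (real n)) \<longlonglongrightarrow> 1 - (m * 18 / k) * 0"
      by (intro tendsto_intros lim_inverse_n)
    then show "(\<lambda>n. 1 - m * (18 / real (k * n))) \<longlonglongrightarrow> 1"
      by (simp add: divide_inverse mult.assoc)
  qed simp
  have dom: "\<forall>\<^sub>F n in sequentially. \<forall>i\<in>{1..t n}.
         measure_pmf.prob (k_out k (G n)) {K. P K} \<le> measure_pmf.prob (M n) {(H, Hs). P (verts (G n), Hs i)} + err n"
    using evGood by eventually_elim (use M in \<open>auto simp: spec_def\<close>)
  show ?thesis
    using small lim dom M unfolding packing_event_def spec_def by (intro exI[of _ M] exI[of _ err]) blast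
qed

end
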